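(* Let $\varphi \in C(\Gamma)$. Then the following are equivalent. (i) $T\varphi \in H^1(\Omega)$. (ii) $T^{-\Delta}\varphi \in H^1(\Omega)$.
   Context: Setting: $d \ge 2$, $\Omega \subset \mathbb R^d$ is open and bounded with boundary $\Gamma = \partial\Omega$; functions are complex-valued unless said otherwise. For $k,l \in \{1,\ldots,d\}$, $a_{kl} \colon \Omega \to \mathbb R$ is bounded and measurable, and there is $\mu \in (0,1]$ with $\mathrm{Re} \sum_{k,l=1}^d a_{kl}(x)\,\xi_k\,\overline{\xi_l} \ge \mu|\xi|^2$ for all $x \in \Omega$, $\xi \in \mathbb C^d$. Further $b_k, c_0 \colon \Omega \to \mathbb C$ and $c_k \colon \Omega \to \mathbb R$ ($k=1,\ldots,d$) are bounded and measurable. $\mathcal D'(\Omega)$ is the antidual of $\mathcal D(\Omega) = C_c^\infty(\Omega)$. Define $\mathcal A \colon H^1_{\mathrm{loc}}(\Omega) \to \mathcal D'(\Omega)$ by $$\langle \mathcal A u, v\rangle = \sum_{k,l=1}^d \int_\Omega a_{kl}(\partial_l u)\overline{\partial_k v} + \sum_{k=1}^d \int_\Omega b_k u\,\overline{\partial_k v} + \sum_{k=1}^d \int_\Omega c_k(\partial_k u)\overline v + \int_\Omega c_0 u \overline v$$ for $v \in C_c^\infty(\Omega)$. A function $u$ is called $\mathcal A$-harmonic if $u \in H^1_{\mathrm{loc}}(\Omega)$ and $\mathcal A u = 0$. Standing assumption: $0$ is not a Dirichlet eigenvalue, i.e. if $u \in H^1_0(\Omega)$ and $\mathcal A u = 0$,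 then $u = 0$. Perron solution operator: $T = T^{\mathcal A} \colon C(\Gamma) \to C_b(\Omega)$ is the unique bounded linear map (supremum norms; $C_b(\Omega)$ is the space of bounded continuous functions) such that $T\varphi$ is $\mathcal A$-harmonic for all $\varphi \in C(\Gamma)$ and $\Phi|_\Omega - T(\Phi|_\Gamma) \in H^1_0(\Omega)$ for all $\Phi \in C(\overline\Omega)\cap H^1(\Omega)$. Such a map exists and is unique. $T^{-\Delta}$ denotes this operator in the special case $\mathcal A = -\Delta$, i.e. $a_{kl} = \delta_{kl}$, $b_k = c_k = c_0 = 0$. *)

theory Defs
  imports "HOL-Analysis.Analysis"
begin

text \<open>
  Functions on an open set \<open>\<Omega>\<close> (or on its boundary or closure) are represented by total functions
  on \<open>real ^ 'n\<close>; every notion below depends only on the values on the set in question.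
  Measurability and integrals are with respect to Lebesgue measure.
\<close>

section \<open>Test functions\<close>

definition partial :: "'n::finite \<Rightarrow> (real ^ 'n \<Rightarrow> complex) \<Rightarrow> real ^ 'n \<Rightarrow> complex" where
  "partial k f x = frechet_derivative f (at x) (axis k 1)"

primrec C_k :: "nat \<Rightarrow> (real ^ 'n::finite \<Rightarrow> complex) \<Rightarrow> bool" where
  "C_k 0 f \<longleftrightarrow> continuous_on UNIV f"
| "C_k (Suc m) f \<longleftrightarrow> f differentiable_on UNIV \<and> (\<forall>k. C_k m (partial k f))"

text \<open>\<open>C\<^sub>c\<^sup>\<infinity>(\<Omega>)\<close>; its elements are extended by zero outside \<open>\<Omega>\<close>.\<close>

definition test_functions :: "(real ^ 'n::finite) set \<Rightarrow> (real ^ 'n \<Rightarrow> complex) set" where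
  "test_functions \<Omega> =
     {v. (\<forall>m. C_k m v) \<and> compact (closure {x. v x \<noteq> 0}) \<and> closure {x. v x \<noteq> 0} \<subseteq> \<Omega>}"

section \<open>Sobolev spaces\<close>

definition L2 :: "(real ^ 'n::finite) set \<Rightarrow> (real ^ 'n \<Rightarrow> complex) set" where
  "L2 S = {u \<in> borel_measurable (lebesgue_on S). integrable (lebesgue_on S) (\<lambda>x. (norm (u x))\<^sup>2)}"

definition L1_loc :: "(real ^ 'n::finite) set \<Rightarrow> (real ^ 'n \<Rightarrow> complex) set" where
  "L1_loc \<Omega> = {u. \<forall>K. compact K \<and> K \<subseteq> \<Omega> \<longrightarrow> integrable (lebesgue_on K) u}"

definition L2_loc :: "(real ^ 'n::finite) set \<Rightarrow> (real ^ 'n \<Rightarrow> complex) set" where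
  "L2_loc \<Omega> = {u. \<forall>K. compact K \<and> K \<subseteq> \<Omega> \<longrightarrow> u \<in> L2 K}"

definition has_weak_partial ::
  "(real ^ 'n::finite) set \<Rightarrow> 'n \<Rightarrow> (real ^ 'n \<Rightarrow> complex) \<Rightarrow> (real ^ 'n \<Rightarrow> complex) \<Rightarrow> bool" where
  "has_weak_partial \<Omega> k u g \<longleftrightarrow> u \<in> L1_loc \<Omega> \<and> g \<in> L1_loc \<Omega> \<and>
     (\<forall>v\<in>test_functions \<Omega>.
        (LINT x|lebesgue_on \<Omega>. u x * partial k v x) = - (LINT x|lebesgue_on \<Omega>. g x * v x))"

text \<open>A weak derivative is determined only almost everywhere; an arbitrary representative is
  chosen.  It is used only under integrals.\<close>

definition weak_partial ::
  "(real ^ 'n::finite) set \<Rightarrow> 'n \<Rightarrow> (real ^ 'n \<Rightarrow> complex) \<Rightarrow> real ^ 'n \<Rightarrow> complex" where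
  "weak_partial \<Omega> k u = (SOME g. has_weak_partial \<Omega> k u g)"

definition H1 :: "(real ^ 'n::finite) set \<Rightarrow> (real ^ 'n \<Rightarrow> complex) set" where
  "H1 \<Omega> = {u \<in> L2 \<Omega>. \<forall>k. \<exists>g\<in>L2 \<Omega>. has_weak_partial \<Omega> k u g}"

definition H1_loc :: "(real ^ 'n::finite) set \<Rightarrow> (real ^ 'n \<Rightarrow> complex) set" where
  "H1_loc \<Omega> = {u \<in> L2_loc \<Omega>. \<forall>k. \<exists>g\<in>L2_loc \<Omega>. has_weak_partial \<Omega> k u g}"

definition H1_norm :: "(real ^ 'n::finite) set \<Rightarrow> (real ^ 'n \<Rightarrow> complex) \<Rightarrow> real" where
  "H1_norm \<Omega> u = sqrt ((LINT x|lebesgue_on \<Omega>. (norm (u x))\<^sup>2) +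
     (\<Sum>k\<in>UNIV. LINT x|lebesgue_on \<Omega>. (norm (weak_partial \<Omega> k u x))\<^sup>2))"

text \<open>The closure of the test functions in \<open>H\<^sup>1(\<Omega>)\<close>.\<close>

definition H1_0 :: "(real ^ 'n::finite) set \<Rightarrow> (real ^ 'n \<Rightarrow> complex) set" where
  "H1_0 \<Omega> = {u \<in> H1 \<Omega>. \<forall>\<epsilon>>0. \<exists>v\<in>test_functions \<Omega>. H1_norm \<Omega> (\<lambda>x. u x - v x) < \<epsilon>}"

section \<open>The elliptic operator\<close>

definition elliptic_coefficients ::
  "(real ^ 'n::finite) set \<Rightarrow> ('n \<Rightarrow> 'n \<Rightarrow> real ^ 'n \<Rightarrow> real) \<Rightarrow> ('n \<Rightarrow> real ^ 'n \<Rightarrow> complex) \<Rightarrow>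
   ('n \<Rightarrow> real ^ 'n \<Rightarrow> real) \<Rightarrow> (real ^ 'n \<Rightarrow> complex) \<Rightarrow> bool" where
  "elliptic_coefficients \<Omega> a b c c\<^sub>0 \<longleftrightarrow>
     (\<forall>k l. a k l \<in> borel_measurable (lebesgue_on \<Omega>) \<and> bounded (a k l ` \<Omega>)) \<and>
     (\<forall>k. b k \<in> borel_measurable (lebesgue_on \<Omega>) \<and> bounded (b k ` \<Omega>)) \<and>
     (\<forall>k. c k \<in> borel_measurable (lebesgue_on \<Omega>) \<and> bounded (c k ` \<Omega>)) \<and>
     c\<^sub>0 \<in> borel_measurable (lebesgue_on \<Omega>) \<and> bounded (c\<^sub>0 ` \<Omega>) \<and>
     (\<exists>\<mu>. 0 < \<mu> \<and> \<mu> \<le> 1 \<and>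
        (\<forall>x\<in>\<Omega>. \<forall>\<xi> :: complex ^ 'n.
           Re (\<Sum>k\<in>UNIV. \<Sum>l\<in>UNIV. of_real (a k l x) * \<xi> $ k * cnj (\<xi> $ l)) \<ge> \<mu> * (norm \<xi>)\<^sup>2))"

text \<open>\<open>elliptic_op \<Omega> a b c c\<^sub>0 u v\<close> is the pairing of the distribution \<open>\<A> u\<close> with the test
  function \<open>v\<close>.\<close>

definition elliptic_op ::
  "(real ^ 'n::finite) set \<Rightarrow> ('n \<Rightarrow> 'n \<Rightarrow> real ^ 'n \<Rightarrow> real) \<Rightarrow> ('n \<Rightarrow> real ^ 'n \<Rightarrow> complex) \<Rightarrow>
   ('n \<Rightarrow> real ^ 'n \<Rightarrow> real) \<Rightarrow> (real ^ 'n \<Rightarrow> complex) \<Rightarrow>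
   (real ^ 'n \<Rightarrow> complex) \<Rightarrow> (real ^ 'n \<Rightarrow> complex) \<Rightarrow> complex" where
  "elliptic_op \<Omega> a b c c\<^sub>0 u v =
     (\<Sum>k\<in>UNIV. \<Sum>l\<in>UNIV.
        LINT x|lebesgue_on \<Omega>. of_real (a k l x) * weak_partial \<Omega> l u x * cnj (partial k v x)) +
     (\<Sum>k\<in>UNIV. LINT x|lebesgue_on \<Omega>. b k x * u x * cnj (partial k v x)) +
     (\<Sum>k\<in>UNIV. LINT x|lebesgue_on \<Omega>. of_real (c k x) * weak_partial \<Omega> k u x * cnj (v x)) +
     (LINT x|lebesgue_on \<Omega>. c\<^sub>0 x * u x * cnj (v x))"

definition harmonic ::
  "(real ^ 'n::finite) set \<Rightarrow> ('n \<Rightarrow> 'n \<Rightarrow> real ^ 'n \<Rightarrow> real) \<Rightarrow> ('n \<Rightarrow> real ^ 'n \<Rightarrow> complex) \<Rightarrow>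
   ('n \<Rightarrow> real ^ 'n \<Rightarrow> real) \<Rightarrow> (real ^ 'n \<Rightarrow> complex) \<Rightarrow> (real ^ 'n \<Rightarrow> complex) \<Rightarrow> bool" where
  "harmonic \<Omega> a b c c\<^sub>0 u \<longleftrightarrow>
     u \<in> H1_loc \<Omega> \<and> (\<forall>v\<in>test_functions \<Omega>. elliptic_op \<Omega> a b c c\<^sub>0 u v = 0)"

definition zero_Dirichlet_eigenvalue ::
  "(real ^ 'n::finite) set \<Rightarrow> ('n \<Rightarrow> 'n \<Rightarrow> real ^ 'n \<Rightarrow> real) \<Rightarrow> ('n \<Rightarrow> real ^ 'n \<Rightarrow> complex) \<Rightarrow>
   ('n \<Rightarrow> real ^ 'n \<Rightarrow> real) \<Rightarrow> (real ^ 'n \<Rightarrow> complex) \<Rightarrow> bool" where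
  "zero_Dirichlet_eigenvalue \<Omega> a b c c\<^sub>0 \<longleftrightarrow>
     (\<exists>u\<in>H1_0 \<Omega>. (\<forall>v\<in>test_functions \<Omega>. elliptic_op \<Omega> a b c c\<^sub>0 u v = 0) \<and>
        \<not> (AE x in lebesgue_on \<Omega>. u x = 0))"

section \<open>The Perron solution operator\<close>

text \<open>\<open>T\<close> acts on functions that are continuous on \<open>\<Gamma> = frontier \<Omega>\<close>; its values are regarded as
  functions on \<open>\<Omega>\<close>.  By linearity and the supremum norm bound, \<open>T \<phi>\<close> on \<open>\<Omega>\<close> depends only on the
  restriction of \<open>\<phi>\<close> to \<open>\<Gamma>\<close>.  The norm bound is stated pointwise in \<open>\<Omega>\<close>, which avoids the supremum
  of an empty set of reals when \<open>\<Omega>\<close> is empty.\<close>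

definition perron_operator ::
  "(real ^ 'n::finite) set \<Rightarrow> ('n \<Rightarrow> 'n \<Rightarrow> real ^ 'n \<Rightarrow> real) \<Rightarrow> ('n \<Rightarrow> real ^ 'n \<Rightarrow> complex) \<Rightarrow>
   ('n \<Rightarrow> real ^ 'n \<Rightarrow> real) \<Rightarrow> (real ^ 'n \<Rightarrow> complex) \<Rightarrow>
   ((real ^ 'n \<Rightarrow> complex) \<Rightarrow> real ^ 'n \<Rightarrow> complex) \<Rightarrow> bool" where
  "perron_operator \<Omega> a b c c\<^sub>0 T \<longleftrightarrow>
     (\<forall>\<phi>. continuous_on (frontier \<Omega>) \<phi> \<longrightarrow>
        continuous_on \<Omega> (T \<phi>) \<and> bounded (T \<phi> ` \<Omega>)) \<and>
     (\<forall>\<phi> \<psi>. continuous_on (frontier \<Omega>) \<phi> \<and> continuous_on (frontier \<Omega>) \<psi> \<longrightarrow>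
        (\<forall>x\<in>\<Omega>. T (\<lambda>z. \<phi> z + \<psi> z) x = T \<phi> x + T \<psi> x)) \<and>
     (\<forall>\<alpha> \<phi>. continuous_on (frontier \<Omega>) \<phi> \<longrightarrow>
        (\<forall>x\<in>\<Omega>. T (\<lambda>z. \<alpha> * \<phi> z) x = \<alpha> * T \<phi> x)) \<and>
     (\<exists>M. \<forall>\<phi>. continuous_on (frontier \<Omega>) \<phi> \<longrightarrow>
        (\<forall>x\<in>\<Omega>. norm (T \<phi> x) \<le> M * (SUP z\<in>frontier \<Omega>. norm (\<phi> z)))) \<and>
     (\<forall>\<phi>. continuous_on (frontier \<Omega>) \<phi> \<longrightarrow> harmonic \<Omega> a b c c\<^sub>0 (T \<phi>)) \<and>
     (\<forall>\<Phi>. continuous_on (closure \<Omega>) \<Phi> \<and> \<Phi> \<in> H1 \<Omega> \<longrightarrow> (\<lambda>x. \<Phi> x - T \<Phi> x) \<in> H1_0 \<Omega>)"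

definition perron_operator_neg_Laplace ::
  "(real ^ 'n::finite) set \<Rightarrow> ((real ^ 'n \<Rightarrow> complex) \<Rightarrow> real ^ 'n \<Rightarrow> complex) \<Rightarrow> bool" where
  "perron_operator_neg_Laplace \<Omega> T \<longleftrightarrow>
     perron_operator \<Omega> (\<lambda>k l x. if k = l then 1 else 0) (\<lambda>k x. 0) (\<lambda>k x. 0) (\<lambda>x. 0) T"

end

theory Submission
  imports Defs
begin

text \<open>
  Let \<open>S\<close> be any Perron operator with \<open>w = S \<phi>\<close> in \<open>H\<^sup>1\<close>; it suffices to show that the positive part
  of \<open>Re (T \<phi> - w)\<close> lies in \<open>H\<^sup>1\<close>, and then to replace \<open>\<phi>\<close> by \<open>- \<phi>\<close> and \<open>\<plusminus> \<i> \<phi>\<close>.  Choose a polynomial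
  \<open>\<Phi>\<close> that is close to \<open>\<phi>\<close> on the boundary.  Then \<open>T \<Phi> - w = h + g\<close> where \<open>h = T \<Phi> - S \<Phi>\<close> is in \<open>H\<^sup>1\<^sub>0\<close>
  and \<open>g = S \<Phi> - S \<phi>\<close> satisfies \<open>\<bar>g\<bar> \<le> \<epsilon>\<close>.  Hence a smooth truncation \<open>\<psi>\<close> of \<open>(Re (T \<Phi> - w) - 2 \<epsilon>)\<^sup>+\<close>
  is an admissible test function.  Because \<open>a\<^sub>k\<^sub>l\<close> and \<open>c\<^sub>k\<close> are real, the real part of
  \<open>\<langle>\<A> (T \<Phi>), \<psi>\<rangle> = 0\<close> bounds the gradient of \<open>\<psi>\<close> in \<open>L\<^sup>2\<close> by norms of \<open>w\<close> in \<open>H\<^sup>1\<close> and of \<open>T \<Phi>\<close>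
  in \<open>L\<^sup>2\<close>, uniformly in \<open>\<epsilon>\<close>; letting \<open>\<epsilon>\<close> tend to \<open>0\<close> gives the claim.  To work with classical derivatives only, \<open>h\<close> is replaced by a test
  function and \<open>g\<close> by a smooth function on the support of that test function.
\<close>

section \<open>Smooth functions\<close>

text \<open>Nothing controls the gradient of \<open>T \<Phi>\<close> itself as \<Phi> approaches
  \<phi>. What stays bounded is the gradient of \<open>T \<Phi> - f\<close>, where \<open>f\<close>
  is the function being truncated: \<open>f\<close> is close to \<open>T \<Phi> - w\<close>, so this
  difference is close to \<open>w\<close>. The energy identity is therefore split along \<nabla>(T
  \<Phi>) = \<nabla> f + \<nabla>(T \<Phi> - f): the first part yields coercivity and the second is
  absorbed. Lower-order coefficients carry no sign, so the form as a whole need not be coercive;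
  their contribution is paid for by \<open>L2\<close> norms, which the supremum bound of the Perron
  operators keeps uniform. The shift by 2 \<epsilon> also secures compact support. Off the support
  of the test function replacing \<open>h\<close>, the real part of \<open>f\<close> is at most
  \<epsilon> - 2 \<epsilon> < 0, so the truncation vanishes there and no regularity of the boundary
  enters.\<close>

lemma C_k_continuous: "C_k m f \<Longrightarrow> continuous_on UNIV f"
  by (cases m) (auto intro: differentiable_imp_continuous_on)

lemma C_k_SucD: "C_k (Suc m) f \<Longrightarrow> C_k m f"
proof (induction m arbitrary: f)
  case 0
  then show ?case using differentiable_imp_continuous_on by auto
next
  case (Suc m)
  then show ?case by (metis C_k.simps(2))
qed

lemma partial_eqI: "(f has_derivative D) (at x) \<Longrightarrow> partial k f x = D (axis k 1)"
  unfolding partial_def by (metis frechet_derivative_at)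

lemma C_k_Suc_derivative:
  assumes "C_k (Suc m) f"
  shows "(f has_derivative frechet_derivative f (at x)) (at x)"
  using assms by (auto simp: differentiable_on_def frechet_derivative_works)

text \<open>Derivatives are unique, so any explicit family \<open>D\<close> may stand in for
  \<open>frechet_derivative\<close>; the closure properties below are proved through this
  rule.\<close>

lemma C_k_SucI:
  assumes "\<And>x. (f has_derivative D x) (at x)" and "\<And>k. C_k m (\<lambda>x. D x (axis k 1))"
  shows "C_k (Suc m) f"
proof -
  have "f differentiable_on UNIV"
    using assms(1) by (auto simp: differentiable_on_def differentiable_def)
  moreover have "partial k f = (\<lambda>x. D x (axis k 1))" for k
    using partial_eqI[OF assms(1)] by auto
  ultimately show ?thesis using assms(2) by simp
qed

lemma C_k_const: "C_k m (\<lambda>x. z)"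
proof (induction m arbitrary: z)
  case (Suc m)
  show ?case by (rule C_k_SucI[where D = "\<lambda>x h. 0"]) (use Suc in auto)
qed simp

text \<open>Linearity is over the reals, so that taking real parts, embedded back into the complex
  numbers, is an instance.\<close>

lemma C_k_linear:
  assumes "bounded_linear L" shows "C_k m f \<Longrightarrow> C_k m (\<lambda>x. L (f x))"
proof (induction m arbitrary: f)
  case 0
  then show ?case
    using linear_continuous_on[OF assms] continuous_on_compose2[of UNIV L UNIV f] by auto
next
  case (Suc m)
  show ?case
  proof (rule C_k_SucI)
    show "((\<lambda>x. L (f x)) has_derivative (\<lambda>h. L (frechet_derivative f (at x) h))) (at x)" for x
      by (rule bounded_linear.has_derivative[OF assms C_k_Suc_derivative[OF Suc.prems]])
    show "C_k m (\<lambda>x. L (frechet_derivative f (at x) (axis k 1)))" for k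
      using Suc.IH[of "partial k f"] Suc.prems by (simp add: partial_def[abs_def])
  qed
qed

lemma C_k_add: "C_k m f \<Longrightarrow> C_k m g \<Longrightarrow> C_k m (\<lambda>x. f x + g x)"
proof (induction m arbitrary: f g)
  case (Suc m)
  show ?case
  proof (rule C_k_SucI)
    show "((\<lambda>x. f x + g x) has_derivative
      (\<lambda>h. frechet_derivative f (at x) h + frechet_derivative g (at x) h)) (at x)" for x
      by (intro has_derivative_add C_k_Suc_derivative[OF Suc.prems(1)] C_k_Suc_derivative[OF Suc.prems(2)])
    show "C_k m (\<lambda>x. frechet_derivative f (at x) (axis k 1) + frechet_derivative g (at x) (axis k 1))" for k
      using Suc.IH[of "partial k f" "partial k g"] Suc.prems by (simp add: partial_def[abs_def])
  qed
qed (auto intro: continuous_intros)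

lemma C_k_mult: "C_k m f \<Longrightarrow> C_k m g \<Longrightarrow> C_k m (\<lambda>x. f x * g x)"
proof (induction m arbitrary: f g)
  case (Suc m)
  show ?case
  proof (rule C_k_SucI)
    show "((\<lambda>x. f x * g x) has_derivative
      (\<lambda>h. f x * frechet_derivative g (at x) h + frechet_derivative f (at x) h * g x)) (at x)" for x
      by (intro has_derivative_mult C_k_Suc_derivative[OF Suc.prems(1)] C_k_Suc_derivative[OF Suc.prems(2)])
    have 1: "C_k m (\<lambda>x. f x * partial k g x)" for k
      using Suc.IH[OF C_k_SucD[OF Suc.prems(1)], of "partial k g"] Suc.prems by simp
    have 2: "C_k m (\<lambda>x. partial k f x * g x)" for k
      using Suc.IH[OF _ C_k_SucD[OF Suc.prems(2)], of "partial k f"] Suc.prems by simp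
    show "C_k m (\<lambda>x. f x * frechet_derivative g (at x) (axis k 1) + frechet_derivative f (at x) (axis k 1) * g x)" for k
      using C_k_add[OF 1[of k] 2[of k]] by (simp add: partial_def[abs_def])
  qed
qed (auto intro: continuous_intros)

lemma C_k_of_linear:
  assumes "bounded_linear (l :: real ^ 'n \<Rightarrow> real)"
  shows "C_k m (\<lambda>x. of_real (l x))"
proof (cases m)
  case 0
  then show ?thesis using linear_continuous_on[OF assms] by (auto intro: continuous_intros)
next
  case (Suc m')
  have "bounded_linear (\<lambda>x. complex_of_real (l x))"
    using bounded_linear_compose[OF bounded_linear_of_real assms] by (simp add: o_def)
  then show ?thesis unfolding Suc
    by (intro C_k_SucI[where D = "\<lambda>x h. of_real (l h)"] C_k_const) (simp add: bounded_linear_imp_has_derivative)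
qed

text \<open>This family of flat functions contains both the bump profile (\<open>i = 0\<close>) and the smooth
  approximation \<open>t exp(-\<kappa>/t)\<close> of the positive part (\<open>i = 1\<close>), and is closed under
  differentiation up to linear combinations.\<close>

definition flat :: "int \<Rightarrow> real \<Rightarrow> real \<Rightarrow> real" where
  "flat i \<kappa> t = (if 0 < t then t powi i * exp (- \<kappa> / t) else 0)"

text \<open>With s = \<kappa>/t the limit from the right is that of s^N / e^s at infinity, where N
  is large enough for t^-N to dominate t^i on (0, 1). From the left the function is 0.\<close>

lemma flat_tendsto_0:
  assumes "0 < \<kappa>" shows "(flat i \<kappa> \<longlongrightarrow> 0) (at 0)"
proof -
  obtain N where N: "- i \<le> int N" using zero_le_imp_eq_int[of "\<bar>i\<bar>"] by (metis abs_ge_minus_self abs_ge_zero)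
  have lim: "((\<lambda>x. x ^ N / exp x) \<longlongrightarrow> (0::real)) at_top" by (rule tendsto_power_div_exp_0)
  have fl: "filterlim (\<lambda>t. \<kappa> / t) at_top (at_right 0)"
    using assms by (simp add: filterlim_tendsto_pos_mult_at_top[OF tendsto_const _ filterlim_inverse_at_top_right] divide_inverse)
  have "((\<lambda>t. (\<kappa> / t) ^ N / exp (\<kappa> / t)) \<longlongrightarrow> 0) (at_right 0)"
    using filterlim_compose[OF lim fl] .
  then have "((\<lambda>t. (1 / \<kappa> ^ N) * ((\<kappa> / t) ^ N / exp (\<kappa> / t))) \<longlongrightarrow> 0) (at_right 0)"
    by (rule tendsto_mult_right_zero)
  then have r: "(flat i \<kappa> \<longlongrightarrow> 0) (at_right 0)"
  proof (rule Lim_null_comparison[rotated])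
    have "eventually (\<lambda>t. t \<in> {0<..<1}) (at_right (0::real))"
      by (rule eventually_at_right_real) simp
    then show "eventually (\<lambda>t. norm (flat i \<kappa> t) \<le> (1 / \<kappa> ^ N) * ((\<kappa> / t) ^ N / exp (\<kappa> / t))) (at_right 0)"
    proof (rule eventually_mono)
      fix t :: real assume t: "t \<in> {0<..<1}"
      have "t powi i \<le> t powi (- int N)"
        using t N by (intro power_int_decreasing) auto
      then have "t powi i \<le> 1 / t ^ N" by (simp add: power_int_minus divide_inverse)
      then have "t powi i * exp (- \<kappa> / t) \<le> 1 / t ^ N * exp (- \<kappa> / t)"
        by (rule mult_right_mono) simp
      also have "\<dots> = (1 / \<kappa> ^ N) * ((\<kappa> / t) ^ N / exp (\<kappa> / t))"
        using assms t by (simp add: field_simps exp_minus)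
      finally show "norm (flat i \<kappa> t) \<le> (1 / \<kappa> ^ N) * ((\<kappa> / t) ^ N / exp (\<kappa> / t))"
        using t by (simp add: flat_def)
    qed
  qed
  have "(flat i \<kappa> \<longlongrightarrow> 0) (at_left 0)"
    by (rule tendsto_eventually) (auto simp: flat_def eventually_at_filter)
  with r show ?thesis by (simp add: filterlim_split_at)
qed

text \<open>At 0 the difference quotient of \<open>flat i \<kappa>\<close> is
  \<open>flat (i - 1) \<kappa>\<close>, which tends to 0. Negative exponents therefore have to
  belong to the family.\<close>

lemma flat_has_derivative:
  assumes "0 < \<kappa>"
  shows "(flat i \<kappa> has_real_derivative (of_int i * flat (i - 1) \<kappa> t + \<kappa> * flat (i - 2) \<kappa> t)) (at t)"
proof (cases t "0::real" rule: linorder_cases)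
  case less
  then have "((\<lambda>t. 0) has_real_derivative (of_int i * flat (i - 1) \<kappa> t + \<kappa> * flat (i - 2) \<kappa> t)) (at t)"
    by (simp add: flat_def)
  then show ?thesis
    by (rule DERIV_cong_ev[THEN iffD1, rotated 3, OF _ refl _ refl]) (use less in \<open>auto simp: flat_def eventually_nhds intro!: exI[of _ "{..<0}"]\<close>)
next
  case equal
  have "((\<lambda>h. flat (i - 1) \<kappa> h) \<longlongrightarrow> 0) (at 0)" by (rule flat_tendsto_0[OF assms])
  moreover have "(flat i \<kappa> (0 + h) - flat i \<kappa> 0) / h = flat (i - 1) \<kappa> h" for h
    by (auto simp: flat_def power_int_diff)
  ultimately show ?thesis using equal by (simp add: DERIV_def) (simp add: flat_def)
next
  case greater
  have "((\<lambda>t. t powi i * exp (- \<kappa> / t)) has_real_derivative (of_int i * flat (i - 1) \<kappa> t + \<kappa> * flat (i - 2) \<kappa> t)) (at t)"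
    using greater by (auto intro!: derivative_eq_intros simp: flat_def power_int_diff field_simps power2_eq_square)
  then show ?thesis
    by (rule DERIV_cong_ev[THEN iffD1, rotated 3, OF _ refl _ refl]) (use greater in \<open>auto simp: flat_def eventually_nhds intro!: exI[of _ "{0<..}"]\<close>)
qed

lemma bounded_linear_of_real_Re: "bounded_linear (\<lambda>z. complex_of_real (Re z))"
  using bounded_linear_compose[OF bounded_linear_of_real bounded_linear_Re] by (simp add: o_def)

text \<open>The exponent \<open>i\<close> is generalized in the induction because a derivative
  lowers it by one and by two.\<close>

lemma C_k_flat:
  assumes "0 < \<kappa>" shows "C_k m f \<Longrightarrow> C_k m (\<lambda>x. of_real (flat i \<kappa> (Re (f x))))"
proof (induction m arbitrary: f i)
  case 0
  have "continuous_on UNIV (flat i \<kappa>)"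
    using flat_has_derivative[OF assms] DERIV_isCont by (blast intro: continuous_at_imp_continuous_on)
  then show ?case using 0
    by (auto intro!: continuous_intros continuous_on_compose2[of UNIV "flat i \<kappa>"])
next
  case (Suc m)
  let ?F = "\<lambda>t. of_int i * flat (i - 1) \<kappa> t + \<kappa> * flat (i - 2) \<kappa> t"
  show ?case
  proof (rule C_k_SucI)
    fix x
    have 1: "((\<lambda>x. Re (f x)) has_derivative (\<lambda>h. Re (frechet_derivative f (at x) h))) (at x)"
      by (rule bounded_linear.has_derivative[OF bounded_linear_Re C_k_Suc_derivative[OF Suc.prems]])
    have "(flat i \<kappa> has_derivative (\<lambda>h. ?F (Re (f x)) * h)) (at (Re (f x)))"
      using flat_has_derivative[OF assms] by (simp add: has_field_derivative_def)
    from has_derivative_compose[OF 1 this]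
    show "((\<lambda>x. complex_of_real (flat i \<kappa> (Re (f x)))) has_derivative
        (\<lambda>h. of_real (?F (Re (f x)) * Re (frechet_derivative f (at x) h)))) (at x)"
      by (rule has_derivative_of_real)
  next
    fix k
    have f: "C_k m f" by (rule C_k_SucD[OF Suc.prems])
    have "C_k m (\<lambda>x. (of_int i * of_real (flat (i - 1) \<kappa> (Re (f x))) + of_real \<kappa> * of_real (flat (i - 2) \<kappa> (Re (f x))))
       * complex_of_real (Re (partial k f x)))"
      using Suc.prems by (intro C_k_mult C_k_add C_k_const Suc.IH f C_k_linear[OF bounded_linear_of_real_Re])
        auto
    then show "C_k m (\<lambda>x. of_real (?F (Re (f x)) * Re (frechet_derivative f (at x) (axis k 1))))"
      by (simp add: partial_def[abs_def])
  qed
qed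

section \<open>Derivative rules for smooth functions\<close>

definition smooth :: "(real ^ 'n::finite \<Rightarrow> complex) \<Rightarrow> bool" where
  "smooth f \<longleftrightarrow> (\<forall>m. C_k m f)"

lemma smooth_partial: "smooth f \<Longrightarrow> smooth (partial k f)"
  unfolding smooth_def by (metis C_k.simps(2))

lemma smooth_continuous: "smooth f \<Longrightarrow> continuous_on S f"
  unfolding smooth_def using C_k_continuous continuous_on_subset by blast

lemma smooth_intros:
  "smooth (\<lambda>x. z)"
  "smooth f \<Longrightarrow> smooth g \<Longrightarrow> smooth (\<lambda>x. f x + g x)"
  "smooth f \<Longrightarrow> smooth g \<Longrightarrow> smooth (\<lambda>x. f x - g x)"
  "smooth f \<Longrightarrow> smooth g \<Longrightarrow> smooth (\<lambda>x. f x * g x)"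
  "smooth f \<Longrightarrow> 0 < \<kappa> \<Longrightarrow> smooth (\<lambda>x. of_real (flat i \<kappa> (Re (f x))))"
proof -
  show "smooth (\<lambda>x. f x - g x)" if "smooth f" "smooth g"
    using that C_k_add[of _ f "\<lambda>x. - g x"] C_k_linear[OF bounded_linear_minus[OF bounded_linear_ident], of _ g]
    by (simp add: smooth_def)
qed (auto simp: smooth_def intro!: C_k_const C_k_add C_k_mult C_k_flat)

lemma smooth_of_linear: "bounded_linear l \<Longrightarrow> smooth (\<lambda>x. of_real (l x))"
  by (simp add: smooth_def C_k_of_linear)

lemma smooth_prod:
  "(\<And>i. i \<in> I \<Longrightarrow> smooth (f i)) \<Longrightarrow> smooth (\<lambda>x. \<Prod>i\<in>I. f i x)"
  by (induction I rule: infinite_finite_induct) (auto intro: smooth_intros)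

text \<open>With the derivative written through the partials, the sum, product and chain rules for
  \<open>partial\<close> become evaluations of a known linear map at
  \<open>axis k 1\<close>.\<close>

lemma smooth_has_derivative:
  assumes "smooth f"
  shows "(f has_derivative (\<lambda>h. \<Sum>k\<in>UNIV. h $ k *\<^sub>R partial k f x)) (at x)"
proof -
  have D: "(f has_derivative frechet_derivative f (at x)) (at x)"
    using assms C_k_Suc_derivative unfolding smooth_def by blast
  interpret bounded_linear "frechet_derivative f (at x)" by (rule has_derivative_bounded_linear[OF D])
  have "frechet_derivative f (at x) h = (\<Sum>k\<in>UNIV. h $ k *\<^sub>R partial k f x)" for h
  proof -
    have "frechet_derivative f (at x) h = frechet_derivative f (at x) (\<Sum>k\<in>UNIV. h $ k *\<^sub>R axis k 1)"
      by (simp add: basis_expansion flip: scalar_mult_eq_scaleR)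
    then show ?thesis by (simp add: sum scaleR partial_def)
  qed
  then have "frechet_derivative f (at x) = (\<lambda>h. \<Sum>k\<in>UNIV. h $ k *\<^sub>R partial k f x)" by blast
  with D show ?thesis by simp
qed

lemma sum_axis_scaleR:
  fixes z :: "'n::finite \<Rightarrow> 'b::real_vector"
  shows "(\<Sum>k\<in>UNIV. axis j 1 $ k *\<^sub>R z k) = z j"
  by (simp add: axis_def if_distrib[of "\<lambda>r. scaleR r _"] cong: if_cong)

lemma smooth_partial_add:
  "smooth f \<Longrightarrow> smooth g \<Longrightarrow> partial k (\<lambda>x. f x + g x) x = partial k f x + partial k g x"
  by (rule partial_eqI[THEN trans], rule has_derivative_add[OF smooth_has_derivative smooth_has_derivative])
    (auto simp: sum_axis_scaleR)

lemma smooth_partial_diff: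
  "smooth f \<Longrightarrow> smooth g \<Longrightarrow> partial k (\<lambda>x. f x - g x) x = partial k f x - partial k g x"
  by (rule partial_eqI[THEN trans], rule has_derivative_diff[OF smooth_has_derivative smooth_has_derivative])
    (auto simp: sum_axis_scaleR)

lemma smooth_partial_mult:
  "smooth f \<Longrightarrow> smooth g \<Longrightarrow> partial k (\<lambda>x. f x * g x) x = f x * partial k g x + partial k f x * g x"
  by (rule partial_eqI[THEN trans], rule has_derivative_mult[OF smooth_has_derivative smooth_has_derivative])
    (auto simp: sum_axis_scaleR)

lemma partial_const: "partial k (\<lambda>x. z) x = 0"
  by (rule partial_eqI[THEN trans], rule has_derivative_const) simp

lemma smooth_partial_cmult:
  "smooth f \<Longrightarrow> partial k (\<lambda>x. z * f x) x = z * partial k f x"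
  using smooth_partial_mult[OF smooth_intros(1), of f k z x] by (simp add: partial_const)

lemma smooth_partial_flat:
  assumes "smooth f" "0 < \<kappa>"
  shows "partial k (\<lambda>x. of_real (flat i \<kappa> (Re (f x)))) x =
    of_real ((of_int i * flat (i - 1) \<kappa> (Re (f x)) + \<kappa> * flat (i - 2) \<kappa> (Re (f x))) * Re (partial k f x))"
proof -
  let ?F = "\<lambda>t. of_int i * flat (i - 1) \<kappa> t + \<kappa> * flat (i - 2) \<kappa> t"
  have 1: "((\<lambda>x. Re (f x)) has_derivative (\<lambda>h. Re (\<Sum>k\<in>UNIV. h $ k *\<^sub>R partial k f x))) (at x)"
    by (rule bounded_linear.has_derivative[OF bounded_linear_Re smooth_has_derivative[OF assms(1)]])
  have "(flat i \<kappa> has_derivative (\<lambda>h. ?F (Re (f x)) * h)) (at (Re (f x)))"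
    using flat_has_derivative[OF assms(2)] by (simp add: has_field_derivative_def)
  from has_derivative_of_real[OF has_derivative_compose[OF 1 this]]
  show ?thesis
    by (rule partial_eqI[THEN trans]) (simp add: sum_axis_scaleR)
qed

lemma partial_eq_0_outside:
  assumes "x \<notin> closure {x. f x \<noteq> 0}" shows "partial k f x = 0"
proof -
  have "(f has_derivative (\<lambda>h. 0)) (at x)"
  proof (rule has_derivative_transform_within_open)
    show "((\<lambda>x. 0) has_derivative (\<lambda>h. 0)) (at x)" by simp
    show "open (- closure {x. f x \<noteq> 0})" by auto
  qed (use assms closure_subset[of "{x. f x \<noteq> 0}"] in auto)
  then show ?thesis by (simp add: partial_eqI)
qed

section \<open>Test functions and the fundamental lemma of the calculus of variations\<close>

lemma test_functionsD:
  assumes "v \<in> test_functions \<Omega>"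
  shows "smooth v" "compact (closure {x. v x \<noteq> 0})" "closure {x. v x \<noteq> 0} \<subseteq> \<Omega>"
  using assms by (auto simp: test_functions_def smooth_def)

text \<open>Any compact subset of \<Omega> outside of which \<open>v\<close> vanishes may stand for
  the support, so closure properties only have to name such a set.\<close>

lemma test_functions_iff:
  "v \<in> test_functions \<Omega> \<longleftrightarrow> smooth v \<and> (\<exists>K. compact K \<and> K \<subseteq> \<Omega> \<and> (\<forall>x. x \<notin> K \<longrightarrow> v x = 0))"
proof
  assume v: "v \<in> test_functions \<Omega>"
  have "\<forall>x. x \<notin> closure {x. v x \<noteq> 0} \<longrightarrow> v x = 0" using closure_subset[of "{x. v x \<noteq> 0}"] by auto
  then show "smooth v \<and> (\<exists>K. compact K \<and> K \<subseteq> \<Omega> \<and> (\<forall>x. x \<notin> K \<longrightarrow> v x = 0))"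
    using test_functionsD[OF v] by blast
next
  assume "smooth v \<and> (\<exists>K. compact K \<and> K \<subseteq> \<Omega> \<and> (\<forall>x. x \<notin> K \<longrightarrow> v x = 0))"
  then obtain K where K: "smooth v" "compact K" "K \<subseteq> \<Omega>" "\<forall>x. x \<notin> K \<longrightarrow> v x = 0" by blast
  have "closure {x. v x \<noteq> 0} \<subseteq> K"
    using K by (intro closure_minimal) (auto simp: compact_imp_closed)
  moreover from this have "compact (closure {x. v x \<noteq> 0})"
    using K(2) compact_Int_closed[of K "closure {x. v x \<noteq> 0}"] by (simp add: Int_absorb1)
  ultimately show "v \<in> test_functions \<Omega>"
    using K by (auto simp: test_functions_def smooth_def)
qed

lemma test_functions_mult:
  assumes "smooth f" "v \<in> test_functions \<Omega>" shows "(\<lambda>x. f x * v x) \<in> test_functions \<Omega>"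
  using assms unfolding test_functions_iff by (metis smooth_intros(4) mult_zero_right)

lemma test_functions_cmult: "v \<in> test_functions \<Omega> \<Longrightarrow> (\<lambda>x. z * v x) \<in> test_functions \<Omega>"
  by (rule test_functions_mult[OF smooth_intros(1)])

lemma test_functions_add:
  assumes "u \<in> test_functions \<Omega>" "v \<in> test_functions \<Omega>"
  shows "(\<lambda>x. u x + v x) \<in> test_functions \<Omega>"
proof -
  obtain K L where "compact K" "K \<subseteq> \<Omega>" "\<forall>x. x \<notin> K \<longrightarrow> u x = 0" "compact L" "L \<subseteq> \<Omega>" "\<forall>x. x \<notin> L \<longrightarrow> v x = 0"
    using assms unfolding test_functions_iff by blast
  then show ?thesis
    using assms unfolding test_functions_iff by (auto intro!: smooth_intros exI[of _ "K \<union> L"])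
qed

lemma test_functions_diff:
  assumes "u \<in> test_functions \<Omega>" "v \<in> test_functions \<Omega>"
  shows "(\<lambda>x. u x - v x) \<in> test_functions \<Omega>"
  using test_functions_add[OF assms(1) test_functions_cmult[OF assms(2), of "-1"]] by simp

lemma test_functions_partial:
  assumes "v \<in> test_functions \<Omega>" shows "partial k v \<in> test_functions \<Omega>"
  using test_functionsD[OF assms] smooth_partial partial_eq_0_outside[of _ v k]
  unfolding test_functions_iff by blast

lemma test_functions_mono: "\<Omega> \<subseteq> \<Omega>' \<Longrightarrow> test_functions \<Omega> \<subseteq> test_functions \<Omega>'"
  by (auto simp: test_functions_def)

lemma test_function_outside: "v \<in> test_functions \<Omega> \<Longrightarrow> x \<notin> \<Omega> \<Longrightarrow> v x = 0"
  unfolding test_functions_iff by blast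

lemma continuous_compact_support_integrable:
  fixes f :: "'a::euclidean_space \<Rightarrow> 'b::{banach, second_countable_topology}"
  assumes "continuous_on UNIV f" "compact K" "\<And>x. x \<notin> K \<Longrightarrow> f x = 0"
  shows "integrable lborel f"
proof -
  have "integrable lborel (\<lambda>x. indicator K x *\<^sub>R f x)"
    using assms by (intro borel_integrable_compact) (auto intro: continuous_on_subset)
  moreover have "(\<lambda>x. indicator K x *\<^sub>R f x) = f" using assms(3) by (auto simp: indicator_def)
  ultimately show ?thesis by simp
qed

lemma test_function_integrable:
  assumes "v \<in> test_functions \<Omega>" shows "integrable lborel v"
  using assms continuous_compact_support_integrable[OF smooth_continuous] unfolding test_functions_iff by blast

lemma test_function_bounded:
  assumes "v \<in> test_functions \<Omega>" obtains B where "0 \<le> B" "\<And>x. norm (v x) \<le> B"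
proof -
  obtain K where K: "smooth v" "compact K" "\<forall>x. x \<notin> K \<longrightarrow> v x = 0"
    using assms unfolding test_functions_iff by blast
  obtain B where "\<forall>y\<in>v ` K. norm y \<le> B"
    using compact_imp_bounded[OF compact_continuous_image[OF smooth_continuous[OF K(1)] K(2)]] bounded_iff by blast
  then have "norm (v x) \<le> max B 0" for x using K(3) by (cases "x \<in> K") auto
  with that[of "max B 0"] show thesis by auto
qed

section \<open>Integration by parts\<close>

lemma smooth_has_vector_derivative_line:
  assumes "smooth f"
  shows "((\<lambda>t. f (x + t *\<^sub>R axis k 1)) has_vector_derivative partial k f (x + t *\<^sub>R axis k 1)) (at t within T)"
proof -
  have 1: "((\<lambda>t. x + t *\<^sub>R axis k 1) has_derivative (\<lambda>h. h *\<^sub>R axis k 1)) (at t within T)"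
    by (auto intro!: derivative_eq_intros)
  have "((\<lambda>t. f (x + t *\<^sub>R axis k 1)) has_derivative
     (\<lambda>h. \<Sum>j\<in>UNIV. (h *\<^sub>R axis k 1) $ j *\<^sub>R partial j f (x + t *\<^sub>R axis k 1))) (at t within T)"
    by (rule has_derivative_compose[OF 1 smooth_has_derivative[OF assms]])
  moreover have "(\<Sum>j\<in>UNIV. (h *\<^sub>R axis k 1) $ j *\<^sub>R partial j f (x + t *\<^sub>R axis k 1)) = h *\<^sub>R partial k f (x + t *\<^sub>R axis k 1)" for h
    by (simp add: axis_def if_distrib[of "\<lambda>r. scaleR r _"] if_distrib[of "\<lambda>r. _ * r"] cong: if_cong)
  ultimately show ?thesis by (simp add: has_vector_derivative_def)
qed

text \<open>Difference quotients are bounded uniformly, which is the domination needed for passing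
  to the limit under the integral.\<close>

lemma smooth_line_bound:
  assumes "smooth f" "\<And>x. norm (partial k f x) \<le> B"
  shows "norm (f (x + h *\<^sub>R axis k 1) - f x) \<le> B * \<bar>h\<bar>"
proof -
  have "norm (f (x + h *\<^sub>R axis k 1) - f (x + 0 *\<^sub>R axis k 1)) \<le> B * norm (h - 0)"
  proof (rule differentiable_bound[of UNIV "\<lambda>t. f (x + t *\<^sub>R axis k 1)"
          "\<lambda>t s. s *\<^sub>R partial k f (x + t *\<^sub>R axis k 1)"])
    show "((\<lambda>t. f (x + t *\<^sub>R axis k 1)) has_derivative (\<lambda>s. s *\<^sub>R partial k f (x + t *\<^sub>R axis k 1))) (at t within UNIV)" for t
      using smooth_has_vector_derivative_line[OF assms(1)] by (simp add: has_vector_derivative_def)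
    show "onorm (\<lambda>s. s *\<^sub>R partial k f (x + t *\<^sub>R axis k 1)) \<le> B" for t :: real
      by (rule onorm_le) (simp add: assms(2) mult.commute[of B] mult_left_mono)
  qed auto
  then show ?thesis by simp
qed

lemma integral_translate_lborel:
  fixes f :: "'a::euclidean_space \<Rightarrow> 'b::{banach, second_countable_topology}"
  assumes "f \<in> borel_measurable borel"
  shows "(\<integral>x. f (x + c) \<partial>lborel) = (\<integral>x. f x \<partial>lborel)"
proof -
  have "(\<integral>x. f x \<partial>lborel) = (\<integral>x. f x \<partial>distr lborel borel ((+) c))" by (simp add: lborel_distr_plus)
  also have "\<dots> = (\<integral>x. f (c + x) \<partial>lborel)" using assms by (intro integral_distr) auto
  finally show ?thesis by (simp add: add.commute)
qed

lemma has_vector_derivative_tendsto_quotient: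
  assumes "(g has_vector_derivative d) (at (0::real))"
  shows "((\<lambda>t. (1 / t) *\<^sub>R (g t - g 0)) \<longlongrightarrow> d) (at 0)"
proof -
  have "((\<lambda>t. norm (g t - g 0 - t *\<^sub>R d) / norm t) \<longlongrightarrow> 0) (at 0)"
    using assms by (simp add: has_vector_derivative_def has_derivative_at)
  then have "((\<lambda>t. norm ((1 / t) *\<^sub>R (g t - g 0) - d)) \<longlongrightarrow> 0) (at 0)"
  proof (rule Lim_transform_within[OF _ zero_less_one])
    fix t :: real assume "0 < dist t 0"
    then have "(1 / t) *\<^sub>R (g t - g 0) - d = (1 / t) *\<^sub>R (g t - g 0 - t *\<^sub>R d)"
      by (simp add: algebra_simps)
    then show "norm (g t - g 0 - t *\<^sub>R d) / norm t = norm ((1 / t) *\<^sub>R (g t - g 0) - d)"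
      by simp
  qed
  then show ?thesis by (rule LIM_zero_cancel[OF tendsto_norm_zero_cancel])
qed

text \<open>Translation invariance makes the integral of every difference quotient vanish.\<close>

lemma integral_partial_eq_0:
  assumes F: "F \<in> test_functions \<Omega>"
  shows "(\<integral>x. partial k F x \<partial>lborel) = 0"
proof -
  note sm = test_functionsD(1)[OF F]
  obtain K where K: "compact K" "\<And>x. x \<notin> K \<Longrightarrow> F x = 0" using F unfolding test_functions_iff by blast
  obtain R where R: "K \<subseteq> cball 0 R" using compact_imp_bounded[OF K(1)] by (metis bounded_iff mem_cball_0 subsetI)
  obtain B where B: "0 \<le> B" "\<And>x. norm (partial k F x) \<le> B"
    using test_function_bounded[OF test_functions_partial[OF F]] by blast
  \<comment> \<open>Step sizes lie in (0, 1]: the shifted supports stay within distance one of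
    \<open>K\<close>, so a single ball of radius R + 1 serves every \<open>i\<close>.\<close>
  define h where "h i = inverse (real (Suc i))" for i
  have h: "0 < h i" "h i \<le> 1" for i by (auto simp: h_def field_simps)
  define q where "q i x = (1 / h i) *\<^sub>R (F (x + h i *\<^sub>R axis k 1) - F x)" for i x
  have [measurable]: "F \<in> borel_measurable borel" "partial k F \<in> borel_measurable borel"
    using smooth_continuous sm smooth_partial by (auto intro!: borel_measurable_continuous_onI)
  have intF: "integrable lborel F" by (rule test_function_integrable[OF F])
  have intF': "integrable lborel (\<lambda>x. F (x + c))" for c
  proof -
    have "integrable (distr lborel borel ((+) c)) F" using intF by (simp add: lborel_distr_plus)
    then show ?thesis by (subst (asm) integrable_distr_eq) (auto simp: add.commute)
  qed
  have q0: "(\<integral>x. q i x \<partial>lborel) = 0" for i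
    unfolding q_def using intF intF'[of "h i *\<^sub>R axis k 1"] integral_translate_lborel[of F "h i *\<^sub>R axis k 1"]
    by (simp add: Bochner_Integration.integral_diff)
  have "(\<lambda>i. \<integral>x. q i x \<partial>lborel) \<longlonglongrightarrow> (\<integral>x. partial k F x \<partial>lborel)"
  proof (rule integral_dominated_convergence[where w="\<lambda>x. B * indicator (cball 0 (R + 1)) x"])
    show "partial k F \<in> borel_measurable lborel" by simp
    show "q i \<in> borel_measurable lborel" for i unfolding q_def by measurable
    show "integrable lborel (\<lambda>x::real^'a. B * indicator (cball 0 (R + 1)) x)"
      using emeasure_lborel_cball_finite[of "0::real^'a" "R+1"] by (intro integrable_mult_right integrable_real_indicator) auto
    show "AE x in lborel. (\<lambda>i. q i x) \<longlonglongrightarrow> partial k F x"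
    proof (rule AE_I2)
      fix x
      have "((\<lambda>t. F (x + t *\<^sub>R axis k 1)) has_vector_derivative partial k F x) (at 0)"
        using smooth_has_vector_derivative_line[OF sm, of x k 0] by simp
      then have "((\<lambda>t. (1 / t) *\<^sub>R (F (x + t *\<^sub>R axis k 1) - F x)) \<longlongrightarrow> partial k F x) (at 0)"
        using has_vector_derivative_tendsto_quotient by fastforce
      moreover have "filterlim h (at 0) sequentially"
        using h(1) LIMSEQ_inverse_real_of_nat unfolding h_def filterlim_at by (auto intro!: always_eventually)
      ultimately show "(\<lambda>i. q i x) \<longlonglongrightarrow> partial k F x"
        unfolding q_def by (rule filterlim_compose)
    qed
    fix i show "AE x in lborel. norm (q i x) \<le> B * indicator (cball 0 (R + 1)) x"
    proof (rule AE_I2)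
      fix x
      have b: "norm (q i x) \<le> B"
        using smooth_line_bound[OF sm B(2), of x "h i"] h[of i]
        by (simp add: q_def divide_le_eq del: scaleR_right_diff_distrib)
      show "norm (q i x) \<le> B * indicator (cball 0 (R + 1)) x"
      proof (cases "x \<in> cball 0 (R + 1)")
        case False
        then have "norm x > R + 1" by simp
        moreover have "norm (x + h i *\<^sub>R axis k 1) \<ge> norm x - 1"
          using norm_diff_ineq[of x "h i *\<^sub>R axis k 1"] h[of i] by simp
        ultimately have "x \<notin> K" "x + h i *\<^sub>R axis k 1 \<notin> K" using R by auto
        then show ?thesis using K(2) False by (simp add: q_def)
      qed (use b in simp)
    qed
  qed
  then show ?thesis by (simp add: q0 LIMSEQ_const_iff)
qed

text \<open>The product \<open>f * v\<close> is again a test function, and the integral of its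
  derivative vanishes.\<close>

lemma integration_by_parts:
  assumes f: "smooth f" and v: "v \<in> test_functions \<Omega>"
  shows "(\<integral>x. f x * partial k v x \<partial>lborel) = - (\<integral>x. partial k f x * v x \<partial>lborel)"
proof -
  note sv = test_functionsD(1)[OF v]
  have "0 = (\<integral>x. partial k (\<lambda>x. f x * v x) x \<partial>lborel)"
    using integral_partial_eq_0[OF test_functions_mult[OF f v]] by simp
  also have "\<dots> = (\<integral>x. f x * partial k v x + partial k f x * v x \<partial>lborel)"
    by (simp add: smooth_partial_mult[OF f sv])
  also have "\<dots> = (\<integral>x. f x * partial k v x \<partial>lborel) + (\<integral>x. partial k f x * v x \<partial>lborel)"
    by (intro Bochner_Integration.integral_add test_function_integrable[of _ \<Omega>] test_functions_mult test_functions_partial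
        smooth_partial f v)
  finally show ?thesis by (simp add: add_eq_0_iff)
qed


section \<open>Smooth bumps on boxes\<close>

definition bump :: "real \<Rightarrow> real ^ 'n \<Rightarrow> real ^ 'n \<Rightarrow> real ^ 'n \<Rightarrow> real" where
  "bump \<kappa> a b x = (\<Prod>k\<in>UNIV. flat 0 \<kappa> (x $ k - a $ k) * flat 0 \<kappa> (b $ k - x $ k))"

lemma flat_0_bounds: "0 < \<kappa> \<Longrightarrow> 0 \<le> flat 0 \<kappa> t \<and> flat 0 \<kappa> t \<le> 1"
  by (auto simp: flat_def)

lemma bump_bounds:
  assumes "0 < \<kappa>" shows "0 \<le> bump \<kappa> a b x" "bump \<kappa> a b x \<le> 1"
  unfolding bump_def using flat_0_bounds[OF assms]
  by (auto intro!: prod_nonneg prod_le_1 mult_nonneg_nonneg mult_le_one)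

lemma bump_pos_iff: "bump \<kappa> a b x \<noteq> 0 \<longleftrightarrow> x \<in> box a b"
  by (auto simp: bump_def flat_def mem_box_cart)

text \<open>As \<kappa> tends to 0, exp(-\<kappa>/t) tends to 1 for every t > 0. Together with the
  bounds 0 and 1 this lets dominated convergence carry identities from test functions to indicators
  of boxes.\<close>

lemma bump_tendsto_indicator:
  "(\<lambda>i. bump (inverse (real (Suc i))) a b x) \<longlonglongrightarrow> indicator (box a b) x"
proof (cases "x \<in> box a b")
  case True
  have "(\<lambda>i. flat 0 (inverse (real (Suc i))) t) \<longlonglongrightarrow> 1" if "0 < t" for t
  proof -
    have "(\<lambda>i. exp (- inverse (real (Suc i)) / t)) \<longlonglongrightarrow> exp (- 0 / t)"
      by (intro tendsto_intros LIMSEQ_inverse_real_of_nat) (use that in auto)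
    then show ?thesis using that by (simp add: flat_def)
  qed
  then have "(\<lambda>i. bump (inverse (real (Suc i))) a b x) \<longlonglongrightarrow> (\<Prod>k\<in>(UNIV::'a set). 1 * 1)"
    unfolding bump_def using True by (intro tendsto_prod tendsto_mult) (auto simp: mem_box_cart)
  then show ?thesis using True by simp
next
  case False
  then have "bump (inverse (real (Suc i))) a b x = 0" for i using bump_pos_iff by blast
  then show ?thesis using False by simp
qed

lemma smooth_bump:
  assumes "0 < \<kappa>" shows "smooth (\<lambda>x. complex_of_real (bump \<kappa> a b x))"
proof -
  have "smooth (\<lambda>x. \<Prod>k\<in>UNIV. complex_of_real (flat 0 \<kappa> (Re (of_real (x $ k) - of_real (a $ k)))) *
      complex_of_real (flat 0 \<kappa> (Re (of_real (b $ k) - of_real (x $ k)))))"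
    by (intro smooth_prod smooth_intros smooth_of_linear bounded_linear_vec_nth assms)
  then show ?thesis by (simp add: bump_def)
qed

lemma bump_test_function:
  assumes "0 < \<kappa>" "cbox a b \<subseteq> \<Omega>" shows "(\<lambda>x. complex_of_real (bump \<kappa> a b x)) \<in> test_functions \<Omega>"
  unfolding test_functions_iff
proof (intro conjI exI[of _ "cbox a b"] allI impI)
  fix x assume "x \<notin> cbox a b"
  then have "x \<notin> box a b" using box_subset_cbox[of a b] by blast
  then show "complex_of_real (bump \<kappa> a b x) = 0" using bump_pos_iff[of \<kappa> a b x] by simp
qed (use assms smooth_bump in auto)

section \<open>Functions orthogonal to all test functions\<close>

lemma integral_lebesgue_on_support:
  fixes f :: "'a::euclidean_space \<Rightarrow> 'b::{banach, second_countable_topology}"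
  assumes "S \<in> sets lebesgue" "\<And>x. x \<notin> S \<Longrightarrow> f x = 0"
  shows "integral\<^sup>L (lebesgue_on S) f = integral\<^sup>L lebesgue f"
    "integrable (lebesgue_on S) f \<longleftrightarrow> integrable lebesgue f"
proof -
  have "(\<lambda>x. indicator S x *\<^sub>R f x) = f" using assms(2) by (auto simp: indicator_def)
  then show "integral\<^sup>L (lebesgue_on S) f = integral\<^sup>L lebesgue f"
    "integrable (lebesgue_on S) f \<longleftrightarrow> integrable lebesgue f"
    using assms(1) by (simp_all add: integral_restrict_space integrable_restrict_space)
qed

text \<open>A countable cover witnessing \<sigma>-finiteness of \<open>lborel\<close> consists of
  Lebesgue sets with the same measures.\<close>

lemma sigma_finite_lebesgue: "sigma_finite_measure (lebesgue :: 'a::euclidean_space measure)"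
proof
  obtain A where "countable A" "A \<subseteq> sets (lborel :: 'a measure)" "\<Union>A = space (lborel :: 'a measure)"
      "\<forall>a\<in>A. emeasure (lborel :: 'a measure) a \<noteq> \<infinity>"
    using lborel.sigma_finite_countable by blast
  then show "\<exists>A. countable A \<and> A \<subseteq> sets lebesgue \<and> \<Union>A = space lebesgue \<and> (\<forall>a\<in>A. emeasure lebesgue (a :: 'a set) \<noteq> \<infinity>)"
    by (intro exI[of _ A]) auto
qed

text \<open>Open boxes form an intersection-stable generator of the Borel sets, so the Dynkin system
  of sets with vanishing integral contains every Borel set; the hypothesis on the total integral
  serves the complements. A Lebesgue set differs from a Borel set only within a null set.\<close>

lemma AE_eq_0_if_box_integrals_eq_0:
  fixes f :: "'a::euclidean_space \<Rightarrow> 'b::{banach, second_countable_topology}"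
  assumes f: "integrable lebesgue f" and 0: "(\<integral>x. f x \<partial>lebesgue) = 0"
    and box: "\<And>a b. (\<integral>x. indicator (box a b) x *\<^sub>R f x \<partial>lebesgue) = 0"
  shows "AE x in lebesgue. f x = 0"
proof (rule sigma_finite_measure.density_zero[OF sigma_finite_lebesgue f])
  have borel: "(\<integral>x. indicator A x *\<^sub>R f x \<partial>lebesgue) = 0" if "A \<in> sets borel" for A
  proof -
    let ?G = "range (\<lambda>(a, b). box a b :: 'a set)"
    have "Int_stable ?G"
      by (auto simp: Int_stable_def Int_interval box_Int_box)
    moreover have "?G \<subseteq> Pow UNIV" "A \<in> sigma_sets UNIV ?G"
      using that by (auto simp: borel_eq_box)
    ultimately show ?thesis
    proof (induction rule: sigma_sets_induct_disjoint)
      case (basic A)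
      then show ?case using box by auto
    next
      case empty
      then show ?case by simp
    next
      case (compl A)
      then have A: "A \<in> sets lebesgue" by (auto simp: borel_eq_box)
      have "(\<integral>x. indicator (UNIV - A) x *\<^sub>R f x \<partial>lebesgue) = (\<integral>x. f x - indicator A x *\<^sub>R f x \<partial>lebesgue)"
        by (rule Bochner_Integration.integral_cong) (auto simp: indicator_def)
      also have "\<dots> = 0"
        using compl(2) 0 A f by (subst Bochner_Integration.integral_diff) (auto intro: integrable_mult_indicator)
      finally show ?case .
    next
      case (union A)
      then have A: "range A \<subseteq> sets lebesgue" by (auto simp: borel_eq_box)
      then have UA: "(\<Union>i. A i) \<in> sets lebesgue" by blast
      have "set_lebesgue_integral lebesgue (\<Union>i. A i) f = (\<Sum>i. set_lebesgue_integral lebesgue (A i) f)"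
        using A union(1) integrable_mult_indicator[OF UA f]
        by (intro lebesgue_integral_countable_add) (auto simp: disjoint_family_on_def set_integrable_def)
      then show ?case using union(3) by (simp add: set_lebesgue_integral_def)
    qed
  qed
  fix A :: "'a set" assume "A \<in> sets lebesgue"
  then obtain S N N' where A: "A = S \<union> N" "N \<subseteq> N'" "N' \<in> null_sets lborel" "S \<in> sets lborel"
    by (rule sets_completionE)
  have "N' \<in> null_sets lebesgue" using A(3) by (rule null_sets_completionI)
  then have "AE x in lebesgue. x \<notin> N'" by (rule AE_not_in)
  then have "AE x in lebesgue. indicator A x *\<^sub>R f x = indicator S x *\<^sub>R f x"
    by eventually_elim (use A in \<open>auto simp: indicator_def\<close>)
  moreover have "integrable lebesgue (\<lambda>x. indicator A x *\<^sub>R f x)" "integrable lebesgue (\<lambda>x. indicator S x *\<^sub>R f x)"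
    using A(4) f \<open>A \<in> sets lebesgue\<close> by (auto intro!: integrable_mult_indicator)
  ultimately show "set_lebesgue_integral lebesgue A f = 0"
    using borel A(4) integral_cong_AE[of "\<lambda>x. indicator A x *\<^sub>R f x" lebesgue "\<lambda>x. indicator S x *\<^sub>R f x"]
    unfolding set_lebesgue_integral_def by auto
qed

lemma AE_lebesgue_on_iff: "open S \<Longrightarrow> (AE x in lebesgue_on S. P x) \<longleftrightarrow> (AE x in lebesgue. x \<in> S \<longrightarrow> P x)"
  by (subst AE_restrict_space_iff) auto

text \<open>On a closed box inside \<Omega> the function is integrable, and bumps transfer the
  orthogonality to indicators of smaller boxes. Countably many such boxes cover \<Omega>.\<close>

lemma AE_eq_0_if_orthogonal_test_functions:
  assumes \<Omega>: "open \<Omega>" and g: "g \<in> L1_loc \<Omega>"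
    and orth: "\<And>v. v \<in> test_functions \<Omega> \<Longrightarrow> (LINT x|lebesgue_on \<Omega>. g x * v x) = 0"
  shows "AE x in lebesgue_on \<Omega>. g x = 0"
proof -
  have \<Omega>m: "\<Omega> \<in> sets lebesgue" using \<Omega> by auto
  have loc: "AE x in lebesgue. x \<in> box a b \<longrightarrow> g x = 0" if ab: "cbox a b \<subseteq> \<Omega>" for a b
  proof -
    let ?f = "\<lambda>x. indicator (box a b) x *\<^sub>R g x"
    have "integrable (lebesgue_on (cbox a b)) g" using g ab by (auto simp: L1_loc_def)
    then have intc: "integrable lebesgue (\<lambda>x. indicator (cbox a b) x *\<^sub>R g x)"
      by (subst (asm) integrable_restrict_space) auto
    have i: "integrable lebesgue (\<lambda>x. indicator (box a b) x *\<^sub>R (indicator (cbox a b) x *\<^sub>R g x))"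
      by (rule integrable_mult_indicator[OF _ intc]) auto
    have "indicator (box a b) x *\<^sub>R (indicator (cbox a b) x *\<^sub>R g x) = ?f x" for x
      using box_subset_cbox[of a b] by (auto simp: indicator_def)
    then have f: "integrable lebesgue ?f" using i by (simp only:)
    have box0: "(\<integral>x. indicator (box c d) x *\<^sub>R g x \<partial>lebesgue) = 0" if cd: "box c d \<subseteq> box a b" for c d
    proof (cases "box c d = {}")
      case False
      then have "box a b \<noteq> {}" using cd by blast
      with False have "cbox c d \<subseteq> cbox a b"
        using closure_mono[OF cd] by (simp add: closure_box)
      then have cd': "cbox c d \<subseteq> \<Omega>" using ab by blast
      define \<beta> where "\<beta> i x = bump (inverse (real (Suc i))) c d x" for i x
      have \<beta>: "(\<lambda>x. complex_of_real (\<beta> i x)) \<in> test_functions \<Omega>" for i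
        unfolding \<beta>_def by (rule bump_test_function[OF _ cd']) simp
      have b: "0 \<le> \<beta> i x" "\<beta> i x \<le> 1" "\<beta> i x \<noteq> 0 \<longleftrightarrow> x \<in> box c d" for i x
        using bump_bounds[of "inverse (real (Suc i))" c d x] bump_pos_iff[of "inverse (real (Suc i))" c d x]
        unfolding \<beta>_def by auto
      have e: "g x * of_real (\<beta> i x) = \<beta> i x *\<^sub>R ?f x" for i x
        using b(3)[of i x] cd by (cases "x \<in> box c d") (auto simp: scaleR_conv_of_real)
      have m: "\<beta> i \<in> borel_measurable lebesgue" for i
      proof -
        have "continuous_on UNIV (\<lambda>x. Re (complex_of_real (\<beta> i x)))"
          by (intro continuous_on_Re smooth_continuous test_functionsD(1)[OF \<beta>])
        then show ?thesis by (auto intro!: measurable_completion borel_measurable_continuous_onI)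
      qed
      have "(LINT x|lebesgue_on \<Omega>. g x * of_real (\<beta> i x)) = 0" for i by (rule orth[OF \<beta>])
      then have z: "(\<integral>x. \<beta> i x *\<^sub>R ?f x \<partial>lebesgue) = 0" for i
        using integral_lebesgue_on_support(1)[OF \<Omega>m, of "\<lambda>x. g x * of_real (\<beta> i x)"] test_function_outside[OF \<beta>]
        by (simp add: e)
      have "(\<lambda>i. \<integral>x. \<beta> i x *\<^sub>R ?f x \<partial>lebesgue) \<longlonglongrightarrow> (\<integral>x. indicator (box c d) x *\<^sub>R ?f x \<partial>lebesgue)"
      proof (rule integral_dominated_convergence[where w="\<lambda>x. norm (?f x)"])
        show "AE x in lebesgue. (\<lambda>i. \<beta> i x *\<^sub>R ?f x) \<longlonglongrightarrow> indicator (box c d) x *\<^sub>R ?f x"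
          unfolding \<beta>_def by (intro AE_I2 tendsto_scaleR bump_tendsto_indicator tendsto_const)
        show "AE x in lebesgue. norm (\<beta> i x *\<^sub>R ?f x) \<le> norm (?f x)" for i
          using b by (intro AE_I2) (simp add: mult_left_le_one_le mult.assoc)
        show "(\<lambda>x. indicator (box c d) x *\<^sub>R ?f x) \<in> borel_measurable lebesgue"
          by (intro borel_measurable_scaleR[OF borel_measurable_indicator borel_measurable_integrable[OF f]]) auto
        show "(\<lambda>x. \<beta> i x *\<^sub>R ?f x) \<in> borel_measurable lebesgue" for i
          by (intro borel_measurable_scaleR[OF m borel_measurable_integrable[OF f]])
        show "integrable lebesgue (\<lambda>x. norm (?f x))" by (rule integrable_norm[OF f])
      qed
      moreover have "indicator (box c d) x *\<^sub>R ?f x = indicator (box c d) x *\<^sub>R g x" for x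
        using cd by (auto simp: indicator_def)
      ultimately have "(\<lambda>i::nat. 0) \<longlonglongrightarrow> (\<integral>x. indicator (box c d) x *\<^sub>R g x \<partial>lebesgue)"
        by (simp only: z)
      then show ?thesis by (simp add: LIMSEQ_const_iff)
    qed simp
    have "AE x in lebesgue. ?f x = 0"
    proof (rule AE_eq_0_if_box_integrals_eq_0[OF f])
      show "(\<integral>x. ?f x \<partial>lebesgue) = 0" using box0[of a b] by simp
      show "(\<integral>x. indicator (box c d) x *\<^sub>R ?f x \<partial>lebesgue) = 0" for c d
      proof -
        \<comment> \<open>An arbitrary box is cut down to its intersection with
          \<open>box a b\<close>, which is again a box.\<close>
        obtain p q where pq: "box c d \<inter> box a b = box p q" using box_Int_box by blast
        have "x \<in> box p q \<longleftrightarrow> x \<in> box c d \<and> x \<in> box a b" for x using pq by blast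
        then have "indicator (box c d) x *\<^sub>R ?f x = indicator (box p q) x *\<^sub>R g x" for x
          by (simp add: indicator_def)
        moreover have "box p q \<subseteq> box a b" using pq by blast
        ultimately show ?thesis using box0[of p q] by (simp only:)
      qed
    qed
    then show ?thesis by eventually_elim (auto simp: indicator_def split: if_splits)
  qed
  have "AE x in lebesgue. x \<in> \<Omega> \<longrightarrow> g x = 0"
  proof -
    obtain D where D: "countable D" "D \<subseteq> Pow \<Omega>" "\<And>X. X \<in> D \<Longrightarrow> \<exists>a b. X = cbox a b" "\<Union>D = \<Omega>"
      using open_countable_Union_open_cbox[OF \<Omega>] by metis
    have "AE x in lebesgue. x \<in> X \<longrightarrow> g x = 0" if XD: "X \<in> D" for X
    proof -
      obtain a b where X: "X = cbox a b" "cbox a b \<subseteq> \<Omega>" using D(2) D(3)[OF XD] XD by blast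
      \<comment> \<open>The cover consists of closed boxes while \<open>loc\<close> concerns open
        ones; the faces are negligible.\<close>
      have "cbox a b - box a b \<in> null_sets lebesgue"
        using negligible_frontier_interval negligible_iff_null_sets by blast
      then have "AE x in lebesgue. x \<notin> cbox a b - box a b" by (rule AE_not_in)
      with loc[OF X(2)] show ?thesis by eventually_elim (use X in auto)
    qed
    then have "AE x in lebesgue. \<forall>X\<in>D. x \<in> X \<longrightarrow> g x = 0"
      by (subst AE_ball_countable[OF D(1)]) blast
    then show ?thesis by eventually_elim (use D(4) in auto)
  qed
  then show ?thesis by (simp add: AE_lebesgue_on_iff \<Omega>)
qed

section \<open>The space \<open>L\<^sup>2\<close>\<close>

text \<open>The squared \<open>L2\<close> norm. Squares keep the estimates polynomial, at the price
  of factors 2 and 3 in place of the triangle inequality.\<close>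

definition nsq :: "(real ^ 'n::finite) set \<Rightarrow> (real ^ 'n \<Rightarrow> complex) \<Rightarrow> real" where
  "nsq S u = (LINT x|lebesgue_on S. (norm (u x))\<^sup>2)"

lemma nsq_nonneg: "0 \<le> nsq S u" unfolding nsq_def by simp

lemma norm_add_squared_le: "(norm (a + b))\<^sup>2 \<le> 2 * (norm a)\<^sup>2 + 2 * (norm (b :: 'a::real_normed_vector))\<^sup>2"
proof -
  have "(norm (a + b))\<^sup>2 \<le> (norm a + norm b)\<^sup>2" by (simp add: norm_triangle_ineq power_mono)
  also have "\<dots> \<le> 2 * (norm a)\<^sup>2 + 2 * (norm b)\<^sup>2"
    using zero_le_power2[of "norm a - norm b"] by (simp add: power2_eq_square algebra_simps)
  finally show ?thesis .
qed

lemma L2_measurable: "u \<in> L2 S \<Longrightarrow> u \<in> borel_measurable (lebesgue_on S)"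
  and L2_integrable: "u \<in> L2 S \<Longrightarrow> integrable (lebesgue_on S) (\<lambda>x. (norm (u x))\<^sup>2)"
  by (auto simp: L2_def)

lemma L2_bound:
  assumes "integrable (lebesgue_on S) w" "u \<in> borel_measurable (lebesgue_on S)"
    "AE x in lebesgue_on S. (norm (u x))\<^sup>2 \<le> w x"
  shows "u \<in> L2 S"
proof -
  have "integrable (lebesgue_on S) (\<lambda>x. (norm (u x))\<^sup>2)"
    by (rule Bochner_Integration.integrable_bound[OF assms(1)]) (use assms in auto)
  with assms show ?thesis by (simp add: L2_def)
qed

lemma L2_add: assumes "u \<in> L2 S" "v \<in> L2 S" shows "(\<lambda>x. u x + v x) \<in> L2 S"
  using assms by (intro L2_bound[where w="\<lambda>x. 2 * (norm (u x))\<^sup>2 + 2 * (norm (v x))\<^sup>2"])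
    (auto simp: L2_integrable norm_add_squared_le intro: borel_measurable_add L2_measurable)

lemma L2_cmult: assumes "u \<in> L2 S" shows "(\<lambda>x. z * u x) \<in> L2 S"
  using assms by (intro L2_bound[where w="\<lambda>x. (norm z)\<^sup>2 * (norm (u x))\<^sup>2"])
    (auto simp: L2_integrable norm_mult power_mult_distrib intro!: borel_measurable_times L2_measurable[OF assms])

lemma L2_diff: assumes "u \<in> L2 S" "v \<in> L2 S" shows "(\<lambda>x. u x - v x) \<in> L2 S"
  using L2_add[OF assms(1) L2_cmult[OF assms(2), of "-1"]] by simp

lemma L2_bounded_mult:
  assumes "u \<in> L2 S" "m \<in> borel_measurable (lebesgue_on S)" "\<And>x. x \<in> S \<Longrightarrow> norm (m x) \<le> B"
  shows "(\<lambda>x. m x * u x) \<in> L2 S"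
proof (rule L2_bound[where w="\<lambda>x. B\<^sup>2 * (norm (u x))\<^sup>2"])
  show "AE x in lebesgue_on S. (norm (m x * u x))\<^sup>2 \<le> B\<^sup>2 * (norm (u x))\<^sup>2"
  proof (rule AE_I2)
    fix x assume "x \<in> space (lebesgue_on S)"
    then have "norm (m x * u x) \<le> B * norm (u x)" using assms(3) by (simp add: norm_mult mult_right_mono)
    then have "(norm (m x * u x))\<^sup>2 \<le> (B * norm (u x))\<^sup>2" by (simp add: power_mono)
    then show "(norm (m x * u x))\<^sup>2 \<le> B\<^sup>2 * (norm (u x))\<^sup>2" by (simp add: power_mult_distrib)
  qed
qed (use assms in \<open>auto simp: L2_integrable intro!: borel_measurable_times L2_measurable[OF assms(1)]\<close>)

lemma L2_cong: assumes "\<And>x. x \<in> S \<Longrightarrow> u x = v x" shows "u \<in> L2 S \<longleftrightarrow> v \<in> L2 S"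
proof -
  have "u \<in> borel_measurable (lebesgue_on S) \<longleftrightarrow> v \<in> borel_measurable (lebesgue_on S)"
    by (rule measurable_lebesgue_cong[OF assms])
  moreover have "integrable (lebesgue_on S) (\<lambda>x. (norm (u x))\<^sup>2) \<longleftrightarrow> integrable (lebesgue_on S) (\<lambda>x. (norm (v x))\<^sup>2)"
    by (rule Bochner_Integration.integrable_cong) (use assms in auto)
  ultimately show ?thesis by (simp add: L2_def)
qed

lemma lebesgue_on_subset:
  fixes f :: "'a::euclidean_space \<Rightarrow> 'b::{banach, second_countable_topology}"
  assumes "T \<subseteq> S" "T \<in> sets lebesgue" "S \<in> sets lebesgue"
  shows "integrable (lebesgue_on S) f \<Longrightarrow> integrable (lebesgue_on T) f"
    "f \<in> borel_measurable (lebesgue_on S) \<Longrightarrow> f \<in> borel_measurable (lebesgue_on T)"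
proof -
  show "f \<in> borel_measurable (lebesgue_on S) \<Longrightarrow> f \<in> borel_measurable (lebesgue_on T)"
    by (rule measurable_restrict_mono[OF _ assms(1)])
  show "integrable (lebesgue_on T) f" if "integrable (lebesgue_on S) f"
  proof -
    have "integrable lebesgue (\<lambda>x. indicator S x *\<^sub>R f x)"
      using that assms(3) by (simp add: integrable_restrict_space)
    then have i: "integrable lebesgue (\<lambda>x. indicator T x *\<^sub>R (indicator S x *\<^sub>R f x))"
      by (rule integrable_mult_indicator[OF assms(2)])
    have "indicator T x *\<^sub>R (indicator S x *\<^sub>R f x) = indicator T x *\<^sub>R f x" for x
      using assms(1) by (auto simp: indicator_def)
    with i have "integrable lebesgue (\<lambda>x. indicator T x *\<^sub>R f x)" by (simp only:)
    then show ?thesis using assms(2) by (simp add: integrable_restrict_space)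
  qed
qed

lemma L2_subset:
  assumes "T \<subseteq> S" "T \<in> sets lebesgue" "S \<in> sets lebesgue" "u \<in> L2 S" shows "u \<in> L2 T"
  using assms lebesgue_on_subset[OF assms(1-3)] by (auto simp: L2_def)

lemma nsq_subset:
  assumes "T \<subseteq> S" "T \<in> sets lebesgue" "S \<in> sets lebesgue" "u \<in> L2 S" shows "nsq T u \<le> nsq S u"
  unfolding nsq_def
  by (rule integral_mono_lebesgue_on_AE)
    (use assms L2_integrable[OF assms(4)] L2_integrable[OF L2_subset[OF assms]] in auto)

lemma L2_mult_integrable:
  assumes "u \<in> L2 S" "v \<in> L2 S" shows "integrable (lebesgue_on S) (\<lambda>x. u x * v x)"
proof (rule Bochner_Integration.integrable_bound)
  show "integrable (lebesgue_on S) (\<lambda>x. (norm (u x))\<^sup>2 + (norm (v x))\<^sup>2)"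
    using assms by (simp add: L2_integrable)
  show "AE x in lebesgue_on S. norm (u x * v x) \<le> norm ((norm (u x))\<^sup>2 + (norm (v x))\<^sup>2)"
  proof (rule AE_I2)
    fix x
    have "norm (u x) * norm (v x) \<le> (norm (u x))\<^sup>2 + (norm (v x))\<^sup>2"
      using sum_squares_bound[of "norm (u x)" "norm (v x)"] mult_nonneg_nonneg[OF norm_ge_zero[of "u x"] norm_ge_zero[of "v x"]] by linarith
    then show "norm (u x * v x) \<le> norm ((norm (u x))\<^sup>2 + (norm (v x))\<^sup>2)" by (simp add: norm_mult)
  qed
qed (intro borel_measurable_times L2_measurable assms)

text \<open>Supremum bounds, such as those that come with the Perron operators, become
  \<open>L2\<close> bounds because the domain has finite measure.\<close>

lemma nsq_le_const:
  assumes "g \<in> L2 S" "S \<in> lmeasurable" "\<And>x. x \<in> S \<Longrightarrow> norm (g x) \<le> \<beta>"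
  shows "nsq S g \<le> \<beta>\<^sup>2 * measure lebesgue S"
proof -
  interpret finite_measure "lebesgue_on S" by (rule finite_measure_lebesgue_on[OF assms(2)])
  have "nsq S g \<le> (LINT x|lebesgue_on S. \<beta>\<^sup>2)"
    unfolding nsq_def using assms(3) by (intro integral_mono L2_integrable[OF assms(1)]) (auto intro: power_mono)
  then show ?thesis using assms(2) by (simp add: measure_restrict_space mult.commute fmeasurableD)
qed

lemma sum3_squared_le: "(p + q + r)\<^sup>2 \<le> 3 * p\<^sup>2 + 3 * q\<^sup>2 + 3 * (r::real)\<^sup>2"
  using zero_le_power2[of "p - q"] zero_le_power2[of "p - r"] zero_le_power2[of "q - r"]
  by (simp add: power2_eq_square algebra_simps)

lemma integrable_lebesgue_on_extend:
  fixes f :: "'a::euclidean_space \<Rightarrow> real"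
  assumes "integrable (lebesgue_on K) f" "K \<in> sets lebesgue" "\<Omega> \<in> sets lebesgue"
  shows "integrable (lebesgue_on \<Omega>) (\<lambda>x. if x \<in> K then f x else 0)"
  using lebesgue_on_subset(1)[of \<Omega> UNIV "\<lambda>x. if x \<in> K then f x else 0"]
    Lebesgue_Measure.integrable_restrict_UNIV[OF assms(2), of f] assms by (simp add: lebesgue_on_UNIV_eq)

lemma nsq_add_le:
  assumes "u \<in> L2 S" "v \<in> L2 S" shows "nsq S (\<lambda>x. u x + v x) \<le> 2 * nsq S u + 2 * nsq S v"
proof -
  have "nsq S (\<lambda>x. u x + v x) \<le> (LINT x|lebesgue_on S. 2 * (norm (u x))\<^sup>2 + 2 * (norm (v x))\<^sup>2)"
    unfolding nsq_def using assms L2_integrable[OF L2_add[OF assms]]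
    by (intro integral_mono) (auto simp: L2_integrable norm_add_squared_le)
  then show ?thesis using assms by (simp add: L2_integrable nsq_def)
qed

lemma nsq_cmult: "nsq S (\<lambda>x. z * u x) = (norm z)\<^sup>2 * nsq S u"
  by (simp add: nsq_def norm_mult power_mult_distrib)

lemma nsq_diff_le:
  assumes "u \<in> L2 S" "v \<in> L2 S" shows "nsq S (\<lambda>x. u x - v x) \<le> 2 * nsq S u + 2 * nsq S v"
  using nsq_add_le[OF assms(1) L2_cmult[OF assms(2), of "-1"]] nsq_cmult[of S "-1" v] by simp

lemma nsq_minus_commute: "nsq S (\<lambda>x. u x - v x) = nsq S (\<lambda>x. v x - u x)"
  by (simp add: nsq_def norm_minus_commute)

lemma nsq_parallelogram:
  assumes "u \<in> L2 S" "v \<in> L2 S"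
  shows "nsq S (\<lambda>x. u x + v x) + nsq S (\<lambda>x. u x - v x) = 2 * nsq S u + 2 * nsq S v"
proof -
  have "nsq S (\<lambda>x. u x + v x) + nsq S (\<lambda>x. u x - v x)
      = (LINT x|lebesgue_on S. (norm (u x + v x))\<^sup>2 + (norm (u x - v x))\<^sup>2)"
    unfolding nsq_def using L2_add[OF assms] L2_diff[OF assms] by (simp add: L2_integrable)
  also have "\<dots> = (LINT x|lebesgue_on S. 2 * (norm (u x))\<^sup>2 + 2 * (norm (v x))\<^sup>2)"
  proof (rule Bochner_Integration.integral_cong[OF refl])
    show "(norm (u x + v x))\<^sup>2 + (norm (u x - v x))\<^sup>2 = 2 * (norm (u x))\<^sup>2 + 2 * (norm (v x))\<^sup>2" for x
      unfolding cmod_power2 by (simp add: power2_eq_square algebra_simps)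
  qed
  also have "\<dots> = 2 * nsq S u + 2 * nsq S v" unfolding nsq_def using assms by (simp add: L2_integrable)
  finally show ?thesis .
qed

lemma nn_integral_nsq:
  assumes "u \<in> L2 S" shows "(\<integral>\<^sup>+x. ennreal ((norm (u x))\<^sup>2) \<partial>lebesgue_on S) = ennreal (nsq S u)"
  unfolding nsq_def using L2_integrable[OF assms] by (intro nn_integral_eq_integral) auto

lemma L2_Cauchy_Schwarz:
  assumes "u \<in> L2 S" "v \<in> L2 S"
  shows "(norm (LINT x|lebesgue_on S. u x * v x))\<^sup>2 \<le> nsq S u * nsq S v"
proof -
  let ?M = "lebesgue_on S"
  have uv: "integrable ?M (\<lambda>x. norm (u x * v x))" using L2_mult_integrable[OF assms] by simp
  note [measurable] = L2_measurable[OF assms(1)] L2_measurable[OF assms(2)]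
  have "(\<integral>\<^sup>+x. ennreal (norm (u x)) * ennreal (norm (v x)) \<partial>?M)\<^sup>2
      \<le> (\<integral>\<^sup>+x. (ennreal (norm (u x)))\<^sup>2 \<partial>?M) * (\<integral>\<^sup>+x. (ennreal (norm (v x)))\<^sup>2 \<partial>?M)"
    by (rule Cauchy_Schwarz_nn_integral) auto
  also have "\<dots> = ennreal (nsq S u) * ennreal (nsq S v)"
    using nn_integral_nsq[OF assms(1)] nn_integral_nsq[OF assms(2)] by (simp add: ennreal_power)
  also have "(\<integral>\<^sup>+x. ennreal (norm (u x)) * ennreal (norm (v x)) \<partial>?M) = ennreal (LINT x|?M. norm (u x * v x))"
    using nn_integral_eq_integral[OF uv] by (simp add: norm_mult ennreal_mult)
  finally have "(LINT x|?M. norm (u x * v x))\<^sup>2 \<le> nsq S u * nsq S v"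
    by (simp add: ennreal_power ennreal_mult[symmetric] nsq_nonneg)
  moreover have "norm (LINT x|?M. u x * v x) \<le> (LINT x|?M. norm (u x * v x))"
    by (rule integral_norm_bound)
  ultimately show ?thesis by (meson norm_ge_zero order_trans power_mono)
qed

text \<open>Cauchy-Schwarz bounds the difference of the integrals. In this form the defining
  identity of a weak derivative survives limits.\<close>

lemma L2_tendsto_integral_mult:
  assumes "\<And>i. p i \<in> L2 S" "f \<in> L2 S" "v \<in> L2 S" "(\<lambda>i. nsq S (\<lambda>x. p i x - f x)) \<longlonglongrightarrow> 0"
  shows "(\<lambda>i. LINT x|lebesgue_on S. p i x * v x) \<longlonglongrightarrow> (LINT x|lebesgue_on S. f x * v x)"
proof -
  have "(\<lambda>i. sqrt (nsq S (\<lambda>x. p i x - f x) * nsq S v)) \<longlonglongrightarrow> sqrt (0 * nsq S v)"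
    by (intro tendsto_intros assms)
  then have "(\<lambda>i. (LINT x|lebesgue_on S. p i x * v x) - (LINT x|lebesgue_on S. f x * v x)) \<longlonglongrightarrow> 0"
  proof (rule Lim_null_comparison[rotated, OF tendsto_eq_rhs])
    show "\<forall>\<^sub>F i in sequentially. norm ((LINT x|lebesgue_on S. p i x * v x) - (LINT x|lebesgue_on S. f x * v x))
       \<le> sqrt (nsq S (\<lambda>x. p i x - f x) * nsq S v)"
    proof (intro always_eventually allI real_le_rsqrt)
      fix i
      have "(LINT x|lebesgue_on S. p i x * v x) - (LINT x|lebesgue_on S. f x * v x) = (LINT x|lebesgue_on S. (p i x - f x) * v x)"
        using assms by (simp add: L2_mult_integrable left_diff_distrib)
      then show "(norm ((LINT x|lebesgue_on S. p i x * v x) - (LINT x|lebesgue_on S. f x * v x)))\<^sup>2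
          \<le> nsq S (\<lambda>x. p i x - f x) * nsq S v"
        using L2_Cauchy_Schwarz[OF L2_diff[OF assms(1,2)] assms(3)] by simp
    qed
  qed simp
  then show ?thesis by (rule LIM_zero_cancel)
qed

text \<open>This is the Riesz-Fischer argument: a rapidly Cauchy subsequence converges almost
  everywhere, and Fatou's lemma makes its pointwise limit a limit in the mean.\<close>

lemma L2_complete:
  assumes p: "\<And>i. p i \<in> L2 S"
    and Cauchy: "\<And>e. 0 < e \<Longrightarrow> \<exists>N. \<forall>m\<ge>N. \<forall>n\<ge>N. nsq S (\<lambda>x. p m x - p n x) < e"
  obtains f where "f \<in> L2 S" "(\<lambda>i. nsq S (\<lambda>x. p i x - f x)) \<longlonglongrightarrow> 0"
proof -
  let ?M = "lebesgue_on S"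
  note [measurable] = L2_measurable[OF p]
  have "\<exists>N. \<forall>k. (\<forall>m\<ge>N k. \<forall>n\<ge>N k. nsq S (\<lambda>x. p m x - p n x) < 1 / 4 ^ k) \<and> N k < N (Suc k)"
  proof (rule dependent_nat_choice)
    show "\<exists>N. \<forall>m\<ge>N. \<forall>n\<ge>N. nsq S (\<lambda>x. p m x - p n x) < 1 / 4 ^ 0" by (rule Cauchy) simp
    fix N k
    obtain N' where "\<forall>m\<ge>N'. \<forall>n\<ge>N'. nsq S (\<lambda>x. p m x - p n x) < 1 / 4 ^ Suc k"
      using Cauchy[of "1 / 4 ^ Suc k"] by auto
    then show "\<exists>N''. (\<forall>m\<ge>N''. \<forall>n\<ge>N''. nsq S (\<lambda>x. p m x - p n x) < 1 / 4 ^ Suc k) \<and> N < N''"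
      by (intro exI[of _ "max N' (Suc N)"]) auto
  qed
  then obtain r where r: "\<And>k m n. r k \<le> m \<Longrightarrow> r k \<le> n \<Longrightarrow> nsq S (\<lambda>x. p m x - p n x) < 1 / 4 ^ k"
      and rmono: "\<And>k. r k < r (Suc k)" by blast
  \<comment> \<open>The increments have squared norm below 4^-k, so even with weight 2^k their
    squares have an integrable sum. Almost everywhere 2 d_k \<le> 2^k d_k^2 + 2^-k then turns this
    into absolute convergence.\<close>
  define d where "d k x = norm (p (r (Suc k)) x - p (r k) x)" for k x
  have [measurable]: "d k \<in> borel_measurable ?M" for k unfolding d_def by measurable
  have "(\<integral>\<^sup>+x. (\<Sum>k. ennreal (2 ^ k * (d k x)\<^sup>2)) \<partial>?M) = (\<Sum>k. \<integral>\<^sup>+x. ennreal (2 ^ k * (d k x)\<^sup>2) \<partial>?M)"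
    by (rule nn_integral_suminf) measurable
  also have "\<dots> \<le> (\<Sum>k. ennreal ((1/2) ^ k))"
  proof (rule suminf_le)
    fix k
    have "(\<integral>\<^sup>+x. ennreal (2 ^ k * (d k x)\<^sup>2) \<partial>?M) = ennreal (2 ^ k) * (\<integral>\<^sup>+x. ennreal ((d k x)\<^sup>2) \<partial>?M)"
      by (subst nn_integral_cmult[symmetric]) (auto simp: ennreal_mult)
    also have "\<dots> = ennreal (2 ^ k * nsq S (\<lambda>x. p (r (Suc k)) x - p (r k) x))"
      using nn_integral_nsq[OF L2_diff[OF p p]] unfolding d_def by (simp add: ennreal_mult nsq_nonneg)
    also have "\<dots> \<le> ennreal (2 ^ k * (1 / 4 ^ k))"
      using r[of k "r (Suc k)" "r k"] rmono[of k] by (intro ennreal_leI mult_left_mono) auto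
    also have "2 ^ k * (1 / 4 ^ k) = (1/2 :: real) ^ k"
      by (simp add: power_divide flip: power_mult_distrib[of 2 2]) (simp add: field_simps flip: power_mult_distrib)
    finally show "(\<integral>\<^sup>+x. ennreal (2 ^ k * (d k x)\<^sup>2) \<partial>?M) \<le> ennreal ((1/2) ^ k)" .
  qed auto
  also have "\<dots> < \<infinity>"
    by (subst suminf_ennreal2) (auto intro: summable_geometric)
  finally have "AE x in ?M. (\<Sum>k. ennreal (2 ^ k * (d k x)\<^sup>2)) \<noteq> \<infinity>"
    by (intro nn_integral_PInf_AE) auto
  then have conv: "AE x in ?M. convergent (\<lambda>k. p (r k) x)"
  proof eventually_elim
    case (elim x)
    then have s: "summable (\<lambda>k. 2 ^ k * (d k x)\<^sup>2)"
      by (intro summable_suminf_not_top) auto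
    have "summable (\<lambda>k. d k x)"
    proof (rule summable_comparison_test'[where N=0])
      show "summable (\<lambda>k. (2 ^ k * (d k x)\<^sup>2 + (1/2) ^ k) / 2)"
        by (intro summable_divide summable_add s summable_geometric) auto
      fix k
      have "0 \<le> (2 ^ k * d k x - 1)\<^sup>2 / 2 ^ k" by simp
      also have "\<dots> = 2 ^ k * (d k x)\<^sup>2 + (1/2) ^ k - 2 * d k x"
        by (simp add: power2_eq_square field_simps power_one_over)
      finally show "norm (d k x) \<le> (2 ^ k * (d k x)\<^sup>2 + (1/2) ^ k) / 2"
        by (simp add: d_def)
    qed
    then have "summable (\<lambda>k. p (r (Suc k)) x - p (r k) x)"
      unfolding d_def by (rule summable_norm_cancel)
    then have "convergent (\<lambda>n. (\<Sum>k<n. p (r (Suc k)) x - p (r k) x) + p (r 0) x)"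
      by (intro convergent_add convergent_const) (simp add: summable_iff_convergent)
    moreover have "(\<Sum>k<n. p (r (Suc k)) x - p (r k) x) + p (r 0) x = p (r n) x" for n
      using sum_lessThan_telescope[of "\<lambda>k. p (r k) x" n] by simp
    ultimately show ?case by (simp only:)
  qed
  \<comment> \<open>Where the subsequence diverges \<open>lim\<close> is arbitrary; this concerns a
    null set only.\<close>
  define f where "f x = lim (\<lambda>k. p (r k) x)" for x
  have [measurable]: "f \<in> borel_measurable ?M" unfolding f_def by measurable
  have bound: "(\<integral>\<^sup>+x. ennreal ((norm (p m x - f x))\<^sup>2) \<partial>?M) \<le> ennreal (1 / 4 ^ k)" if "r k \<le> m" for k m
  proof -
    have "AE x in ?M. ennreal ((norm (p m x - f x))\<^sup>2) = liminf (\<lambda>j. ennreal ((norm (p m x - p (r j) x))\<^sup>2))"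
      using conv
    proof eventually_elim
      case (elim x)
      then have "(\<lambda>j. p (r j) x) \<longlonglongrightarrow> f x" unfolding f_def by (simp add: convergent_LIMSEQ_iff)
      then have "(\<lambda>j. ennreal ((norm (p m x - p (r j) x))\<^sup>2)) \<longlonglongrightarrow> ennreal ((norm (p m x - f x))\<^sup>2)"
        by (intro tendsto_intros tendsto_ennrealI)
      then show ?case by (rule lim_imp_Liminf[OF sequentially_bot, symmetric])
    qed
    then have "(\<integral>\<^sup>+x. ennreal ((norm (p m x - f x))\<^sup>2) \<partial>?M)
        = (\<integral>\<^sup>+x. liminf (\<lambda>j. ennreal ((norm (p m x - p (r j) x))\<^sup>2)) \<partial>?M)"
      by (rule nn_integral_cong_AE)
    also have "\<dots> \<le> liminf (\<lambda>j. \<integral>\<^sup>+x. ennreal ((norm (p m x - p (r j) x))\<^sup>2) \<partial>?M)"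
      by (rule nn_integral_liminf) measurable
    also have "\<dots> \<le> limsup (\<lambda>j. \<integral>\<^sup>+x. ennreal ((norm (p m x - p (r j) x))\<^sup>2) \<partial>?M)"
      by (rule Liminf_le_Limsup) simp
    also have "\<dots> \<le> ennreal (1 / 4 ^ k)"
    proof (rule Limsup_bounded)
      show "\<forall>\<^sub>F j in sequentially. (\<integral>\<^sup>+x. ennreal ((norm (p m x - p (r j) x))\<^sup>2) \<partial>?M) \<le> ennreal (1 / 4 ^ k)"
      proof (rule eventually_sequentiallyI[of k])
        fix j assume "k \<le> j"
        then have "r k \<le> r j" using rmono by (simp add: lift_Suc_mono_le less_imp_le)
        then show "(\<integral>\<^sup>+x. ennreal ((norm (p m x - p (r j) x))\<^sup>2) \<partial>?M) \<le> ennreal (1 / 4 ^ k)"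
          using r[OF that] nn_integral_nsq[OF L2_diff[OF p p]] by (simp add: ennreal_leI less_imp_le)
      qed
    qed
    finally show ?thesis .
  qed
  have diff: "(\<lambda>x. p m x - f x) \<in> L2 S" if "r k \<le> m" for k m
  proof -
    have "(\<integral>\<^sup>+x. ennreal (norm ((norm (p m x - f x))\<^sup>2)) \<partial>?M) < \<infinity>"
      using order.strict_trans1[OF bound[OF that]] by (simp add: ennreal_less_top)
    then show ?thesis by (auto simp: L2_def integrable_iff_bounded)
  qed
  have f: "f \<in> L2 S" using L2_diff[OF p[of "r 0"] diff[of 0 "r 0"]] by simp
  moreover have "(\<lambda>i. nsq S (\<lambda>x. p i x - f x)) \<longlonglongrightarrow> 0"
  proof (rule LIMSEQ_I)
    fix e :: real assume "0 < e"
    then obtain k where k: "(1/4 :: real) ^ k < e" using real_arch_pow_inv[of e "1/4"] by auto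
    have "nsq S (\<lambda>x. p i x - f x) \<le> 1 / 4 ^ k" if "r k \<le> i" for i
      using bound[OF that] nn_integral_nsq[OF L2_diff[OF p f]] by simp
    then show "\<exists>N. \<forall>i\<ge>N. norm (nsq S (\<lambda>x. p i x - f x) - 0) < e"
      using k nsq_nonneg[of S] by (intro exI[of _ "r k"]) (auto simp: power_one_over abs_of_nonneg intro: le_less_trans)
  qed
  ultimately show thesis by (rule that)
qed

section \<open>Weak derivatives\<close>

lemma L1_loc_mult_test_integrable:
  assumes g: "g \<in> L1_loc \<Omega>" and v: "v \<in> test_functions \<Omega>" and \<Omega>: "open \<Omega>"
  shows "integrable (lebesgue_on \<Omega>) (\<lambda>x. g x * v x)"
proof -
  obtain K where K: "smooth v" "compact K" "K \<subseteq> \<Omega>" "\<forall>x. x \<notin> K \<longrightarrow> v x = 0"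
    using v unfolding test_functions_iff by blast
  obtain B where B: "0 \<le> B" "\<And>x. norm (v x) \<le> B" using test_function_bounded[OF v] by blast
  have Km: "K \<in> sets lebesgue" using K(2) by (simp add: borel_compact)
  have vm: "v \<in> borel_measurable lebesgue"
    by (intro measurable_completion borel_measurable_continuous_onI smooth_continuous[OF K(1)] | simp)+
  have gK: "integrable (lebesgue_on K) g" using g K by (auto simp: L1_loc_def)
  have "integrable (lebesgue_on K) (\<lambda>x. g x * v x)"
  proof (rule Bochner_Integration.integrable_bound)
    show "integrable (lebesgue_on K) (\<lambda>x. B * norm (g x))" using gK by simp
    show "(\<lambda>x. g x * v x) \<in> borel_measurable (lebesgue_on K)"
      using vm by (intro borel_measurable_times borel_measurable_integrable[OF gK] measurable_restrict_space1)
    show "AE x in lebesgue_on K. norm (g x * v x) \<le> norm (B * norm (g x))"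
      using B by (intro AE_I2) (simp add: norm_mult mult.commute[of B] mult_left_mono)
  qed
  then have "integrable lebesgue (\<lambda>x. g x * v x)"
    using integral_lebesgue_on_support(2)[OF Km, of "\<lambda>x. g x * v x"] K(4) by simp
  moreover have "\<Omega> \<in> sets lebesgue" using \<Omega> by auto
  moreover have "v x = 0" if "x \<notin> \<Omega>" for x using K that by blast
  ultimately show ?thesis
    using integral_lebesgue_on_support(2)[of \<Omega> "\<lambda>x. g x * v x"] by simp
qed

lemma L1_loc_add: "f \<in> L1_loc \<Omega> \<Longrightarrow> g \<in> L1_loc \<Omega> \<Longrightarrow> (\<lambda>x. f x + g x) \<in> L1_loc \<Omega>"
  and L1_loc_cmult: "f \<in> L1_loc \<Omega> \<Longrightarrow> (\<lambda>x. z * f x) \<in> L1_loc \<Omega>"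
  and L1_loc_diff: "f \<in> L1_loc \<Omega> \<Longrightarrow> g \<in> L1_loc \<Omega> \<Longrightarrow> (\<lambda>x. f x - g x) \<in> L1_loc \<Omega>"
  by (auto simp: L1_loc_def)

lemma L2_imp_integrable:
  assumes "u \<in> L2 S" "S \<in> lmeasurable" shows "integrable (lebesgue_on S) u"
proof -
  interpret finite_measure "lebesgue_on S" by (rule finite_measure_lebesgue_on[OF assms(2)])
  have "(\<lambda>x. 1) \<in> L2 S" by (simp add: L2_def)
  then show ?thesis using L2_mult_integrable[OF assms(1), of "\<lambda>x. 1"] by simp
qed

lemma L2_imp_L1_loc: assumes "u \<in> L2 \<Omega>" "open \<Omega>" shows "u \<in> L1_loc \<Omega>"
  unfolding L1_loc_def
proof safe
  fix K assume K: "compact K" "K \<subseteq> \<Omega>"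
  have "u \<in> L2 K" by (rule L2_subset[OF K(2) _ _ assms(1)]) (use K assms in \<open>auto simp: borel_compact\<close>)
  then show "integrable (lebesgue_on K) u" by (rule L2_imp_integrable) (simp add: K lmeasurable_compact)
qed

lemma has_weak_partial_unique:
  assumes "open \<Omega>" "has_weak_partial \<Omega> k u g" "has_weak_partial \<Omega> k u g'"
  shows "AE x in lebesgue_on \<Omega>. g x = g' x"
proof -
  have "AE x in lebesgue_on \<Omega>. g x - g' x = 0"
  proof (rule AE_eq_0_if_orthogonal_test_functions[OF assms(1)])
    show "(\<lambda>x. g x - g' x) \<in> L1_loc \<Omega>" using assms by (auto simp: has_weak_partial_def intro: L1_loc_diff)
    fix v assume v: "v \<in> test_functions \<Omega>"
    have "(LINT x|lebesgue_on \<Omega>. (g x - g' x) * v x) = (LINT x|lebesgue_on \<Omega>. g x * v x) - (LINT x|lebesgue_on \<Omega>. g' x * v x)"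
      using assms v by (simp add: has_weak_partial_def L1_loc_mult_test_integrable left_diff_distrib)
    then show "(LINT x|lebesgue_on \<Omega>. (g x - g' x) * v x) = 0"
      using assms v by (auto simp: has_weak_partial_def)
  qed
  then show ?thesis by simp
qed

lemma weak_partial_AE:
  assumes "open \<Omega>" "has_weak_partial \<Omega> k u g"
  shows "AE x in lebesgue_on \<Omega>. weak_partial \<Omega> k u x = g x"
proof -
  have "has_weak_partial \<Omega> k u (weak_partial \<Omega> k u)"
    unfolding weak_partial_def by (rule someI[where P="has_weak_partial \<Omega> k u", OF assms(2)])
  then show ?thesis by (rule has_weak_partial_unique[OF assms(1) _ assms(2)])
qed

lemma has_weak_partial_add:
  assumes "open \<Omega>" "has_weak_partial \<Omega> k u g" "has_weak_partial \<Omega> k u' g'"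
  shows "has_weak_partial \<Omega> k (\<lambda>x. u x + u' x) (\<lambda>x. g x + g' x)"
  using assms unfolding has_weak_partial_def
  by (auto simp: L1_loc_add distrib_right L1_loc_mult_test_integrable test_functions_partial)

lemma has_weak_partial_cmult:
  assumes "open \<Omega>" "has_weak_partial \<Omega> k u g"
  shows "has_weak_partial \<Omega> k (\<lambda>x. z * u x) (\<lambda>x. z * g x)"
  using assms unfolding has_weak_partial_def
  by (auto simp: L1_loc_cmult mult.assoc L1_loc_mult_test_integrable test_functions_partial)

lemma has_weak_partial_diff:
  assumes "open \<Omega>" "has_weak_partial \<Omega> k u g" "has_weak_partial \<Omega> k u' g'"
  shows "has_weak_partial \<Omega> k (\<lambda>x. u x - u' x) (\<lambda>x. g x - g' x)"
  using has_weak_partial_add[OF assms(1,2) has_weak_partial_cmult[OF assms(1,3), of "-1"]] by simp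

lemma L1_loc_cong: "(\<And>x. x \<in> \<Omega> \<Longrightarrow> u x = u' x) \<Longrightarrow> u \<in> L1_loc \<Omega> \<longleftrightarrow> u' \<in> L1_loc \<Omega>"
  unfolding L1_loc_def mem_Collect_eq
  by (intro all_cong Bochner_Integration.integrable_cong) auto

lemma has_weak_partial_cong:
  assumes "\<And>x. x \<in> \<Omega> \<Longrightarrow> u x = u' x"
  shows "has_weak_partial \<Omega> k u g \<longleftrightarrow> has_weak_partial \<Omega> k u' g"
proof -
  have "(LINT x|lebesgue_on \<Omega>. u x * w x) = (LINT x|lebesgue_on \<Omega>. u' x * w x)" for w
    by (rule Bochner_Integration.integral_cong) (use assms in auto)
  then show ?thesis using L1_loc_cong[of \<Omega> u u', OF assms] by (simp add: has_weak_partial_def)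
qed

text \<open>Test functions of \<open>V\<close> vanish off \<open>V\<close>, so integrals against
  them over \<open>V\<close> and over \<Omega> agree.\<close>

lemma has_weak_partial_subset:
  assumes "open \<Omega>" "open V" "V \<subseteq> \<Omega>" "has_weak_partial \<Omega> k u g"
  shows "has_weak_partial V k u g"
proof -
  have "(LINT x|lebesgue_on V. w x * v x) = (LINT x|lebesgue_on \<Omega>. w x * v x)" if "v \<in> test_functions V" for w v
  proof -
    have "v x = 0" if "x \<notin> \<Omega>" for x using test_function_outside[OF \<open>v \<in> test_functions V\<close>] that assms(3) by blast
    then show ?thesis
      using integral_lebesgue_on_support(1)[of V "\<lambda>x. w x * v x"] integral_lebesgue_on_support(1)[of \<Omega> "\<lambda>x. w x * v x"]
        test_function_outside[OF that] assms(1,2) by simp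
  qed
  then show ?thesis
    using assms test_functions_mono[OF assms(3)] test_functions_partial[of _ V k]
    unfolding has_weak_partial_def L1_loc_def by (auto dest: subsetD)
qed

lemma smooth_measurable:
  assumes "smooth f" shows "f \<in> borel_measurable (lebesgue_on S)"
proof -
  have "f \<in> borel_measurable borel" by (intro borel_measurable_continuous_onI smooth_continuous[OF assms])
  then show ?thesis by (intro measurable_restrict_space1 measurable_completion) simp
qed

lemma smooth_L2:
  assumes "smooth f" "bounded S" "S \<in> sets lebesgue" shows "f \<in> L2 S"
proof -
  have "bounded (f ` closure S)"
    using assms by (intro compact_imp_bounded compact_continuous_image smooth_continuous) auto
  then obtain B where B: "\<And>x. x \<in> S \<Longrightarrow> norm (f x) \<le> B" using closure_subset by (auto simp: bounded_iff)
  have "S \<in> lmeasurable" using assms by (simp add: bounded_set_imp_lmeasurable)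
  then interpret finite_measure "lebesgue_on S" by (rule finite_measure_lebesgue_on)
  have "(\<lambda>x. 1) \<in> L2 S" by (simp add: L2_def)
  then show ?thesis using L2_bounded_mult[of "\<lambda>x. 1" S f B] B smooth_measurable[OF assms(1)] by simp
qed

lemma test_function_L2: assumes "v \<in> test_functions \<Omega>" "S \<in> sets lebesgue" shows "v \<in> L2 S"
proof -
  obtain K where K: "smooth v" "compact K" "\<forall>x. x \<notin> K \<longrightarrow> v x = 0"
    using assms unfolding test_functions_iff by blast
  have "integrable lborel (\<lambda>x. (norm (v x))\<^sup>2)"
    by (rule continuous_compact_support_integrable[OF _ K(2)]) (use K in \<open>auto intro!: continuous_intros smooth_continuous\<close>)
  then have "integrable lebesgue (\<lambda>x. (norm (v x))\<^sup>2)" by (simp add: integrable_completion)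
  then have "integrable (lebesgue_on S) (\<lambda>x. (norm (v x))\<^sup>2)"
    using lebesgue_on_subset(1)[of S UNIV "\<lambda>x. (norm (v x))\<^sup>2"] assms(2) by (simp add: lebesgue_on_UNIV_eq)
  then show ?thesis using smooth_measurable[OF K(1)] by (simp add: L2_def)
qed

lemma smooth_L1_loc: assumes "smooth f" shows "f \<in> L1_loc \<Omega>"
  unfolding L1_loc_def
proof safe
  fix K :: "(real ^ 'a) set" assume K: "compact K"
  show "integrable (lebesgue_on K) f"
    by (intro L2_imp_integrable smooth_L2 assms)
      (use K in \<open>auto simp: borel_compact compact_imp_bounded lmeasurable_compact\<close>)
qed

lemma smooth_has_weak_partial:
  assumes "smooth f" "open \<Omega>" shows "has_weak_partial \<Omega> k f (partial k f)"
proof -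
  have I: "(LINT x|lebesgue_on \<Omega>. w x * v x) = (\<integral>x. w x * v x \<partial>lborel)" if "smooth w" "v \<in> test_functions \<Omega>" for w v
  proof -
    have "(\<lambda>x. w x * v x) \<in> borel_measurable borel"
      using smooth_continuous test_functionsD(1)[OF test_functions_mult[OF that]]
      by (intro borel_measurable_continuous_onI) blast
    then have "(\<integral>x. w x * v x \<partial>lebesgue) = (\<integral>x. w x * v x \<partial>lborel)" by (intro integral_completion) simp
    then show ?thesis
      using integral_lebesgue_on_support(1)[of \<Omega> "\<lambda>x. w x * v x"] test_function_outside[OF that(2)] assms(2) by auto
  qed
  show ?thesis unfolding has_weak_partial_def
    using integration_by_parts[OF assms(1)] I[OF assms(1) test_functions_partial]
      I[OF smooth_partial[OF assms(1)]] by (auto intro!: smooth_L1_loc smooth_partial assms)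
qed

section \<open>The spaces \<open>H1\<close> and \<open>H1_0\<close>\<close>

lemma H1I:
  assumes "u \<in> L2 \<Omega>" "\<And>k. G k \<in> L2 \<Omega>" "\<And>k. has_weak_partial \<Omega> k u (G k)" shows "u \<in> H1 \<Omega>"
  using assms by (auto simp: H1_def)

lemma H1E:
  assumes "u \<in> H1 \<Omega>"
  obtains G where "u \<in> L2 \<Omega>" "\<And>k. G k \<in> L2 \<Omega>" "\<And>k. has_weak_partial \<Omega> k u (G k)"
proof -
  have "\<forall>k. \<exists>g. g \<in> L2 \<Omega> \<and> has_weak_partial \<Omega> k u g" using assms by (auto simp: H1_def)
  then obtain G where "\<forall>k. G k \<in> L2 \<Omega> \<and> has_weak_partial \<Omega> k u (G k)" by metis
  with that assms show thesis by (auto simp: H1_def)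
qed

lemma H1_add: assumes "open \<Omega>" "u \<in> H1 \<Omega>" "v \<in> H1 \<Omega>" shows "(\<lambda>x. u x + v x) \<in> H1 \<Omega>"
proof -
  obtain F where F: "u \<in> L2 \<Omega>" "\<And>k. F k \<in> L2 \<Omega>" "\<And>k. has_weak_partial \<Omega> k u (F k)" using H1E[OF assms(2)] by blast
  obtain G where G: "v \<in> L2 \<Omega>" "\<And>k. G k \<in> L2 \<Omega>" "\<And>k. has_weak_partial \<Omega> k v (G k)" using H1E[OF assms(3)] by blast
  show ?thesis
    by (rule H1I[where G="\<lambda>k x. F k x + G k x"]) (intro L2_add has_weak_partial_add assms F G)+
qed

lemma H1_cmult: assumes "open \<Omega>" "u \<in> H1 \<Omega>" shows "(\<lambda>x. z * u x) \<in> H1 \<Omega>"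
proof -
  obtain F where F: "u \<in> L2 \<Omega>" "\<And>k. F k \<in> L2 \<Omega>" "\<And>k. has_weak_partial \<Omega> k u (F k)" using H1E[OF assms(2)] by blast
  show ?thesis
    by (rule H1I[where G="\<lambda>k x. z * F k x"]) (intro L2_cmult has_weak_partial_cmult assms F)+
qed

lemma H1_diff: assumes "open \<Omega>" "u \<in> H1 \<Omega>" "v \<in> H1 \<Omega>" shows "(\<lambda>x. u x - v x) \<in> H1 \<Omega>"
  using H1_add[OF assms(1,2) H1_cmult[OF assms(1,3), of "-1"]] by simp

lemma H1_cong: assumes "\<And>x. x \<in> \<Omega> \<Longrightarrow> u x = v x" shows "u \<in> H1 \<Omega> \<longleftrightarrow> v \<in> H1 \<Omega>"
  using L2_cong[of \<Omega> u v, OF assms] has_weak_partial_cong[of \<Omega> u v, OF assms] by (simp add: H1_def)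

lemma smooth_H1: assumes "smooth f" "open \<Omega>" "bounded \<Omega>" shows "f \<in> H1 \<Omega>"
  by (rule H1I[where G="\<lambda>k. partial k f"]) (use assms in \<open>auto intro: smooth_L2 smooth_partial smooth_has_weak_partial\<close>)

text \<open>Lebesgue measure is complete. This matters for \<open>weak_partial\<close>, a choice
  among functions whose measurability is known on compact subsets of \<Omega> only.\<close>

lemma borel_measurable_lebesgue_on_AE:
  fixes f :: "'a::euclidean_space \<Rightarrow> 'b::euclidean_space"
  assumes "open S" "f \<in> borel_measurable (lebesgue_on S)" "AE x in lebesgue_on S. f x = g x"
  shows "g \<in> borel_measurable (lebesgue_on S)"
proof -
  have "AE x in lebesgue. (if x \<in> S then f x else 0) = (if x \<in> S then g x else 0)"
    using assms(3) unfolding AE_lebesgue_on_iff[OF assms(1)] by eventually_elim auto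
  moreover have "(\<lambda>x. if x \<in> S then f x else 0) \<in> borel_measurable lebesgue"
    using assms by (simp add: borel_measurable_if)
  ultimately have "(\<lambda>x. if x \<in> S then g x else 0) \<in> borel_measurable lebesgue"
    by (rule borel_measurable_AE[rotated])
  then show ?thesis by (rule borel_measurable_if_D)
qed

text \<open>Weak derivatives are unique almost everywhere, so \<open>H1_norm\<close> does not depend
  on the choice hidden in \<open>weak_partial\<close>.\<close>

lemma H1_norm_eq:
  assumes "open \<Omega>" "\<And>k. has_weak_partial \<Omega> k u (G k)"
    and "\<And>k. G k \<in> L2 \<Omega>"
  shows "H1_norm \<Omega> u = sqrt (nsq \<Omega> u + (\<Sum>k\<in>UNIV. nsq \<Omega> (G k)))"
proof -
  have "(LINT x|lebesgue_on \<Omega>. (norm (weak_partial \<Omega> k u x))\<^sup>2) = nsq \<Omega> (G k)" for k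
  proof -
    note ae = weak_partial_AE[OF assms(1,2), of k]
    have m: "G k \<in> borel_measurable (lebesgue_on \<Omega>)" by (rule L2_measurable[OF assms(3)])
    have "AE x in lebesgue_on \<Omega>. G k x = weak_partial \<Omega> k u x" using ae by eventually_elim simp
    then have [measurable]: "weak_partial \<Omega> k u \<in> borel_measurable (lebesgue_on \<Omega>)"
      by (rule borel_measurable_lebesgue_on_AE[OF assms(1) m])
    show ?thesis unfolding nsq_def
      by (rule integral_cong_AE) (use m ae in auto)
  qed
  then show ?thesis by (simp add: H1_norm_def nsq_def)
qed

lemma H1_0_approx:
  assumes \<Omega>: "open \<Omega>" and u: "u \<in> H1_0 \<Omega>" and G: "\<And>k. has_weak_partial \<Omega> k u (G k)" "\<And>k. G k \<in> L2 \<Omega>"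
    and \<eta>: "0 < \<eta>"
  obtains v where "v \<in> test_functions \<Omega>" "nsq \<Omega> (\<lambda>x. u x - v x) < \<eta>" "\<And>k. nsq \<Omega> (\<lambda>x. G k x - partial k v x) < \<eta>"
proof -
  obtain v where v: "v \<in> test_functions \<Omega>" "H1_norm \<Omega> (\<lambda>x. u x - v x) < sqrt \<eta>"
    using u \<eta> unfolding H1_0_def mem_Collect_eq by (meson real_sqrt_gt_zero)
  note sv = test_functionsD(1)[OF v(1)]
  have \<Omega>m: "\<Omega> \<in> sets lebesgue" using \<Omega> by auto
  have "H1_norm \<Omega> (\<lambda>x. u x - v x) = sqrt (nsq \<Omega> (\<lambda>x. u x - v x) + (\<Sum>k\<in>UNIV. nsq \<Omega> (\<lambda>x. G k x - partial k v x)))"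
    by (intro H1_norm_eq \<Omega> has_weak_partial_diff G smooth_has_weak_partial sv L2_diff
        test_function_L2[OF test_functions_partial[OF v(1)] \<Omega>m])
  with v(2) have s: "nsq \<Omega> (\<lambda>x. u x - v x) + (\<Sum>k\<in>UNIV. nsq \<Omega> (\<lambda>x. G k x - partial k v x)) < \<eta>" by simp
  have "nsq \<Omega> (\<lambda>x. G k x - partial k v x) \<le> (\<Sum>k\<in>UNIV. nsq \<Omega> (\<lambda>x. G k x - partial k v x))" for k
    by (rule member_le_sum) (auto simp: nsq_nonneg)
  moreover have "0 \<le> (\<Sum>k\<in>UNIV. nsq \<Omega> (\<lambda>x. G k x - partial k v x))" by (simp add: sum_nonneg nsq_nonneg)
  ultimately show thesis
    using s nsq_nonneg[of \<Omega> "\<lambda>x. u x - v x"] by (intro that[OF v(1)]) (smt (verit))+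
qed

text \<open>A minimizing sequence for the gradient norm is Cauchy by the parallelogram law; this replaces the
  weak compactness of bounded sets in \<open>H\<^sup>1\<close>.\<close>

lemma weak_gradient_of_bounded_approximation:
  assumes V: "open V" and f: "f \<in> L2 V"
    and C: "\<And>p. p \<in> C \<Longrightarrow> smooth p" "\<And>p. p \<in> C \<Longrightarrow> p \<in> L2 V" "\<And>p k. p \<in> C \<Longrightarrow> partial k p \<in> L2 V"
    and mid: "\<And>p q. p \<in> C \<Longrightarrow> q \<in> C \<Longrightarrow> (\<lambda>x. (1/2) * (p x + q x)) \<in> C"
    and approx: "\<And>e. 0 < e \<Longrightarrow> \<exists>p\<in>C. nsq V (\<lambda>x. p x - f x) < e \<and> (\<Sum>k\<in>UNIV. nsq V (partial k p)) \<le> B"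
  obtains G p where "\<And>k. G k \<in> L2 V" "\<And>k. has_weak_partial V k f (G k)" "\<And>i. p i \<in> C"
    "(\<lambda>i. nsq V (\<lambda>x. p i x - f x)) \<longlonglongrightarrow> 0" "\<And>k. (\<lambda>i. nsq V (\<lambda>x. partial k (p i) x - G k x)) \<longlonglongrightarrow> 0"
proof -
  define N where "N p = (\<Sum>k\<in>UNIV. nsq V (partial k p))" for p
  define D where "D p q = (\<Sum>k\<in>UNIV. nsq V (\<lambda>x. partial k p x - partial k q x))" for p q
  define r where "r n = inverse (real (Suc n))" for n
  have r: "0 < r n" "n \<le> m \<Longrightarrow> r m \<le> r n" for m n by (auto simp: r_def)
  have r0: "r \<longlonglongrightarrow> 0" unfolding r_def by (rule LIMSEQ_inverse_real_of_nat)
  \<comment> \<open>These sets are closed under midpoints and shrink as \<open>n\<close> grows. The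
    sequence is found by nearly minimizing the gradient energy over each of them.\<close>
  define Cn where "Cn n = {p \<in> C. nsq V (\<lambda>x. p x - f x) \<le> r n}" for n
  have N0: "0 \<le> N p" for p by (simp add: N_def sum_nonneg nsq_nonneg)
  have Cn_mid: "(\<lambda>x. (1/2) * (p x + q x)) \<in> Cn n" if "p \<in> Cn n" "q \<in> Cn n" for p q n
  proof -
    have pq: "p \<in> C" "q \<in> C" using that by (auto simp: Cn_def)
    have "nsq V (\<lambda>x. (1/2) * (p x + q x) - f x) = nsq V (\<lambda>x. (1/2) * ((p x - f x) + (q x - f x)))"
      by (simp add: algebra_simps)
    also have "\<dots> = (1/4) * nsq V (\<lambda>x. (p x - f x) + (q x - f x))" by (subst nsq_cmult) (simp add: power2_eq_square)
    also have "\<dots> \<le> (1/4) * (2 * nsq V (\<lambda>x. p x - f x) + 2 * nsq V (\<lambda>x. q x - f x))"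
      using nsq_add_le[OF L2_diff[OF C(2)[OF pq(1)] f] L2_diff[OF C(2)[OF pq(2)] f]] by simp
    also have "\<dots> \<le> r n" using that by (simp add: Cn_def)
    finally show ?thesis using mid[OF pq] by (simp add: Cn_def)
  qed
  \<comment> \<open>The parallelogram law summed over the partials; the factor 4 undoes the 1/2 of
    the midpoint.\<close>
  have par: "4 * N (\<lambda>x. (1/2) * (p x + q x)) + D p q = 2 * N p + 2 * N q" if "p \<in> C" "q \<in> C" for p q
  proof -
    have "4 * nsq V (partial k (\<lambda>x. (1/2) * (p x + q x))) + nsq V (\<lambda>x. partial k p x - partial k q x)
        = 2 * nsq V (partial k p) + 2 * nsq V (partial k q)" for k
    proof -
      have "partial k (\<lambda>x. (1/2) * (p x + q x)) = (\<lambda>x. (1/2) * (partial k p x + partial k q x))"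
        using smooth_partial_cmult[OF smooth_intros(2)[OF C(1)[OF that(1)] C(1)[OF that(2)]]]
          smooth_partial_add[OF C(1)[OF that(1)] C(1)[OF that(2)]] by (intro ext) (simp only:)
      then have "nsq V (partial k (\<lambda>x. (1/2) * (p x + q x))) = (norm (1/2 :: complex))\<^sup>2 * nsq V (\<lambda>x. partial k p x + partial k q x)"
        by (simp only: nsq_cmult)
      then have "4 * nsq V (partial k (\<lambda>x. (1/2) * (p x + q x))) = nsq V (\<lambda>x. partial k p x + partial k q x)"
        by (simp only:) (simp add: power2_eq_square)
      then show ?thesis using nsq_parallelogram[OF C(3)[OF that(1)] C(3)[OF that(2)], of k k] by simp
    qed
    then show ?thesis
      unfolding N_def D_def by (simp add: sum_distrib_left flip: sum.distrib)
  qed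
  define d where "d n = Inf (N ` Cn n)" for n
  have bdd: "bdd_below (N ` Cn n)" for n using N0 by (auto intro: bdd_belowI[of _ 0])
  have ex: "\<exists>p\<in>Cn n. N p \<le> B" for n
    using approx[OF r(1)[of n]] by (auto simp: Cn_def N_def less_imp_le)
  have dB: "d n \<le> B" for n using ex[of n] cINF_lower[OF bdd, of _ n] by (auto simp: d_def intro: order_trans)
  have dinc: "d n \<le> d m" if "n \<le> m" for n m
    unfolding d_def using ex[of m] r(2)[OF that] by (intro cInf_superset_mono bdd image_mono) (auto simp: Cn_def)
  have dle: "d n \<le> N p" if "p \<in> Cn n" for n p unfolding d_def using that by (intro cINF_lower bdd)
  have "\<exists>p\<in>Cn n. N p < d n + r n" for n
    using cInf_lessD[of "N ` Cn n" "d n + r n"] ex[of n] r(1)[of n] by (auto simp: d_def)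
  then obtain p where p: "\<And>n. p n \<in> Cn n" "\<And>n. N (p n) < d n + r n" by metis
  have pC: "p n \<in> C" for n using p(1)[of n] by (simp add: Cn_def)
  \<comment> \<open>The midpoint lies in \<open>Cn n\<close>, so its energy is at least
    \<open>d n\<close>. The parallelogram law leaves 2 (d m + r m) + 2 (d n + r n) - 4 d n, and r m
    \<le> r n.\<close>
  have D: "D (p m) (p n) \<le> 2 * (d m - d n) + 4 * r n" if "n \<le> m" for m n
  proof -
    have "p m \<in> Cn n" using p(1)[of m] r(2)[OF that] by (auto simp: Cn_def)
    then have M: "d n \<le> N (\<lambda>x. (1/2) * (p m x + p n x))" by (intro dle Cn_mid p)
    have "D (p m) (p n) \<le> 2 * (d m - d n) + 4 * r n" if "d n \<le> M" "4 * M + D (p m) (p n) = 2 * N (p m) + 2 * N (p n)" for M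
      using that p(2)[of m] p(2)[of n] r(2)[OF \<open>n \<le> m\<close>] by (simp add: algebra_simps)
    then show ?thesis using M par[OF pC pC] by blast
  qed
  \<comment> \<open>Infima over shrinking sets increase, and \<open>B\<close> bounds them, so their
    differences tend to 0.\<close>
  have "incseq d" using dinc by (auto simp: incseq_def)
  then have "convergent d" using dB by (meson Bseq_monoseq_convergent incseq_convergent convergentI)
  then have "Cauchy d" by (rule convergent_Cauchy)
  have DC: "\<exists>M. \<forall>m\<ge>M. \<forall>n\<ge>M. D (p m) (p n) < e" if e: "0 < e" for e
  proof -
    obtain M1 where M1: "\<forall>m\<ge>M1. \<forall>n\<ge>M1. norm (d m - d n) < e / 8" using CauchyD[OF \<open>Cauchy d\<close>, of "e/8"] e by auto
    obtain M2 where M2: "\<forall>n\<ge>M2. norm (r n - 0) < e / 8" using LIMSEQ_D[OF r0, of "e/8"] e by auto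
    have main: "D (p m) (p n) < e" if "max M1 M2 \<le> n" "n \<le> m" for m n
    proof -
      have "norm (d m - d n) < e/8" "norm (r n - 0) < e/8" using M1 M2 that by auto
      then have "d m < d n + e / 8" "r n < e / 8" unfolding real_norm_def by linarith+
      moreover have "D (p m) (p n) \<le> 2 * d m - 2 * d n + 4 * r n" using D[OF that(2)] by (simp only: right_diff_distrib)
      ultimately show ?thesis using e by linarith
    qed
    have sym: "D p q = D q p" for p q unfolding D_def by (intro sum.cong refl nsq_minus_commute)
    show ?thesis
    proof (intro exI[of _ "max M1 M2"] allI impI)
      fix m n assume "max M1 M2 \<le> m" "max M1 M2 \<le> n"
      then show "D (p m) (p n) < e" using main[of n m] main[of m n] sym[of "p m" "p n"] by (cases "n \<le> m") auto
    qed
  qed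
  have "\<exists>g. g \<in> L2 V \<and> (\<lambda>i. nsq V (\<lambda>x. partial k (p i) x - g x)) \<longlonglongrightarrow> 0" for k
  proof -
    have "nsq V (\<lambda>x. partial k (p m) x - partial k (p n) x) \<le> D (p m) (p n)" for m n
      unfolding D_def by (rule member_le_sum) (auto simp: nsq_nonneg)
    then have "\<exists>M. \<forall>m\<ge>M. \<forall>n\<ge>M. nsq V (\<lambda>x. partial k (p m) x - partial k (p n) x) < e" if "0 < e" for e
      using DC[OF that] by (meson le_less_trans)
    then obtain g where "g \<in> L2 V" "(\<lambda>i. nsq V (\<lambda>x. partial k (p i) x - g x)) \<longlonglongrightarrow> 0"
      using L2_complete[of "\<lambda>i. partial k (p i)" V, OF C(3)[OF pC]] by blast
    then show ?thesis by blast
  qed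
  then have "\<exists>G. \<forall>k. G k \<in> L2 V \<and> (\<lambda>i. nsq V (\<lambda>x. partial k (p i) x - G k x)) \<longlonglongrightarrow> 0"
    by (intro choice allI)
  then obtain G where G: "\<And>k. G k \<in> L2 V" "\<And>k. (\<lambda>i. nsq V (\<lambda>x. partial k (p i) x - G k x)) \<longlonglongrightarrow> 0" by blast
  have pf: "(\<lambda>i. nsq V (\<lambda>x. p i x - f x)) \<longlonglongrightarrow> 0"
    by (rule tendsto_sandwich[OF _ _ tendsto_const r0]) (use p(1) in \<open>auto simp: Cn_def nsq_nonneg\<close>)
  have Vm: "V \<in> sets lebesgue" using V by auto
  have "has_weak_partial V k f (G k)" for k
    unfolding has_weak_partial_def
  proof (intro conjI ballI L2_imp_L1_loc V f G)
    fix v assume v: "v \<in> test_functions V"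
    have "(\<lambda>i. LINT x|lebesgue_on V. p i x * partial k v x) \<longlonglongrightarrow> (LINT x|lebesgue_on V. f x * partial k v x)"
      by (intro L2_tendsto_integral_mult C(2)[OF pC] f pf test_function_L2[OF test_functions_partial[OF v] Vm])
    moreover have "(LINT x|lebesgue_on V. p i x * partial k v x) = - (LINT x|lebesgue_on V. partial k (p i) x * v x)" for i
      using smooth_has_weak_partial[OF C(1)[OF pC] V] v by (auto simp: has_weak_partial_def)
    moreover have "(\<lambda>i. - (LINT x|lebesgue_on V. partial k (p i) x * v x)) \<longlonglongrightarrow> - (LINT x|lebesgue_on V. G k x * v x)"
      by (intro tendsto_minus L2_tendsto_integral_mult C(3)[OF pC] G test_function_L2[OF v Vm])
    ultimately show "(LINT x|lebesgue_on V. f x * partial k v x) = - (LINT x|lebesgue_on V. G k x * v x)"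
      using LIMSEQ_unique by (simp only:)
  qed
  with G pC pf show thesis by (intro that)
qed

section \<open>Mollification\<close>

lemma onorm_partial_sum_le: "onorm (\<lambda>h :: real ^ 'n. \<Sum>k\<in>UNIV. h $ k *\<^sub>R (z k :: complex)) \<le> (\<Sum>k\<in>UNIV. norm (z k))"
proof (rule onorm_le)
  fix h :: "real ^ 'n"
  have "norm (\<Sum>k\<in>UNIV. h $ k *\<^sub>R z k) \<le> (\<Sum>k\<in>UNIV. norm h * norm (z k))"
    by (intro sum_norm_le) (simp add: component_le_norm_cart mult_right_mono)
  then show "norm (\<Sum>k\<in>UNIV. h $ k *\<^sub>R z k) \<le> (\<Sum>k\<in>UNIV. norm (z k)) * norm h"
    by (simp add: sum_distrib_left mult.commute)
qed

lemma test_function_Lipschitz: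
  assumes "v \<in> test_functions \<Omega>"
  obtains L where "0 \<le> L" "\<And>x y. norm (v x - v y) \<le> L * norm (x - y)"
proof -
  have "\<exists>B. 0 \<le> B \<and> (\<forall>x. norm (partial k v x) \<le> B)" for k
    using test_function_bounded[OF test_functions_partial[OF assms]] by metis
  then obtain B where B: "\<And>k. 0 \<le> B k" "\<And>k x. norm (partial k v x) \<le> B k" by metis
  have "norm (v x - v y) \<le> (\<Sum>k\<in>UNIV. B k) * norm (x - y)" for x y
  proof (rule differentiable_bound[of UNIV])
    show "(v has_derivative (\<lambda>h. \<Sum>k\<in>UNIV. h $ k *\<^sub>R partial k v x)) (at x within UNIV)" for x
      using smooth_has_derivative[OF test_functionsD(1)[OF assms]] by simp
    show "onorm (\<lambda>h. \<Sum>k\<in>UNIV. h $ k *\<^sub>R partial k v x) \<le> (\<Sum>k\<in>UNIV. B k)" for x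
      by (rule order_trans[OF onorm_partial_sum_le]) (intro sum_mono B)
  qed auto
  with that[of "\<Sum>k\<in>UNIV. B k"] B(1) show thesis by (simp add: sum_nonneg)
qed

text \<open>The partials are Lipschitz, which gives a second-order remainder uniform in
  \<open>x\<close>. Increments under a convolution integral can then be estimated directly.\<close>

lemma test_function_Taylor:
  assumes v: "v \<in> test_functions \<Omega>"
  obtains L where "0 \<le> L" "\<And>x h. norm (v (x + h) - v x - (\<Sum>k\<in>UNIV. h $ k *\<^sub>R partial k v x)) \<le> L * (norm h)\<^sup>2"
proof -
  have "\<exists>L. 0 \<le> L \<and> (\<forall>x y. norm (partial k v x - partial k v y) \<le> L * norm (x - y))" for k
    using test_function_Lipschitz[OF test_functions_partial[OF v]] by metis
  then obtain L where L: "\<And>k. 0 \<le> L k" "\<And>k x y. norm (partial k v x - partial k v y) \<le> L k * norm (x - y)" by metis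
  have "norm (v (x + h) - v x - (\<Sum>k\<in>UNIV. h $ k *\<^sub>R partial k v x)) \<le> (\<Sum>k\<in>UNIV. L k) * (norm h)\<^sup>2" for x h
  proof -
    let ?f = "\<lambda>y h. \<Sum>k\<in>UNIV. h $ k *\<^sub>R partial k v y"
    have "norm (v (x + h) - v x - ?f x ((x + h) - x)) \<le> norm ((x + h) - x) * ((\<Sum>k\<in>UNIV. L k) * norm h)"
    proof (rule differentiable_bound_linearization[where S="cball x (norm h)"])
      show "x + t *\<^sub>R (x + h - x) \<in> cball x (norm h)" if "t \<in> {0..1}" for t
        using that by (simp add: dist_norm mult_left_le_one_le)
      show "(v has_derivative ?f y) (at y within cball x (norm h))" for y
        using smooth_has_derivative[OF test_functionsD(1)[OF v]] by (rule has_derivative_at_withinI)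
      fix y assume y: "y \<in> cball x (norm h)"
      have "?f y - ?f x = (\<lambda>h. \<Sum>k\<in>UNIV. h $ k *\<^sub>R (partial k v y - partial k v x))"
        by (auto simp: sum_subtractf scaleR_diff_right)
      then have "onorm (?f y - ?f x) \<le> (\<Sum>k\<in>UNIV. norm (partial k v y - partial k v x))"
        by (simp only: onorm_partial_sum_le)
      also have "\<dots> \<le> (\<Sum>k\<in>UNIV. L k * norm h)"
        using y by (intro sum_mono order_trans[OF L(2)] mult_left_mono L(1)) (simp add: dist_norm norm_minus_commute)
      finally show "onorm (?f y - ?f x) \<le> (\<Sum>k\<in>UNIV. L k) * norm h" by (simp add: sum_distrib_right)
    qed simp
    then show ?thesis by (simp add: power2_eq_square mult_ac)
  qed
  with that[of "\<Sum>k\<in>UNIV. L k"] L(1) show thesis by (simp add: sum_nonneg)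
qed

lemma C_k_affine: "C_k m f \<Longrightarrow> C_k m (\<lambda>y. f (r *\<^sub>R y + t))"
proof (induction m arbitrary: f)
  case 0
  then show ?case by (auto intro!: continuous_intros continuous_on_compose2[of UNIV f])
next
  case (Suc m)
  show ?case
  proof (rule C_k_SucI)
    fix y
    have 1: "((\<lambda>y. r *\<^sub>R y + t) has_derivative (\<lambda>h. r *\<^sub>R h)) (at y)"
      by (auto intro!: derivative_eq_intros)
    show "((\<lambda>y. f (r *\<^sub>R y + t)) has_derivative (\<lambda>h. frechet_derivative f (at (r *\<^sub>R y + t)) (r *\<^sub>R h))) (at y)"
      by (rule has_derivative_compose[OF 1 C_k_Suc_derivative[OF Suc.prems]])
  next
    fix k
    have "frechet_derivative f (at y) (r *\<^sub>R axis k 1) = of_real r * partial k f y" for y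
      using linear_scale[OF linear_frechet_derivative, of f "at y" r "axis k 1"] Suc.prems
      by (simp add: partial_def differentiable_on_def scaleR_conv_of_real)
    then show "C_k m (\<lambda>y. frechet_derivative f (at (r *\<^sub>R y + t)) (r *\<^sub>R axis k 1))"
      using C_k_mult[OF C_k_const Suc.IH[of "partial k f"]] Suc.prems by simp
  qed
qed

lemma smooth_reflect: "smooth f \<Longrightarrow> smooth (\<lambda>y. f (x - y))"
  using C_k_affine[of _ f "-1" x] by (simp add: smooth_def)

lemma partial_reflect:
  assumes "smooth f" shows "partial k (\<lambda>y. f (x - y)) y = - partial k f (x - y)"
proof -
  have 1: "((\<lambda>y. x - y) has_derivative (\<lambda>h. - h)) (at y)" by (auto intro!: derivative_eq_intros)
  show ?thesis
    by (rule partial_eqI[THEN trans, OF has_derivative_compose[OF 1 smooth_has_derivative[OF assms]]])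
      (simp add: axis_def if_distrib[of "\<lambda>r. scaleR r _"] if_distrib[of uminus] cong: if_cong)
qed

text \<open>Convolution with \<open>g\<close> extended by zero; integrating over \<Omega> avoids
  writing the extension.\<close>

definition conv :: "(real ^ 'n::finite) set \<Rightarrow> (real ^ 'n \<Rightarrow> complex) \<Rightarrow> (real ^ 'n \<Rightarrow> complex) \<Rightarrow> real ^ 'n \<Rightarrow> complex" where
  "conv \<Omega> \<rho> g x = (LINT y|lebesgue_on \<Omega>. \<rho> (x - y) * g y)"

lemma conv_integrable:
  assumes \<rho>: "\<rho> \<in> test_functions UNIV" and g: "integrable (lebesgue_on \<Omega>) g"
  shows "integrable (lebesgue_on \<Omega>) (\<lambda>y. \<rho> (x - y) * g y)"
proof -
  obtain B where B: "0 \<le> B" "\<And>x. norm (\<rho> x) \<le> B" using test_function_bounded[OF \<rho>] by blast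
  show ?thesis
  proof (rule Bochner_Integration.integrable_bound)
    show "integrable (lebesgue_on \<Omega>) (\<lambda>x. B * norm (g x))" using g by simp
    show "(\<lambda>y. \<rho> (x - y) * g y) \<in> borel_measurable (lebesgue_on \<Omega>)"
      by (intro borel_measurable_times smooth_measurable smooth_reflect test_functionsD(1)[OF \<rho>] borel_measurable_integrable[OF g])
    show "AE y in lebesgue_on \<Omega>. norm (\<rho> (x - y) * g y) \<le> norm (B * norm (g y))"
      using B by (intro AE_I2) (simp add: norm_mult mult_right_mono)
  qed
qed

text \<open>Integrating the uniform Taylor remainder of the kernel against |g| leaves an error of
  order |h|^2.\<close>

lemma conv_has_derivative:
  assumes \<rho>: "\<rho> \<in> test_functions UNIV" and g: "integrable (lebesgue_on \<Omega>) g"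
  shows "(conv \<Omega> \<rho> g has_derivative (\<lambda>h. \<Sum>k\<in>UNIV. h $ k *\<^sub>R conv \<Omega> (partial k \<rho>) g x)) (at x)"
proof -
  obtain L where L: "0 \<le> L" "\<And>x h. norm (\<rho> (x + h) - \<rho> x - (\<Sum>k\<in>UNIV. h $ k *\<^sub>R partial k \<rho> x)) \<le> L * (norm h)\<^sup>2"
    using test_function_Taylor[OF \<rho>] by blast
  let ?I = "LINT y|lebesgue_on \<Omega>. norm (g y)"
  let ?D = "\<lambda>h. \<Sum>k\<in>UNIV. h $ k *\<^sub>R conv \<Omega> (partial k \<rho>) g x"
  have bl: "bounded_linear ?D"
    by (intro bounded_linear_sum bounded_linear_scaleR_left[THEN bounded_linear_compose] bounded_linear_vec_nth)
  have est: "norm (conv \<Omega> \<rho> g (x + h) - conv \<Omega> \<rho> g x - ?D h) \<le> L * (norm h)\<^sup>2 * ?I" for h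
  proof -
    note i = conv_integrable[OF \<rho> g] conv_integrable[OF test_functions_partial[OF \<rho>] g]
    have e: "(\<rho> (x + h - y) - \<rho> (x - y) - (\<Sum>k\<in>UNIV. h $ k *\<^sub>R partial k \<rho> (x - y))) * g y
        = \<rho> (x + h - y) * g y - \<rho> (x - y) * g y - (\<Sum>k\<in>UNIV. h $ k *\<^sub>R (partial k \<rho> (x - y) * g y))" for y
      by (simp add: left_diff_distrib sum_distrib_right)
    have "conv \<Omega> \<rho> g (x + h) - conv \<Omega> \<rho> g x - ?D h
      = (LINT y|lebesgue_on \<Omega>. \<rho> (x + h - y) * g y - \<rho> (x - y) * g y - (\<Sum>k\<in>UNIV. h $ k *\<^sub>R (partial k \<rho> (x - y) * g y)))"
      unfolding conv_def by (simp add: i)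
    also have "norm \<dots> \<le> (LINT y|lebesgue_on \<Omega>. L * (norm h)\<^sup>2 * norm (g y))"
    proof (rule order_trans[OF integral_norm_bound integral_mono])
      show "integrable (lebesgue_on \<Omega>) (\<lambda>y. norm (\<rho> (x + h - y) * g y - \<rho> (x - y) * g y - (\<Sum>k\<in>UNIV. h $ k *\<^sub>R (partial k \<rho> (x - y) * g y))))"
        by (intro integrable_norm) (simp add: i)
      show "integrable (lebesgue_on \<Omega>) (\<lambda>y. L * (norm h)\<^sup>2 * norm (g y))" using g by simp
      show "norm (\<rho> (x + h - y) * g y - \<rho> (x - y) * g y - (\<Sum>k\<in>UNIV. h $ k *\<^sub>R (partial k \<rho> (x - y) * g y))) \<le> L * (norm h)\<^sup>2 * norm (g y)" for y
        unfolding e[symmetric] norm_mult using L(2)[of "x - y" h] by (intro mult_right_mono) (auto simp: algebra_simps)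
    qed
    also have "\<dots> = L * (norm h)\<^sup>2 * ?I" using g by simp
    finally show ?thesis .
  qed
  have "((\<lambda>h. norm (conv \<Omega> \<rho> g (x + h) - conv \<Omega> \<rho> g x - ?D h) / norm h) \<longlongrightarrow> 0) (at 0)"
  proof (rule Lim_null_comparison)
    show "\<forall>\<^sub>F h in at 0. norm (norm (conv \<Omega> \<rho> g (x + h) - conv \<Omega> \<rho> g x - ?D h) / norm h) \<le> L * ?I * norm h"
    proof (rule eventually_at_filter[THEN iffD2, OF always_eventually], intro allI impI)
      fix h :: "real ^ 'a" assume "h \<noteq> 0"
      then show "norm (norm (conv \<Omega> \<rho> g (x + h) - conv \<Omega> \<rho> g x - ?D h) / norm h) \<le> L * ?I * norm h"
        using est[of h] by (simp add: divide_le_eq power2_eq_square mult_ac)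
    qed
    show "((\<lambda>h. L * ?I * norm h) \<longlongrightarrow> 0) (at (0 :: real ^ 'a))"
      by (intro tendsto_mult_right_zero tendsto_norm_zero tendsto_ident_at)
  qed
  with bl show ?thesis by (simp add: has_derivative_at)
qed

text \<open>Derivatives fall on the kernel, so the induction treats all kernels at once.\<close>

lemma smooth_conv:
  assumes \<rho>: "\<rho> \<in> test_functions UNIV" and g: "integrable (lebesgue_on \<Omega>) g"
  shows "smooth (conv \<Omega> \<rho> g)"
proof -
  have "C_k m (conv \<Omega> \<rho> g)" for m
    using \<rho>
  proof (induction m arbitrary: \<rho>)
    case 0
    then show ?case
      using has_derivative_continuous[OF conv_has_derivative[OF 0 g]] by (auto intro: continuous_at_imp_continuous_on)
  next
    case (Suc m)
    show ?case
    proof (rule C_k_SucI[OF conv_has_derivative[OF Suc.prems g]])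
      have "(\<Sum>j\<in>UNIV. axis k 1 $ j *\<^sub>R conv \<Omega> (partial j \<rho>) g x) = conv \<Omega> (partial k \<rho>) g x" for k x
        by (rule sum_axis_scaleR)
      then show "C_k m (\<lambda>x. \<Sum>j\<in>UNIV. axis k 1 $ j *\<^sub>R conv \<Omega> (partial j \<rho>) g x)" for k
        using Suc.IH[OF test_functions_partial[OF Suc.prems], of k] by simp
    qed
  qed
  then show ?thesis by (simp add: smooth_def)
qed

lemma partial_conv:
  assumes \<rho>: "\<rho> \<in> test_functions UNIV" and g: "integrable (lebesgue_on \<Omega>) g"
  shows "partial k (conv \<Omega> \<rho> g) x = conv \<Omega> (partial k \<rho>) g x"
  by (rule partial_eqI[THEN trans, OF conv_has_derivative[OF \<rho> g]])
    (rule sum_axis_scaleR)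

lemma exists_mollifier:
  assumes "0 < s"
  obtains \<rho> :: "real ^ 'n::finite \<Rightarrow> real"
  where "(\<lambda>x. complex_of_real (\<rho> x)) \<in> test_functions UNIV" "\<And>x. 0 \<le> \<rho> x" "\<And>x. s \<le> norm x \<Longrightarrow> \<rho> x = 0"
    "\<And>x. \<rho> (- x) = \<rho> x" "(\<integral>x. \<rho> x \<partial>lborel) = 1"
proof -
  \<comment> \<open>The Euclidean norm is at most the sum of the absolute coordinates, so the open
    box of half-width \<delta> lies in the open ball of radius \<open>s\<close>.\<close>
  define \<delta> where "\<delta> = s / (real CARD('n))"
  have \<delta>: "0 < \<delta>" using assms by (simp add: \<delta>_def)
  define a :: "real ^ 'n" where "a = (\<chi> i. \<delta>)"
  let ?b = "bump 1 (- a) a"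
  define c where "c = (\<integral>x. ?b x \<partial>lborel)"
  have test: "(\<lambda>x. complex_of_real (?b x)) \<in> test_functions UNIV" by (rule bump_test_function) auto
  have int: "integrable lborel ?b"
    using integrable_Re[OF test_function_integrable[OF test]] by simp
  have b0: "0 \<le> ?b x" for x by (rule bump_bounds) simp
  \<comment> \<open>The bump is positive on a nonempty open box, and such a box is not
    negligible.\<close>
  have "c \<noteq> 0"
  proof
    assume "c = 0"
    then have "AE x in lborel. ?b x = 0"
      unfolding c_def using integral_nonneg_eq_0_iff_AE[OF int] b0 by simp
    then have "AE x in lborel. x \<notin> box (- a) a" by eventually_elim (use bump_pos_iff[of 1 "-a" a] in blast)
    then have "box (- a) a \<in> null_sets lborel"
      by (subst (asm) AE_iff_null_sets[symmetric]) auto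
    then have "negligible (box (- a) a)" by (simp add: negligible_iff_null_sets null_sets_completionI)
    moreover have "0 \<in> box (- a) a" using \<delta> by (simp add: a_def mem_box_cart)
    ultimately show False using open_not_negligible[of "box (- a) a"] by auto
  qed
  moreover have "0 \<le> c" unfolding c_def using b0 by (simp add: integral_nonneg_AE)
  ultimately have c: "0 < c" by simp
  show thesis
  proof (rule that[of "\<lambda>x. ?b x / c"])
    show "(\<lambda>x. complex_of_real (?b x / c)) \<in> test_functions UNIV"
      using test_functions_cmult[OF test, of "1 / of_real c"] by simp
    show "0 \<le> ?b x / c" for x using b0 c by simp
    show "?b (- x) / c = ?b x / c" for x by (simp add: bump_def mult.commute add.commute)
    show "(\<integral>x. ?b x / c \<partial>lborel) = 1" using c int by (simp add: c_def)
    fix x :: "real ^ 'n" assume x: "s \<le> norm x"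
    have "?b x = 0"
    proof (rule ccontr)
      assume "?b x \<noteq> 0"
      then have xb: "x \<in> box (- a) a" using bump_pos_iff[of 1 "-a" a x] by blast
      have "norm x \<le> (\<Sum>i\<in>UNIV. \<bar>x $ i\<bar>)" by (rule norm_le_l1_cart)
      also have "\<dots> < (\<Sum>i\<in>(UNIV :: 'n set). \<delta>)"
        using xb by (intro sum_strict_mono) (auto simp: mem_box_cart a_def abs_less_iff minus_less_iff)
      also have "\<dots> = s" by (simp add: \<delta>_def)
      finally show False using x by simp
    qed
    then show "?b x / c = 0" by simp
  qed
qed

text \<open>Evenness makes the kernel \<rho>(x - y) symmetric in \<open>x\<close> and
  \<open>y\<close>, so that its integral over either variable is 1.\<close>

locale mollifier =
  fixes \<rho> :: "real ^ 'n::finite \<Rightarrow> real"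
  assumes test: "(\<lambda>x. complex_of_real (\<rho> x)) \<in> test_functions UNIV"
    and nonneg: "\<And>x. 0 \<le> \<rho> x" and even: "\<And>x. \<rho> (- x) = \<rho> x"
    and integral_1: "(\<integral>x. \<rho> x \<partial>lborel) = 1"
begin

abbreviation "c\<rho> \<equiv> (\<lambda>x. complex_of_real (\<rho> x))"

lemma borel [measurable]: "\<rho> \<in> borel_measurable borel"
proof -
  have "continuous_on UNIV (\<lambda>x. Re (c\<rho> x))"
    by (intro continuous_on_Re smooth_continuous test_functionsD(1)[OF test])
  then show ?thesis by (simp add: borel_measurable_continuous_onI)
qed

lemma commute: "\<rho> (x - y) = \<rho> (y - x)"
  using even[of "x - y"] by simp

lemma integrable: "integrable lborel (\<lambda>y. \<rho> (x - y))" and integral: "(\<integral>y. \<rho> (x - y) \<partial>lborel) = 1"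
proof -
  have t: "(\<lambda>y. c\<rho> (x - y)) \<in> test_functions UNIV"
  proof -
    obtain K where K: "compact K" "\<forall>x. x \<notin> K \<longrightarrow> c\<rho> x = 0" using test unfolding test_functions_iff by blast
    have "compact ((\<lambda>z. x - z) ` K)" by (intro compact_continuous_image continuous_intros K)
    moreover have "c\<rho> (x - y) = 0" if "y \<notin> (\<lambda>z. x - z) ` K" for y
      using K(2) that by (metis image_eqI diff_diff_eq2 add_diff_cancel_left')
    ultimately show ?thesis
      unfolding test_functions_iff using smooth_reflect[OF test_functionsD(1)[OF test], of x] by blast
  qed
  show "integrable lborel (\<lambda>y. \<rho> (x - y))"
    using integrable_Re[OF test_function_integrable[OF t]] by simp
  have "(\<integral>y. \<rho> (x - y) \<partial>lborel) = (\<integral>y. \<rho> (y + (- x)) \<partial>lborel)" by (simp add: commute[of x])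
  also have "\<dots> = 1" using integral_translate_lborel[of \<rho> "- x"] integral_1 borel by simp
  finally show "(\<integral>y. \<rho> (x - y) \<partial>lborel) = 1" .
qed

lemma integrable_lebesgue: "integrable lebesgue (\<lambda>y. \<rho> (x - y))"
  and integral_lebesgue: "(\<integral>y. \<rho> (x - y) \<partial>lebesgue) = 1"
  using integrable[of x] integral[of x] by (simp_all add: integrable_completion integral_completion)

text \<open>Jensen's inequality by way of Cauchy-Schwarz: the kernel is split as sqrt \<rho> times
  sqrt \<rho>, and its mass on \<Omega> is at most 1.\<close>

lemma norm_conv_squared_le:
  assumes \<Omega>: "open \<Omega>" and G: "G \<in> L2 \<Omega>"
  shows "ennreal ((norm (conv \<Omega> c\<rho> G x))\<^sup>2) \<le> (\<integral>\<^sup>+y. ennreal (\<rho> (x - y)) * ennreal ((norm (G y))\<^sup>2) \<partial>lebesgue_on \<Omega>)"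
proof -
  have \<Omega>m: "\<Omega> \<in> sets lebesgue" using \<Omega> by auto
  obtain B where B: "0 \<le> B" "\<And>x. norm (c\<rho> x) \<le> B" using test_function_bounded[OF test] by blast
  let ?s = "\<lambda>y. complex_of_real (sqrt (\<rho> (x - y)))"
  have m: "?s \<in> borel_measurable (lebesgue_on \<Omega>)"
    by (intro measurable_restrict_space1 measurable_completion) measurable
  have i: "integrable (lebesgue_on \<Omega>) (\<lambda>y. \<rho> (x - y))"
    using lebesgue_on_subset(1)[of \<Omega> UNIV "\<lambda>y. \<rho> (x - y)"] integrable_lebesgue[of x] \<Omega>m by (simp add: lebesgue_on_UNIV_eq)
  have s2: "?s \<in> L2 \<Omega>" using m i nonneg by (simp add: L2_def)
  have "nsq \<Omega> ?s = (LINT y|lebesgue_on \<Omega>. \<rho> (x - y))" using nonneg by (simp add: nsq_def)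
  also have "\<dots> \<le> (LINT y|lebesgue_on UNIV. \<rho> (x - y))"
    by (rule integral_mono_lebesgue_on_AE)
      (use i integrable_lebesgue[of x] \<Omega>m nonneg in \<open>auto simp: lebesgue_on_UNIV_eq\<close>)
  finally have s1: "nsq \<Omega> ?s \<le> 1" by (simp add: lebesgue_on_UNIV_eq integral_lebesgue)
  have sG: "(\<lambda>y. ?s y * G y) \<in> L2 \<Omega>"
  proof (rule L2_bounded_mult[OF G m])
    show "norm (?s y) \<le> sqrt B" for y using B(2)[of "x - y"] nonneg by (simp add: real_sqrt_le_mono)
  qed
  have "conv \<Omega> c\<rho> G x = (LINT y|lebesgue_on \<Omega>. ?s y * (?s y * G y))"
    unfolding conv_def using nonneg by (simp flip: of_real_mult mult.assoc)
  then have "(norm (conv \<Omega> c\<rho> G x))\<^sup>2 \<le> nsq \<Omega> ?s * nsq \<Omega> (\<lambda>y. ?s y * G y)"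
    using L2_Cauchy_Schwarz[OF s2 sG] by simp
  also have "\<dots> \<le> nsq \<Omega> (\<lambda>y. ?s y * G y)"
    by (rule mult_left_le_one_le[OF nsq_nonneg nsq_nonneg s1])
  finally have "ennreal ((norm (conv \<Omega> c\<rho> G x))\<^sup>2) \<le> (\<integral>\<^sup>+y. ennreal ((norm (?s y * G y))\<^sup>2) \<partial>lebesgue_on \<Omega>)"
    using nn_integral_nsq[OF sG] by (simp add: ennreal_leI)
  also have "\<dots> = (\<integral>\<^sup>+y. ennreal (\<rho> (x - y)) * ennreal ((norm (G y))\<^sup>2) \<partial>lebesgue_on \<Omega>)"
    using nonneg by (simp add: norm_mult power_mult_distrib ennreal_mult)
  finally show ?thesis .
qed

text \<open>Young's convolution inequality for a kernel of mass 1: the pointwise bound is integrated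
  in \<open>x\<close> and the integrals are exchanged.\<close>

lemma conv_L2:
  assumes \<Omega>: "open \<Omega>" "bounded \<Omega>" and V: "V \<in> sets lebesgue" and G: "G \<in> L2 \<Omega>"
  shows "conv \<Omega> c\<rho> G \<in> L2 V" "nsq V (conv \<Omega> c\<rho> G) \<le> nsq \<Omega> G"
proof -
  have \<Omega>m: "\<Omega> \<in> sets lebesgue" "\<Omega> \<in> lmeasurable" using \<Omega> by (auto simp: bounded_set_imp_lmeasurable)
  let ?h = "\<lambda>y. ennreal ((norm (G y))\<^sup>2) * indicator \<Omega> y"
  have "?h = (\<lambda>y. ennreal ((norm (if y \<in> \<Omega> then G y else 0))\<^sup>2))" by (auto simp: indicator_def)
  moreover have "(\<lambda>y. if y \<in> \<Omega> then G y else 0) \<in> borel_measurable lebesgue"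
    using L2_measurable[OF G] \<Omega>m by (simp add: borel_measurable_if)
  ultimately have "?h \<in> borel_measurable lebesgue" by simp
  \<comment> \<open>The exchange of integrals takes place in \<open>lborel\<close>, so the Lebesgue
    measurable density is replaced by a Borel version.\<close>
  from completion_ex_borel_measurable[OF this]
  obtain h where h[measurable]: "h \<in> borel_measurable lborel" and ae: "AE y in lborel. ?h y = h y" by blast
  have hG: "(\<integral>\<^sup>+y. h y \<partial>lborel) = ennreal (nsq \<Omega> G)"
  proof -
    have "(\<integral>\<^sup>+y. h y \<partial>lborel) = (\<integral>\<^sup>+y. ?h y \<partial>lebesgue)"
      unfolding nn_integral_completion using ae by (intro nn_integral_cong_AE) auto
    also have "\<dots> = (\<integral>\<^sup>+y. ennreal ((norm (G y))\<^sup>2) \<partial>lebesgue_on \<Omega>)"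
      using \<Omega>m by (simp add: nn_integral_restrict_space)
    finally show ?thesis using nn_integral_nsq[OF G] by simp
  qed
  have le: "ennreal ((norm (conv \<Omega> c\<rho> G x))\<^sup>2) \<le> (\<integral>\<^sup>+y. ennreal (\<rho> (x - y)) * h y \<partial>lborel)" for x
  proof -
    have "(\<integral>\<^sup>+y. ennreal (\<rho> (x - y)) * ennreal ((norm (G y))\<^sup>2) \<partial>lebesgue_on \<Omega>)
        = (\<integral>\<^sup>+y. ennreal (\<rho> (x - y)) * ?h y \<partial>lebesgue)"
      using \<Omega>m by (simp add: nn_integral_restrict_space mult.assoc)
    also have "\<dots> = (\<integral>\<^sup>+y. ennreal (\<rho> (x - y)) * h y \<partial>lborel)"
      unfolding nn_integral_completion
    proof (rule nn_integral_cong_AE)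
      show "AE y in lborel. ennreal (\<rho> (x - y)) * ?h y = ennreal (\<rho> (x - y)) * h y"
        using ae by eventually_elim simp
    qed
    finally show ?thesis using norm_conv_squared_le[OF \<Omega>(1) G, of x] by simp
  qed
  have [measurable]: "conv \<Omega> c\<rho> G \<in> borel_measurable (lebesgue_on V)"
    by (intro smooth_measurable smooth_conv test L2_imp_integrable[OF G \<Omega>m(2)])
  have cm: "case_prod (\<lambda>x y. ennreal (\<rho> (x - y)) * h y) \<in> borel_measurable (lborel \<Otimes>\<^sub>M lborel)"
    by measurable
  have "(\<integral>\<^sup>+x. ennreal ((norm (conv \<Omega> c\<rho> G x))\<^sup>2) \<partial>lebesgue_on V) \<le> (\<integral>\<^sup>+x. ennreal ((norm (conv \<Omega> c\<rho> G x))\<^sup>2) \<partial>lebesgue)"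
    using V by (subst nn_integral_restrict_space) (auto intro!: nn_integral_mono simp: indicator_def)
  also have "\<dots> \<le> (\<integral>\<^sup>+x. (\<integral>\<^sup>+y. ennreal (\<rho> (x - y)) * h y \<partial>lborel) \<partial>lborel)"
    unfolding nn_integral_completion by (intro nn_integral_mono le)
  also have "\<dots> = (\<integral>\<^sup>+y. (\<integral>\<^sup>+x. ennreal (\<rho> (x - y)) * h y \<partial>lborel) \<partial>lborel)"
    by (rule lborel_pair.Fubini'[OF cm, symmetric])
  also have "\<dots> = (\<integral>\<^sup>+y. h y \<partial>lborel)"
  proof (rule nn_integral_cong)
    fix y
    have "(\<integral>\<^sup>+x. ennreal (\<rho> (x - y)) * h y \<partial>lborel) = (\<integral>\<^sup>+x. ennreal (\<rho> (y - x)) \<partial>lborel) * h y"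
      by (subst nn_integral_multc) (auto simp: commute[of y])
    also have "(\<integral>\<^sup>+x. ennreal (\<rho> (y - x)) \<partial>lborel) = 1"
      using integrable[of y] integral[of y] nonneg by (subst nn_integral_eq_integral) auto
    finally show "(\<integral>\<^sup>+x. ennreal (\<rho> (x - y)) * h y \<partial>lborel) = h y" by simp
  qed
  finally have fin: "(\<integral>\<^sup>+x. ennreal ((norm (conv \<Omega> c\<rho> G x))\<^sup>2) \<partial>lebesgue_on V) \<le> ennreal (nsq \<Omega> G)"
    by (simp add: hG)
  then have "(\<integral>\<^sup>+x. ennreal (norm ((norm (conv \<Omega> c\<rho> G x))\<^sup>2)) \<partial>lebesgue_on V) < \<infinity>"
    using order.strict_trans1[OF fin ennreal_less_top] by simp
  then show L2: "conv \<Omega> c\<rho> G \<in> L2 V" by (simp add: L2_def integrable_iff_bounded)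
  show "nsq V (conv \<Omega> c\<rho> G) \<le> nsq \<Omega> G"
    using fin nn_integral_nsq[OF L2] by (simp add: nsq_nonneg)
qed

end

text \<open>Mollification approximates \<open>g\<close> itself, by uniform continuity, while for the
  gradient only a norm bound is extracted. The minimizing argument, run over the midpoint-closed set
  of smooth functions bounded by \<epsilon>, upgrades the bound to convergence of gradients and
  preserves the supremum bound.\<close>

lemma smooth_approximation:
  fixes \<Omega> :: "(real ^ 'n::finite) set"
  assumes \<Omega>: "open \<Omega>" "bounded \<Omega>"
    and g: "g \<in> L2 \<Omega>" "\<And>k. has_weak_partial \<Omega> k g (G k)" "\<And>k. G k \<in> L2 \<Omega>"
    and cont: "continuous_on \<Omega> g" and bd: "\<And>x. x \<in> \<Omega> \<Longrightarrow> norm (g x) \<le> \<epsilon>" and \<epsilon>: "0 \<le> \<epsilon>"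
    and K: "compact K" "K \<subseteq> \<Omega>" and \<eta>: "0 < \<eta>"
  obtains e where "smooth e" "\<And>x. norm (e x) \<le> \<epsilon>" "nsq K (\<lambda>x. g x - e x) < \<eta>"
    "\<And>k. nsq K (\<lambda>x. G k x - partial k e x) < \<eta>"
proof -
  have \<Omega>m: "\<Omega> \<in> sets lebesgue" "\<Omega> \<in> lmeasurable" using \<Omega> by (auto simp: bounded_set_imp_lmeasurable)
  have gi: "integrable (lebesgue_on \<Omega>) g" by (rule L2_imp_integrable[OF g(1) \<Omega>m(2)])
  obtain r where r: "0 < r" "(\<Union>x\<in>K. cball x r) \<subseteq> \<Omega>"
    using compact_subset_open_imp_cball_epsilon_subset[OF K(1) \<Omega>(1) K(2)] by blast
  \<comment> \<open>\<open>W\<close> is the closed neighbourhood of \<open>K\<close> of radius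
    \<open>r\<close>, \<open>V\<close> the open one of radius r/2. Points within r/2 of
    \<open>V\<close> stay in \<open>W\<close>, so a small kernel centred in \<open>V\<close> is
    supported inside \<Omega>.\<close>
  define W where "W = {x + y |x y. x \<in> K \<and> y \<in> cball 0 r}"
  have W: "compact W" unfolding W_def by (intro compact_sums K compact_cball)
  have mW: "y \<in> W" if "x \<in> K" "dist x y \<le> r" for x y
  proof -
    have "y = x + (y - x)" "y - x \<in> cball 0 r" using that(2) by (auto simp: dist_norm norm_minus_commute)
    then show ?thesis unfolding W_def using that(1) by blast
  qed
  have W\<Omega>: "W \<subseteq> \<Omega>" using r(2) unfolding W_def by (fastforce simp: dist_norm subset_iff)
  define V where "V = (\<Union>x\<in>K. ball x (r/2))"
  have V: "open V" "K \<subseteq> V" "V \<subseteq> W"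
  proof -
    show "open V" "K \<subseteq> V" using r(1) unfolding V_def by auto
    show "V \<subseteq> W"
    proof
      fix y assume "y \<in> V"
      then obtain x where "x \<in> K" "dist x y < r/2" unfolding V_def by auto
      then show "y \<in> W" using mW[of x y] r(1) by simp
    qed
  qed
  have near: "y \<in> W" if xV: "x \<in> V" and d: "dist x y \<le> r/2" for x y
  proof -
    obtain z where "z \<in> K" "dist z x < r/2" using xV by (auto simp: V_def)
    then show ?thesis using mW[of z y] d dist_triangle[of z y x] by (simp add: dist_commute)
  qed
  have Vm: "V \<in> sets lebesgue" "bounded V" using V W bounded_subset[OF compact_imp_bounded] by auto
  have V\<Omega>: "V \<subseteq> \<Omega>" using V W\<Omega> by blast
  have gV: "g \<in> L2 V" by (rule L2_subset[OF V\<Omega> Vm(1) \<Omega>m(1) g(1)])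
  have GV: "G k \<in> L2 V" for k by (rule L2_subset[OF V\<Omega> Vm(1) \<Omega>m(1) g(3)])
  define C :: "(real ^ 'n \<Rightarrow> complex) set" where "C = {p. smooth p \<and> (\<forall>x. norm (p x) \<le> \<epsilon>)}"
  have approx: "\<exists>p\<in>C. nsq V (\<lambda>x. p x - g x) < e \<and> (\<Sum>k\<in>UNIV. nsq V (partial k p)) \<le> (\<Sum>k\<in>UNIV. nsq \<Omega> (G k))" if e: "0 < e" for e
  proof -
    \<comment> \<open>Makes \<tau>^2 times the measure of \<open>V\<close> at most e/4; the summand
      1 guards against measure zero.\<close>
    define \<tau> where "\<tau> = sqrt (e / (measure lebesgue V + 1)) / 2"
    have \<tau>: "0 < \<tau>" using e by (simp add: \<tau>_def add_nonneg_pos)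
    have "uniformly_continuous_on W g"
      by (rule compact_uniformly_continuous[OF continuous_on_subset[OF cont W\<Omega>] W])
    then obtain s where s: "0 < s" "\<And>x y. x \<in> W \<Longrightarrow> y \<in> W \<Longrightarrow> dist y x < s \<Longrightarrow> dist (g y) (g x) < \<tau>"
      unfolding uniformly_continuous_on_def using \<tau> by meson
    obtain \<rho> :: "real ^ 'n \<Rightarrow> real" where \<rho>: "(\<lambda>x. complex_of_real (\<rho> x)) \<in> test_functions UNIV" "\<And>x. 0 \<le> \<rho> x"
        "\<And>x. min s (r/2) \<le> norm x \<Longrightarrow> \<rho> x = 0" "\<And>x. \<rho> (- x) = \<rho> x" "(\<integral>x. \<rho> x \<partial>lborel) = 1"
      using exists_mollifier[of "min s (r/2)"] s(1) r(1) by auto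
    interpret mollifier \<rho> by unfold_locales (use \<rho> in auto)
    have supp: "\<rho> (x - y) = 0" if "x \<in> V" "y \<notin> W" for x y
    proof (rule \<rho>(3))
      have "\<not> dist x y \<le> r/2" using near[OF that(1), of y] that(2) by blast
      then show "min s (r/2) \<le> norm (x - y)" by (simp add: dist_norm)
    qed
    have int1: "(LINT y|lebesgue_on \<Omega>. c\<rho> (x - y)) = 1" "integrable (lebesgue_on \<Omega>) (\<lambda>y. c\<rho> (x - y))" if "x \<in> V" for x
    proof -
      have "c\<rho> (x - y) = 0" if "y \<notin> \<Omega>" for y using supp[OF \<open>x \<in> V\<close>] that W\<Omega> by auto
      from integral_lebesgue_on_support[OF \<Omega>m(1) this]
      show "(LINT y|lebesgue_on \<Omega>. c\<rho> (x - y)) = 1" "integrable (lebesgue_on \<Omega>) (\<lambda>y. c\<rho> (x - y))"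
        using integral_lebesgue[of x] integrable_lebesgue[of x] by auto
    qed
    let ?p = "conv \<Omega> c\<rho> g"
    have sm: "smooth ?p" by (rule smooth_conv[OF \<rho>(1) gi])
    have pb: "norm (?p x) \<le> \<epsilon>" for x
    proof -
      have "norm (?p x) \<le> (LINT y|lebesgue_on \<Omega>. norm (c\<rho> (x - y) * g y))"
        unfolding conv_def by (rule integral_norm_bound)
      \<comment> \<open>For x outside \<open>V\<close> part of the kernel mass may lie off \<Omega>;
        the integral over the whole space covers every \<open>x\<close>.\<close>
      also have "\<dots> \<le> (LINT y|lebesgue_on UNIV. \<rho> (x - y) * \<epsilon>)"
      proof (rule integral_mono_lebesgue_on_AE)
        show "AE y in lebesgue_on \<Omega>. norm (c\<rho> (x - y) * g y) \<le> \<rho> (x - y) * \<epsilon>"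
          using bd \<rho>(2) by (intro AE_I2) (auto simp: norm_mult intro!: mult_left_mono)
      qed (use integrable_lebesgue[of x] \<Omega>m \<rho>(2) \<epsilon> in \<open>auto simp: lebesgue_on_UNIV_eq\<close>)
      also have "\<dots> = \<epsilon>" using integral_lebesgue[of x] by (simp add: lebesgue_on_UNIV_eq)
      finally show ?thesis .
    qed
    have close: "norm (?p x - g x) \<le> \<tau>" if x: "x \<in> V" for x
    proof -
      have "?p x - g x = (LINT y|lebesgue_on \<Omega>. c\<rho> (x - y) * g y) - (LINT y|lebesgue_on \<Omega>. c\<rho> (x - y) * g x)"
        using int1[OF x] by (simp add: conv_def)
      also have "\<dots> = (LINT y|lebesgue_on \<Omega>. c\<rho> (x - y) * (g y - g x))"
        using conv_integrable[OF \<rho>(1) gi, of x] int1[OF x] by (simp add: right_diff_distrib)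
      finally have "norm (?p x - g x) \<le> (LINT y|lebesgue_on \<Omega>. norm (c\<rho> (x - y) * (g y - g x)))"
        using integral_norm_bound by simp
      also have "\<dots> \<le> (LINT y|lebesgue_on UNIV. \<rho> (x - y) * \<tau>)"
      proof (rule integral_mono_lebesgue_on_AE)
        have "norm (c\<rho> (x - y) * (g y - g x)) \<le> \<rho> (x - y) * \<tau>" for y
        proof (cases "min s (r/2) \<le> norm (x - y)")
          case False
          then have "y \<in> W" "x \<in> W" "dist y x < s"
            using near[OF x, of y] near[OF x, of x] r(1) by (auto simp: dist_norm norm_minus_commute)
          then have "norm (g y - g x) \<le> \<tau>" using s(2)[of x y] by (simp add: dist_norm)
          then show ?thesis using \<rho>(2) by (simp add: norm_mult mult_left_mono)
        qed (use \<rho>(3) in auto)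
        then show "AE y in lebesgue_on \<Omega>. norm (c\<rho> (x - y) * (g y - g x)) \<le> \<rho> (x - y) * \<tau>" by simp
      qed (use integrable_lebesgue[of x] \<Omega>m \<rho>(2) \<tau> in \<open>auto simp: lebesgue_on_UNIV_eq\<close>)
      also have "\<dots> = \<tau>" using integral_lebesgue[of x] by (simp add: lebesgue_on_UNIV_eq)
      finally show ?thesis .
    qed
    have "nsq V (\<lambda>x. ?p x - g x) < e"
    proof -
      have Vl: "V \<in> lmeasurable" using Vm by (simp add: bounded_set_imp_lmeasurable)
      have "nsq V (\<lambda>x. ?p x - g x) \<le> \<tau>\<^sup>2 * measure lebesgue V"
        by (rule nsq_le_const[OF L2_diff[OF smooth_L2[OF sm Vm(2,1)] gV] Vl close])
      also have "\<dots> = e / 4 * (measure lebesgue V / (measure lebesgue V + 1))"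
        using e by (simp add: \<tau>_def power_divide)
      also have "\<dots> < e * 1"
        using e by (intro mult_strict_mono) (auto simp: divide_less_eq_1 add_nonneg_pos)
      finally show ?thesis by simp
    qed
    moreover have "nsq V (partial k ?p) \<le> nsq \<Omega> (G k)" for k
    proof -
      \<comment> \<open>For x in \<open>V\<close> the reflected kernel is a test function of
        \<Omega>, so the weak derivative of \<open>g\<close> takes over the derivative of the
        kernel; the sign from the reflection cancels that in the definition.\<close>
      have "partial k ?p x = conv \<Omega> c\<rho> (G k) x" if x: "x \<in> V" for x
      proof -
        let ?v = "\<lambda>y. c\<rho> (x - y)"
        have v: "?v \<in> test_functions \<Omega>"
          unfolding test_functions_iff using smooth_reflect[OF test_functionsD(1)[OF \<rho>(1)], of x] supp[OF x] W W\<Omega>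
          by (auto intro!: exI[of _ W])
        have "partial k ?p x = (LINT y|lebesgue_on \<Omega>. partial k c\<rho> (x - y) * g y)"
          using partial_conv[OF \<rho>(1) gi] by (simp add: conv_def)
        also have "\<dots> = - (LINT y|lebesgue_on \<Omega>. g y * partial k ?v y)"
          by (simp add: partial_reflect[OF test_functionsD(1)[OF \<rho>(1)]] mult.commute)
        also have "\<dots> = (LINT y|lebesgue_on \<Omega>. G k y * ?v y)"
          using g(2)[of k] v by (simp add: has_weak_partial_def)
        finally show ?thesis by (simp add: conv_def mult.commute)
      qed
      then have "nsq V (partial k ?p) = nsq V (conv \<Omega> c\<rho> (G k))"
        unfolding nsq_def by (intro Bochner_Integration.integral_cong) auto
      then show ?thesis using conv_L2(2)[OF \<Omega> Vm(1) g(3)] by simp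
    qed
    ultimately show ?thesis
      using sm pb by (intro bexI[of _ ?p]) (auto simp: C_def intro: sum_mono)
  qed
  have Cs: "smooth p" if "p \<in> C" for p using that by (simp add: C_def)
  have mid: "(\<lambda>x. (1/2) * (p x + q x)) \<in> C" if "p \<in> C" "q \<in> C" for p q
  proof -
    have "norm ((1/2) * (p x + q x)) \<le> \<epsilon>" for x
    proof -
      have "norm ((1/2) * (p x + q x)) = norm (p x + q x) / 2" by (simp add: norm_mult norm_divide)
      then show ?thesis using norm_triangle_ineq[of "p x" "q x"] that by (auto simp: C_def intro: order_trans) (smt (verit))
    qed
    moreover have "smooth (\<lambda>x. (1/2) * (p x + q x))"
      using that by (intro smooth_intros(4)[OF smooth_intros(1) smooth_intros(2)]) (auto simp: C_def)
    ultimately show ?thesis unfolding C_def by blast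
  qed
  obtain H p where H: "\<And>k. H k \<in> L2 V" "\<And>k. has_weak_partial V k g (H k)" and p: "\<And>i. p i \<in> C"
    and p1: "(\<lambda>i. nsq V (\<lambda>x. p i x - g x)) \<longlonglongrightarrow> 0" and p2: "\<And>k. (\<lambda>i. nsq V (\<lambda>x. partial k (p i) x - H k x)) \<longlonglongrightarrow> 0"
    using weak_gradient_of_bounded_approximation[OF V(1) gV Cs smooth_L2[OF Cs Vm(2,1)]
        smooth_L2[OF smooth_partial[OF Cs] Vm(2,1)] mid approx] by blast
  \<comment> \<open>The gradient \<open>H\<close> produced by minimization agrees almost everywhere
    on \<open>V\<close> with the given \<open>G\<close>.\<close>
  have HG: "nsq V (\<lambda>x. partial k q x - H k x) = nsq V (\<lambda>x. partial k q x - G k x)" if "smooth q" for k q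
  proof -
    have "AE x in lebesgue_on V. H k x = G k x"
      by (rule has_weak_partial_unique[OF V(1) H(2) has_weak_partial_subset[OF \<Omega>(1) V(1) V\<Omega> g(2)]])
    then have "AE x in lebesgue_on V. (norm (partial k q x - H k x))\<^sup>2 = (norm (partial k q x - G k x))\<^sup>2"
      by eventually_elim simp
    then show ?thesis unfolding nsq_def
      by (intro integral_cong_AE borel_measurable_integrable[OF L2_integrable] L2_diff H GV
          smooth_L2[OF smooth_partial[OF that] Vm(2,1)])
  qed
  have "\<forall>\<^sub>F i in sequentially. nsq V (\<lambda>x. p i x - g x) < \<eta> \<and> (\<forall>k\<in>UNIV. nsq V (\<lambda>x. partial k (p i) x - H k x) < \<eta>)"
    using order_tendstoD(2)[OF p1 \<eta>] order_tendstoD(2)[OF p2 \<eta>]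
    by (intro eventually_conj) (auto intro!: eventually_all_finite simp: eventually_ball_finite_distrib)
  then obtain i where i: "nsq V (\<lambda>x. p i x - g x) < \<eta>" "\<And>k. nsq V (\<lambda>x. partial k (p i) x - H k x) < \<eta>"
    unfolding eventually_sequentially by auto
  note sp = Cs[OF p[of i]]
  have Km: "K \<in> sets lebesgue" using K by (simp add: borel_compact)
  show thesis
  proof (rule that[of "p i"])
    show "smooth (p i)" by (rule sp)
    show "norm (p i x) \<le> \<epsilon>" for x using p[of i] by (simp add: C_def)
    show "nsq K (\<lambda>x. g x - p i x) < \<eta>"
      using nsq_subset[OF V(2) Km Vm(1) L2_diff[OF gV smooth_L2[OF sp Vm(2,1)]]] i(1)
      by (simp add: nsq_minus_commute[of V g])
    show "nsq K (\<lambda>x. G k x - partial k (p i) x) < \<eta>" for k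
      using nsq_subset[OF V(2) Km Vm(1) L2_diff[OF GV smooth_L2[OF smooth_partial[OF sp] Vm(2,1)]], of k k] i(2)[of k]
      by (simp add: nsq_minus_commute[of V "G k"] HG[OF sp])
  qed
qed

section \<open>The energy estimate\<close>

lemma real_polynomial_smooth: "real_polynomial_function f \<Longrightarrow> smooth (\<lambda>x. complex_of_real (f x))"
proof (induction f rule: real_polynomial_function.induct)
  case (linear f)
  then show ?case by (rule smooth_of_linear)
next
  case (const c)
  show ?case by (rule smooth_intros(1))
next
  case (add f g)
  then show ?case using smooth_intros(2) by fastforce
next
  case (mult f g)
  then show ?case using smooth_intros(4) by fastforce
qed

lemma smooth_uniform_approximation:
  fixes \<phi> :: "real ^ 'n::finite \<Rightarrow> complex"
  assumes "compact S" "continuous_on S \<phi>" "0 < \<epsilon>"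
  obtains \<Phi> where "smooth \<Phi>" "\<And>x. x \<in> S \<Longrightarrow> norm (\<Phi> x - \<phi> x) < \<epsilon>"
proof -
  obtain p where p: "polynomial_function p" "\<And>x. x \<in> S \<Longrightarrow> norm (\<phi> x - p x) < \<epsilon>"
    using Stone_Weierstrass_polynomial_function[OF assms] by blast
  have "real_polynomial_function (\<lambda>x. Re (p x))" "real_polynomial_function (\<lambda>x. Im (p x))"
    using p(1) bounded_linear_Re bounded_linear_Im unfolding polynomial_function_def o_def by auto
  then have "smooth (\<lambda>x. complex_of_real (Re (p x)) + \<i> * complex_of_real (Im (p x)))"
    by (intro smooth_intros(1,2,4) real_polynomial_smooth)
  then have "smooth p" by (simp flip: complex_eq)
  with that p(2) show thesis by (metis norm_minus_commute)
qed

text \<open>\<theta> is the derivative of \<open>flat 1 \<kappa>\<close>. With x = \<kappa>/t the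
  less obvious bounds come from 1 + x \<le> e^x and 1 - x \<le> e^-x. The last claim, that the
  truncation is at most its derivative times the positive part, is what makes first-order terms
  absorbable.\<close>

lemma flat_1_bounds:
  assumes "0 < \<kappa>"
  defines "\<theta> \<equiv> \<lambda>t. flat 0 \<kappa> t + \<kappa> * flat (- 1) \<kappa> t"
  shows "0 \<le> \<theta> t" "\<theta> t \<le> 1" "0 \<le> flat 1 \<kappa> t" "flat 1 \<kappa> t \<le> max 0 t" "max 0 t - flat 1 \<kappa> t \<le> \<kappa>"
    "flat 1 \<kappa> t \<le> \<theta> t * max 0 t"
proof -
  consider "t \<le> 0" | "0 < t" by linarith
  then have "0 \<le> \<theta> t \<and> \<theta> t \<le> 1 \<and> 0 \<le> flat 1 \<kappa> t \<and> flat 1 \<kappa> t \<le> max 0 t \<and> max 0 t - flat 1 \<kappa> t \<le> \<kappa> \<and>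
    flat 1 \<kappa> t \<le> \<theta> t * max 0 t"
  proof cases
    case 1
    then show ?thesis using assms(1) by (simp add: \<theta>_def flat_def)
  next
    case 2
    define x where "x = \<kappa> / t"
    define E where "E = exp (- x)"
    have x: "0 < x" using assms 2 by (simp add: x_def)
    have f1: "flat 1 \<kappa> t = t * E" using 2 by (simp add: flat_def E_def x_def)
    have \<theta>t: "\<theta> t = E * (1 + x)"
      using 2 by (simp add: \<theta>_def flat_def E_def x_def power_int_minus field_simps)
    have E: "0 < E" "E \<le> 1" using x by (auto simp: E_def)
    have "E * (1 + x) \<le> E * exp x" using exp_ge_add_one_self[of x] E by (intro mult_left_mono) auto
    then have "E * (1 + x) \<le> 1" by (simp add: E_def flip: exp_add)
    moreover have "t * (1 - E) \<le> t * x"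
      using exp_ge_add_one_self[of "- x"] 2 by (intro mult_left_mono) (auto simp: E_def)
    then have "t - t * E \<le> \<kappa>" using 2 by (simp add: right_diff_distrib x_def)
    moreover have "t * E \<le> t" using 2 E by (simp add: mult_left_le)
    moreover have "t * E \<le> E * (1 + x) * t" using 2 E x by (simp add: algebra_simps)
    ultimately show ?thesis unfolding f1 \<theta>t using 2 E x by (auto simp: max_def)
  qed
  then show "0 \<le> \<theta> t" "\<theta> t \<le> 1" "0 \<le> flat 1 \<kappa> t" "flat 1 \<kappa> t \<le> max 0 t" "max 0 t - flat 1 \<kappa> t \<le> \<kappa>"
    "flat 1 \<kappa> t \<le> \<theta> t * max 0 t" by auto
qed

text \<open>The roles at a fixed point of \<Omega>: \<sigma> is the real part of the gradient of
  \<open>f\<close>, \<sigma> + \<rho> that of the solution \<open>u\<close>, \<open>q\<close> the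
  truncation with gradient \<theta> \<sigma>, \<open>p\<close> the modulus of \<open>f\<close> and
  \<open>m\<close> that of \<open>u\<close>; \<open>A\<close> and \<gamma> are the real coefficients
  \<open>a\<close> and \<open>c\<close>, while \<beta> and \<delta> are the real parts of
  \<open>b\<close> and \<open>c\<^sub>0\<close> times \<open>u\<close>. Since \<theta>^2 \<le>
  \<theta>, the principal term dominates \<mu> |\<theta> \<sigma>|^2. The others are either linear
  in \<theta> \<sigma> and absorbed, or already bounded by a multiple of R^2.\<close>

lemma pointwise_coercivity:
  fixes A :: "'n::finite \<Rightarrow> 'n \<Rightarrow> real" and \<sigma> \<rho> \<beta> \<gamma> :: "'n \<Rightarrow> real"
  assumes \<mu>: "0 < \<mu>" and B: "0 \<le> B"
    and ell: "\<mu> * (\<Sum>k\<in>UNIV. (\<sigma> k)\<^sup>2) \<le> (\<Sum>k\<in>UNIV. \<Sum>l\<in>UNIV. A k l * \<sigma> l * \<sigma> k)"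
    and bd: "\<And>k l. \<bar>A k l\<bar> \<le> B" "\<And>k. \<bar>\<beta> k\<bar> \<le> B * m" "\<And>k. \<bar>\<gamma> k\<bar> \<le> B" "\<bar>\<delta>\<bar> \<le> B * m"
    and m: "0 \<le> m" and \<theta>: "0 \<le> \<theta>" "\<theta> \<le> 1" and q: "0 \<le> q" "q \<le> p" "q \<le> \<theta> * p"
  defines "R \<equiv> (\<Sum>l\<in>UNIV. \<bar>\<rho> l\<bar>) + m + p"
  shows "\<mu> / 2 * (\<Sum>k\<in>UNIV. (\<theta> * \<sigma> k)\<^sup>2) \<le>
    (\<Sum>k\<in>UNIV. \<Sum>l\<in>UNIV. A k l * (\<sigma> l + \<rho> l) * (\<theta> * \<sigma> k)) + (\<Sum>k\<in>UNIV. \<beta> k * (\<theta> * \<sigma> k)) +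
    (\<Sum>k\<in>UNIV. \<gamma> k * (\<sigma> k + \<rho> k) * q) + \<delta> * q + (real CARD('n) * B\<^sup>2 / (2 * \<mu>) + B) * R\<^sup>2"
proof -
  define P where "P = (\<Sum>l\<in>UNIV. \<bar>\<rho> l\<bar>)"
  define D where "D k = \<theta> * \<sigma> k" for k
  have P: "0 \<le> P" by (simp add: P_def sum_nonneg)
  have p: "0 \<le> p" using q by linarith
  have R: "R = P + m + p" by (simp add: R_def P_def)
  have main: "\<mu> * (\<Sum>k\<in>UNIV. (D k)\<^sup>2) \<le> (\<Sum>k\<in>UNIV. \<Sum>l\<in>UNIV. A k l * \<sigma> l * D k)"
  proof -
    have "\<theta>\<^sup>2 \<le> \<theta>" using \<theta> by (simp add: power2_eq_square mult_left_le)
    then have "(\<Sum>k\<in>UNIV. (D k)\<^sup>2) \<le> \<theta> * (\<Sum>k\<in>UNIV. (\<sigma> k)\<^sup>2)"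
      by (simp add: D_def power_mult_distrib sum_distrib_left[symmetric] mult_right_mono sum_nonneg)
    then have "\<mu> * (\<Sum>k\<in>UNIV. (D k)\<^sup>2) \<le> \<theta> * (\<mu> * (\<Sum>k\<in>UNIV. (\<sigma> k)\<^sup>2))"
      using \<mu> by (simp add: mult.left_commute)
    also have "\<dots> \<le> \<theta> * (\<Sum>k\<in>UNIV. \<Sum>l\<in>UNIV. A k l * \<sigma> l * \<sigma> k)"
      using ell \<theta>(1) by (rule mult_left_mono)
    finally show ?thesis by (simp add: D_def sum_distrib_left mult_ac)
  qed
  have k: "- (\<mu> / 2 * (D k)\<^sup>2 + B\<^sup>2 / (2 * \<mu>) * R\<^sup>2) - B * p * \<bar>\<rho> k\<bar>
      \<le> (\<Sum>l\<in>UNIV. A k l * \<rho> l * D k) + \<beta> k * D k + \<gamma> k * (\<sigma> k + \<rho> k) * q" for k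
  proof -
    have 1: "\<bar>\<Sum>l\<in>UNIV. A k l * \<rho> l * D k\<bar> \<le> B * P * \<bar>D k\<bar>"
    proof -
      have "\<bar>\<Sum>l\<in>UNIV. A k l * \<rho> l * D k\<bar> \<le> (\<Sum>l\<in>UNIV. B * \<bar>\<rho> l\<bar> * \<bar>D k\<bar>)"
        using bd(1) by (intro order_trans[OF sum_abs] sum_mono) (simp add: abs_mult mult_right_mono)
      then show ?thesis by (simp add: P_def sum_distrib_left sum_distrib_right)
    qed
    have 2: "\<bar>\<beta> k * D k\<bar> \<le> B * m * \<bar>D k\<bar>" using bd(2) by (simp add: abs_mult mult_right_mono)
    \<comment> \<open>Here \<sigma> occurs without the factor \<theta>; the hypothesis q \<le>
      \<theta> p supplies it.\<close>
    have 3: "\<bar>\<gamma> k * \<sigma> k * q\<bar> \<le> B * p * \<bar>D k\<bar>"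
    proof -
      have "\<bar>\<sigma> k\<bar> * q \<le> \<bar>\<sigma> k\<bar> * (\<theta> * p)" using q by (intro mult_left_mono) auto
      then have "\<bar>\<sigma> k\<bar> * q \<le> \<bar>D k\<bar> * p" using \<theta> by (simp add: D_def abs_mult mult_ac)
      from mult_mono[OF bd(3)[of k] this B] q(1)
      have "\<bar>\<gamma> k\<bar> * (\<bar>\<sigma> k\<bar> * q) \<le> B * (\<bar>D k\<bar> * p)" by simp
      then show ?thesis using q by (simp add: abs_mult mult_ac)
    qed
    have 4: "\<bar>\<gamma> k * \<rho> k * q\<bar> \<le> B * p * \<bar>\<rho> k\<bar>"
    proof -
      have "\<bar>\<gamma> k\<bar> * (\<bar>\<rho> k\<bar> * q) \<le> B * (\<bar>\<rho> k\<bar> * p)"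
        using bd(3) B q by (intro mult_mono mult_left_mono) auto
      then show ?thesis using q by (simp add: abs_mult mult_ac)
    qed
    \<comment> \<open>Young's inequality, weighted so that half of the coercive term is spent. Its
      remainders, one per coordinate, give the first summand of the constant.\<close>
    have 5: "B * R * \<bar>D k\<bar> \<le> \<mu> / 2 * (D k)\<^sup>2 + B\<^sup>2 / (2 * \<mu>) * R\<^sup>2"
    proof -
      have "0 \<le> (\<mu> * \<bar>D k\<bar> - B * R)\<^sup>2 / (2 * \<mu>)" using \<mu> by simp
      also have "\<dots> = \<mu> / 2 * (D k)\<^sup>2 + B\<^sup>2 / (2 * \<mu>) * R\<^sup>2 - B * R * \<bar>D k\<bar>"
        using \<mu> by (simp add: power2_diff power_mult_distrib field_simps power2_eq_square)
      finally show ?thesis by simp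
    qed
    have "B * R * \<bar>D k\<bar> = B * P * \<bar>D k\<bar> + B * m * \<bar>D k\<bar> + B * p * \<bar>D k\<bar>" by (simp add: R algebra_simps)
    moreover have "\<gamma> k * (\<sigma> k + \<rho> k) * q = \<gamma> k * \<sigma> k * q + \<gamma> k * \<rho> k * q" by (simp add: algebra_simps)
    ultimately show ?thesis using 1 2 3 4 5 by linarith
  qed
  have "(\<Sum>k\<in>UNIV. - (\<mu> / 2 * (D k)\<^sup>2 + B\<^sup>2 / (2 * \<mu>) * R\<^sup>2) - B * p * \<bar>\<rho> k\<bar>)
    \<le> (\<Sum>k\<in>UNIV. (\<Sum>l\<in>UNIV. A k l * \<rho> l * D k) + \<beta> k * D k + \<gamma> k * (\<sigma> k + \<rho> k) * q)"
    by (rule sum_mono[OF k])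
  moreover have "(\<Sum>k\<in>UNIV. - (\<mu> / 2 * (D k)\<^sup>2 + B\<^sup>2 / (2 * \<mu>) * R\<^sup>2) - B * p * \<bar>\<rho> k\<bar>)
     = - (\<mu> / 2 * (\<Sum>k\<in>UNIV. (D k)\<^sup>2)) - real CARD('n) * B\<^sup>2 / (2 * \<mu>) * R\<^sup>2 - B * p * P"
    by (simp add: sum_subtractf sum_negf sum.distrib sum_distrib_left P_def)
  moreover have "(\<Sum>k\<in>UNIV. (\<Sum>l\<in>UNIV. A k l * \<rho> l * D k) + \<beta> k * D k + \<gamma> k * (\<sigma> k + \<rho> k) * q)
     = (\<Sum>k\<in>UNIV. \<Sum>l\<in>UNIV. A k l * \<rho> l * D k) + (\<Sum>k\<in>UNIV. \<beta> k * D k) + (\<Sum>k\<in>UNIV. \<gamma> k * (\<sigma> k + \<rho> k) * q)"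
    by (simp add: sum.distrib)
  moreover have "(\<Sum>k\<in>UNIV. \<Sum>l\<in>UNIV. A k l * (\<sigma> l + \<rho> l) * D k)
     = (\<Sum>k\<in>UNIV. \<Sum>l\<in>UNIV. A k l * \<sigma> l * D k) + (\<Sum>k\<in>UNIV. \<Sum>l\<in>UNIV. A k l * \<rho> l * D k)"
    by (simp add: sum.distrib algebra_simps)
  \<comment> \<open>The terms \<gamma> \<rho> q and \<delta> q contain no \<theta> \<sigma>; they
    account for the summand \<open>B\<close> of the constant.\<close>
  moreover have "B * p * P + B * m * p \<le> B * R\<^sup>2"
  proof -
    have "p * P + m * p \<le> R\<^sup>2" using P p m by (simp add: R power2_eq_square algebra_simps)
    then have "B * (p * P + m * p) \<le> B * R\<^sup>2" using B by (rule mult_left_mono)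
    then show ?thesis by (simp add: algebra_simps)
  qed
  moreover have "- (B * m * p) \<le> \<delta> * q"
  proof -
    have "\<bar>\<delta>\<bar> * q \<le> B * m * p" using bd(4) B m q by (intro mult_mono) auto
    then show ?thesis using q by (metis abs_mult abs_of_nonneg abs_le_D2 neg_le_iff_le minus_le_iff)
  qed
  moreover have "(real CARD('n) * B\<^sup>2 / (2 * \<mu>) + B) * R\<^sup>2 = real CARD('n) * B\<^sup>2 / (2 * \<mu>) * R\<^sup>2 + B * R\<^sup>2"
    by (simp add: algebra_simps)
  ultimately show ?thesis using main unfolding D_def by linarith
qed

text \<open>One \<open>B\<close> bounds all coefficients. Ellipticity is recorded for real vectors,
  in the index order in which the form pairs derivatives.\<close>

locale elliptic_form =
  fixes \<Omega> :: "(real ^ 'n::finite) set" and a :: "'n \<Rightarrow> 'n \<Rightarrow> real ^ 'n \<Rightarrow> real"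
    and b :: "'n \<Rightarrow> real ^ 'n \<Rightarrow> complex" and c :: "'n \<Rightarrow> real ^ 'n \<Rightarrow> real"
    and c\<^sub>0 :: "real ^ 'n \<Rightarrow> complex" and \<mu> B :: real
  assumes \<mu>: "0 < \<mu>" and B: "0 \<le> B"
    and meas: "\<And>k l. a k l \<in> borel_measurable (lebesgue_on \<Omega>)" "\<And>k. b k \<in> borel_measurable (lebesgue_on \<Omega>)"
    "\<And>k. c k \<in> borel_measurable (lebesgue_on \<Omega>)" "c\<^sub>0 \<in> borel_measurable (lebesgue_on \<Omega>)"
    and bd: "\<And>k l x. x \<in> \<Omega> \<Longrightarrow> \<bar>a k l x\<bar> \<le> B" "\<And>k x. x \<in> \<Omega> \<Longrightarrow> norm (b k x) \<le> B"
    "\<And>k x. x \<in> \<Omega> \<Longrightarrow> \<bar>c k x\<bar> \<le> B" "\<And>x. x \<in> \<Omega> \<Longrightarrow> norm (c\<^sub>0 x) \<le> B"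
    and ell: "\<And>x \<sigma>. x \<in> \<Omega> \<Longrightarrow> \<mu> * (\<Sum>k\<in>UNIV. (\<sigma> k)\<^sup>2) \<le> (\<Sum>k\<in>UNIV. \<Sum>l\<in>UNIV. a k l x * \<sigma> l * \<sigma> k)"

text \<open>Ellipticity is evaluated at vectors with real entries, where conjugation disappears and
  the quadratic form is insensitive to the order of the two factors.\<close>

lemma elliptic_coefficientsE:
  fixes a :: "'n::finite \<Rightarrow> 'n \<Rightarrow> real ^ 'n \<Rightarrow> real"
  assumes "elliptic_coefficients \<Omega> a b c c\<^sub>0"
  obtains \<mu> B where "elliptic_form \<Omega> a b c c\<^sub>0 \<mu> B"
proof -
  note E = assms[unfolded elliptic_coefficients_def]
  obtain \<mu> where \<mu>: "0 < \<mu>" "\<forall>x\<in>\<Omega>. \<forall>\<xi> :: complex ^ 'n.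
      \<mu> * (norm \<xi>)\<^sup>2 \<le> Re (\<Sum>k\<in>UNIV. \<Sum>l\<in>UNIV. of_real (a k l x) * \<xi> $ k * cnj (\<xi> $ l))"
    using E by auto
  have "\<exists>B. \<forall>x\<in>\<Omega>. \<bar>a k l x\<bar> \<le> B" for k l using E by (auto simp: bounded_iff)
  then obtain Ba where Ba: "\<And>k l x. x \<in> \<Omega> \<Longrightarrow> \<bar>a k l x\<bar> \<le> Ba k l" by metis
  have "\<exists>B. \<forall>x\<in>\<Omega>. norm (b k x) \<le> B" for k using E by (auto simp: bounded_iff)
  then obtain Bb where Bb: "\<And>k x. x \<in> \<Omega> \<Longrightarrow> norm (b k x) \<le> Bb k" by metis
  have "\<exists>B. \<forall>x\<in>\<Omega>. \<bar>c k x\<bar> \<le> B" for k using E by (auto simp: bounded_iff)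
  then obtain Bc where Bc: "\<And>k x. x \<in> \<Omega> \<Longrightarrow> \<bar>c k x\<bar> \<le> Bc k" by metis
  have "bounded (c\<^sub>0 ` \<Omega>)" using E by blast
  then obtain B0 where B0: "\<And>x. x \<in> \<Omega> \<Longrightarrow> norm (c\<^sub>0 x) \<le> B0" by (auto simp: bounded_iff)
  define B where "B = Max ({0, B0} \<union> range Bb \<union> range Bc \<union> range (\<lambda>(k, l). Ba k l))"
  have le: "z \<le> B" if "z \<in> {0, B0} \<union> range Bb \<union> range Bc \<union> range (\<lambda>(k, l). Ba k l)" for z
    unfolding B_def using that by (intro Max_ge) auto
  show thesis
  proof (rule that[of \<mu> B], unfold_locales)
    show "0 \<le> B" by (rule le) simp
    show "\<bar>a k l x\<bar> \<le> B" if "x \<in> \<Omega>" for k l x by (rule order_trans[OF Ba[OF that] le]) force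
    show "norm (b k x) \<le> B" if "x \<in> \<Omega>" for k x by (rule order_trans[OF Bb[OF that] le]) simp
    show "\<bar>c k x\<bar> \<le> B" if "x \<in> \<Omega>" for k x by (rule order_trans[OF Bc[OF that] le]) simp
    show "norm (c\<^sub>0 x) \<le> B" if "x \<in> \<Omega>" for x by (rule order_trans[OF B0[OF that] le]) simp
    fix x and \<sigma> :: "'n \<Rightarrow> real" assume x: "x \<in> \<Omega>"
    let ?\<xi> = "\<chi> k. complex_of_real (\<sigma> k)"
    have "(norm ?\<xi>)\<^sup>2 = (\<Sum>k\<in>UNIV. (\<sigma> k)\<^sup>2)"
      by (simp add: norm_vec_def L2_set_def sum_nonneg)
    moreover have "Re (\<Sum>k\<in>UNIV. \<Sum>l\<in>UNIV. of_real (a k l x) * ?\<xi> $ k * cnj (?\<xi> $ l))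
        = (\<Sum>k\<in>UNIV. \<Sum>l\<in>UNIV. a k l x * \<sigma> l * \<sigma> k)"
      by (simp add: mult_ac flip: of_real_mult of_real_sum)
    ultimately show "\<mu> * (\<Sum>k\<in>UNIV. (\<sigma> k)\<^sup>2) \<le> (\<Sum>k\<in>UNIV. \<Sum>l\<in>UNIV. a k l x * \<sigma> l * \<sigma> k)"
      using \<mu>(2)[rule_format, OF x, of ?\<xi>] by (simp only:)
  qed (use E \<mu> in auto)
qed

text \<open>The gradient of \<open>u\<close> enters the right side only through its difference from
  that of \<open>f\<close>, which is the point of the estimate. As \<psi>, \<open>a\<close> and
  \<open>c\<close> are real, the real part of the form sees only the real part of that gradient. The
  pointwise inequality is integrated, and the form drops out because it vanishes at \<psi>.\<close>

lemma (in elliptic_form) energy_estimate: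
  assumes \<Omega>: "open \<Omega>" "bounded \<Omega>"
    and u: "u \<in> L2 \<Omega>" "\<And>l. has_weak_partial \<Omega> l u (U l)" "\<And>l. U l \<in> L2 \<Omega>"
    and harm: "\<And>v. v \<in> test_functions \<Omega> \<Longrightarrow> elliptic_op \<Omega> a b c c\<^sub>0 u v = 0"
    and f: "smooth f" and \<epsilon>: "0 < \<epsilon>" and K: "compact K" "K \<subseteq> \<Omega>" and fK: "\<And>x. x \<notin> K \<Longrightarrow> Re (f x) \<le> 0"
  defines "\<psi> \<equiv> \<lambda>x. complex_of_real (flat 1 \<epsilon> (Re (f x)))"
  shows "\<psi> \<in> test_functions \<Omega>"
    and "\<mu> / 2 * (\<Sum>k\<in>UNIV. nsq \<Omega> (partial k \<psi>)) \<le> 3 * real CARD('n) * (real CARD('n) * B\<^sup>2 / (2 * \<mu>) + B) *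
      ((\<Sum>l\<in>UNIV. nsq K (\<lambda>x. U l x - partial l f x)) + nsq K u + nsq K f)"
proof -
  define C where "C = real CARD('n) * B\<^sup>2 / (2 * \<mu>) + B"
  have C: "0 \<le> C" using \<mu> B by (simp add: C_def)
  have \<Omega>m: "\<Omega> \<in> sets lebesgue" using \<Omega> by auto
  have Km: "K \<in> sets lebesgue" using K by (simp add: borel_compact)
  have "flat 1 \<epsilon> (Re (f x)) = 0" if "x \<notin> K" for x using fK[OF that] by (simp add: flat_def)
  then show \<psi>: "\<psi> \<in> test_functions \<Omega>"
    unfolding test_functions_iff \<psi>_def using smooth_intros(5)[OF f \<epsilon>, of 1] K by auto
  define \<theta> where "\<theta> x = flat 0 \<epsilon> (Re (f x)) + \<epsilon> * flat (- 1) \<epsilon> (Re (f x))" for x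
  define q where "q x = flat 1 \<epsilon> (Re (f x))" for x
  define \<sigma> where "\<sigma> k x = Re (partial k f x)" for k x
  define D where "D k x = \<theta> x * \<sigma> k x" for k x
  have partial_\<psi>: "partial k \<psi> x = of_real (D k x)" for k x
    unfolding \<psi>_def by (subst smooth_partial_flat[OF f \<epsilon>]) (simp add: D_def \<theta>_def \<sigma>_def)
  have \<psi>q: "\<psi> x = of_real (q x)" for x by (simp add: \<psi>_def q_def)
  have outside: "D k x = 0" "q x = 0" if "x \<notin> K" for k x
    using fK[OF that] by (simp_all add: D_def \<theta>_def q_def flat_def)
  let ?wp = "\<lambda>l. weak_partial \<Omega> l u"
  have ae: "AE x in lebesgue_on \<Omega>. U l x = ?wp l x" for l
    using weak_partial_AE[OF \<Omega>(1) u(2)[of l]] by eventually_elim simp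
  have wpm: "?wp l \<in> borel_measurable (lebesgue_on \<Omega>)" for l
    by (rule borel_measurable_lebesgue_on_AE[OF \<Omega>(1) L2_measurable[OF u(3)] ae])
  have L: "\<psi> \<in> L2 \<Omega>" "partial k \<psi> \<in> L2 \<Omega>" for k
    using \<psi> by (auto intro: test_function_L2 test_functions_partial \<Omega>m)
  \<comment> \<open>\<open>elliptic_op\<close> contains the chosen representative of the weak
    derivative; it is exchanged for the square-integrable one.\<close>
  have swap: "(LINT x|lebesgue_on \<Omega>. m x * ?wp l x * z x) = (LINT x|lebesgue_on \<Omega>. m x * U l x * z x)"
    if "m \<in> borel_measurable (lebesgue_on \<Omega>)" "z \<in> borel_measurable (lebesgue_on \<Omega>)" for m z l
  proof (rule integral_cong_AE)
    show "AE x in lebesgue_on \<Omega>. m x * ?wp l x * z x = m x * U l x * z x"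
      using ae[of l] by eventually_elim simp
  qed (intro borel_measurable_times that wpm L2_measurable[OF u(3)])+
  have mo: "(\<lambda>x. complex_of_real (a k l x)) \<in> borel_measurable (lebesgue_on \<Omega>)"
     "(\<lambda>x. complex_of_real (c k x)) \<in> borel_measurable (lebesgue_on \<Omega>)" for k l
    using meas by (auto intro: borel_measurable_of_real)
  define F1 where "F1 k l x = of_real (a k l x) * U l x * partial k \<psi> x" for k l x
  define F2 where "F2 k x = b k x * u x * partial k \<psi> x" for k x
  define F3 where "F3 k x = of_real (c k x) * U k x * \<psi> x" for k x
  define F4 where "F4 x = c\<^sub>0 x * u x * \<psi> x" for x
  have i1: "integrable (lebesgue_on \<Omega>) (F1 k l)" for k l
    unfolding F1_def using bd by (intro L2_mult_integrable L L2_bounded_mult[where B=B] u mo) auto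
  have i2: "integrable (lebesgue_on \<Omega>) (F2 k)" for k
    unfolding F2_def using bd by (intro L2_mult_integrable L L2_bounded_mult[where B=B] u meas) auto
  have i3: "integrable (lebesgue_on \<Omega>) (F3 k)" for k
    unfolding F3_def using bd by (intro L2_mult_integrable L L2_bounded_mult[where B=B] u mo) auto
  have i4: "integrable (lebesgue_on \<Omega>) F4"
    unfolding F4_def using bd by (intro L2_mult_integrable L L2_bounded_mult[where B=B] u meas) auto
  define F where "F x = (\<Sum>k\<in>UNIV. \<Sum>l\<in>UNIV. F1 k l x) + (\<Sum>k\<in>UNIV. F2 k x) + (\<Sum>k\<in>UNIV. F3 k x) + F4 x" for x
  have iF: "integrable (lebesgue_on \<Omega>) F"
    unfolding F_def by (intro Bochner_Integration.integrable_add Bochner_Integration.integrable_sum i1 i2 i3 i4)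
  have "(LINT x|lebesgue_on \<Omega>. F x) = elliptic_op \<Omega> a b c c\<^sub>0 u \<psi>"
  proof -
    have c1: "cnj (partial k \<psi> x) = partial k \<psi> x" for k x by (simp add: partial_\<psi>)
    have c2: "cnj (\<psi> x) = \<psi> x" for x by (simp add: \<psi>q)
    have "elliptic_op \<Omega> a b c c\<^sub>0 u \<psi> = (\<Sum>k\<in>UNIV. \<Sum>l\<in>UNIV. LINT x|lebesgue_on \<Omega>. F1 k l x)
        + (\<Sum>k\<in>UNIV. LINT x|lebesgue_on \<Omega>. F2 k x) + (\<Sum>k\<in>UNIV. LINT x|lebesgue_on \<Omega>. F3 k x)
        + (LINT x|lebesgue_on \<Omega>. F4 x)"
      unfolding elliptic_op_def c1 c2 F1_def F2_def F3_def F4_def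
      by (simp only: swap[OF mo(1) L2_measurable[OF L(2)]] swap[OF mo(2) L2_measurable[OF L(1)]])
    also have "\<dots> = (LINT x|lebesgue_on \<Omega>. F x)"
      unfolding F_def by (simp add: i1 i2 i3 i4)
    finally show ?thesis by simp
  qed
  then have "(LINT x|lebesgue_on \<Omega>. F x) = 0" using harm[OF \<psi>] by simp
  then have ReF: "(LINT x|lebesgue_on \<Omega>. Re (F x)) = 0" using iF by simp
  define E where "E x = (\<Sum>l\<in>UNIV. (norm (U l x - partial l f x))\<^sup>2) + (norm (u x))\<^sup>2 + (norm (f x))\<^sup>2" for x
  let ?C = "3 * real CARD('n) * C"
  note Kb = compact_imp_bounded[OF K(1)]
  have UL: "(\<lambda>x. U l x - partial l f x) \<in> L2 K" "u \<in> L2 K" "f \<in> L2 K" for l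
    by (intro L2_diff smooth_L2[OF smooth_partial[OF f] Kb Km] smooth_L2[OF f Kb Km] L2_subset[OF K(2) Km \<Omega>m] u)+
  have iE: "integrable (lebesgue_on K) E"
    unfolding E_def by (intro Bochner_Integration.integrable_add Bochner_Integration.integrable_sum L2_integrable UL)
  note iEK = integrable_lebesgue_on_extend[OF iE Km \<Omega>m]
  have EK: "(LINT x|lebesgue_on K. E x) = (\<Sum>l\<in>UNIV. nsq K (\<lambda>x. U l x - partial l f x)) + nsq K u + nsq K f"
    unfolding E_def nsq_def by (simp add: L2_integrable UL)
  have E0: "0 \<le> E x" for x unfolding E_def by (intro add_nonneg_nonneg sum_nonneg) auto
  \<comment> \<open>Off \<open>K\<close> the gradient of \<psi> and \<open>F\<close> both vanish, so
    the error density \<open>E\<close> may be cut off there.\<close>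
  have point: "\<mu> / 2 * (\<Sum>k\<in>UNIV. (D k x)\<^sup>2) \<le> Re (F x) + ?C * (if x \<in> K then E x else 0)" if x: "x \<in> \<Omega>" for x
  proof (cases "x \<in> K")
    case True
    define \<rho> where "\<rho> l = Re (U l x) - \<sigma> l x" for l
    have "\<bar>Re (b k x * u x)\<bar> \<le> B * norm (u x)" for k
      using abs_Re_le_cmod[of "b k x * u x"] mult_right_mono[OF bd(2)[OF x, of k], of "norm (u x)"] by (simp only: norm_mult) (simp add: norm_mult)
    moreover have "\<bar>Re (c\<^sub>0 x * u x)\<bar> \<le> B * norm (u x)"
      using abs_Re_le_cmod[of "c\<^sub>0 x * u x"] mult_right_mono[OF bd(4)[OF x], of "norm (u x)"] by (simp only: norm_mult) (simp add: norm_mult)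
    moreover have "q x \<le> norm (f x)" "q x \<le> \<theta> x * norm (f x)"
    proof -
      have m: "max 0 (Re (f x)) \<le> norm (f x)" using complex_Re_le_cmod by simp
      show "q x \<le> norm (f x)" unfolding q_def by (rule order_trans[OF flat_1_bounds(4)[OF \<epsilon>] m])
      show "q x \<le> \<theta> x * norm (f x)" unfolding q_def \<theta>_def
        by (rule order_trans[OF flat_1_bounds(6)[OF \<epsilon>] mult_left_mono[OF m flat_1_bounds(1)[OF \<epsilon>]]])
    qed
    ultimately have "\<mu> / 2 * (\<Sum>k\<in>UNIV. (\<theta> x * \<sigma> k x)\<^sup>2) \<le>
      (\<Sum>k\<in>UNIV. \<Sum>l\<in>UNIV. a k l x * (\<sigma> l x + \<rho> l) * (\<theta> x * \<sigma> k x)) + (\<Sum>k\<in>UNIV. Re (b k x * u x) * (\<theta> x * \<sigma> k x)) +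
      (\<Sum>k\<in>UNIV. c k x * (\<sigma> k x + \<rho> k) * q x) + Re (c\<^sub>0 x * u x) * q x
      + C * ((\<Sum>l\<in>UNIV. \<bar>\<rho> l\<bar>) + norm (u x) + norm (f x))\<^sup>2"
      unfolding C_def
      by (intro pointwise_coercivity \<mu> B ell[OF x] bd[OF x] norm_ge_zero)
        (auto simp: \<theta>_def q_def intro: flat_1_bounds(1-3)[OF \<epsilon>])
    also have "(\<Sum>k\<in>UNIV. \<Sum>l\<in>UNIV. a k l x * (\<sigma> l x + \<rho> l) * (\<theta> x * \<sigma> k x)) + (\<Sum>k\<in>UNIV. Re (b k x * u x) * (\<theta> x * \<sigma> k x)) +
      (\<Sum>k\<in>UNIV. c k x * (\<sigma> k x + \<rho> k) * q x) + Re (c\<^sub>0 x * u x) * q x = Re (F x)"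
      unfolding F_def F1_def F2_def F3_def F4_def partial_\<psi> \<psi>q by (simp add: \<rho>_def D_def)
    finally have 1: "\<mu> / 2 * (\<Sum>k\<in>UNIV. (\<theta> x * \<sigma> k x)\<^sup>2)
      \<le> Re (F x) + C * ((\<Sum>l\<in>UNIV. \<bar>\<rho> l\<bar>) + norm (u x) + norm (f x))\<^sup>2" .
    \<comment> \<open>The factor 3 comes from three summands, the dimension from Cauchy-Schwarz for
      the sum over the coordinates.\<close>
    have 2: "((\<Sum>l\<in>UNIV. \<bar>\<rho> l\<bar>) + norm (u x) + norm (f x))\<^sup>2 \<le> 3 * real CARD('n) * E x"
    proof -
      let ?P = "\<Sum>l\<in>UNIV. \<bar>\<rho> l\<bar>"
      have n: "1 \<le> real CARD('n)" by (simp add: Suc_leI)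
      note sum3_squared_le[of ?P "norm (u x)" "norm (f x)"]
      moreover have "?P\<^sup>2 \<le> real CARD('n) * (\<Sum>l\<in>UNIV. (norm (U l x - partial l f x))\<^sup>2)"
      proof -
        have "?P\<^sup>2 \<le> (\<Sum>l\<in>UNIV. \<bar>\<rho> l\<bar>\<^sup>2) * real CARD('n)" by (rule sum_squared_le_sum_of_squares)
        also have "(\<Sum>l\<in>UNIV. \<bar>\<rho> l\<bar>\<^sup>2) \<le> (\<Sum>l\<in>UNIV. (norm (U l x - partial l f x))\<^sup>2)"
        proof (intro sum_mono power_mono)
          show "\<bar>\<rho> l\<bar> \<le> norm (U l x - partial l f x)" for l
            using abs_Re_le_cmod[of "U l x - partial l f x"] by (simp add: \<rho>_def \<sigma>_def)
        qed auto
        finally show ?thesis by (simp add: mult.commute mult_left_mono)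
      qed
      moreover have "(norm (u x))\<^sup>2 \<le> real CARD('n) * (norm (u x))\<^sup>2" "(norm (f x))\<^sup>2 \<le> real CARD('n) * (norm (f x))\<^sup>2"
        using mult_right_mono[OF n, of "(norm (u x))\<^sup>2"] mult_right_mono[OF n, of "(norm (f x))\<^sup>2"] by simp_all
      ultimately show ?thesis by (simp add: E_def distrib_left)
    qed
    have "C * ((\<Sum>l\<in>UNIV. \<bar>\<rho> l\<bar>) + norm (u x) + norm (f x))\<^sup>2 \<le> ?C * E x"
      using mult_left_mono[OF 2 C] by (simp add: mult_ac)
    then show ?thesis using 1 True unfolding D_def by simp
  next
    case False
    then have "F x = 0" unfolding F_def F1_def F2_def F3_def F4_def partial_\<psi> \<psi>q by (simp add: outside)
    then show ?thesis using False by (simp add: outside)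
  qed
  have "\<mu> / 2 * (\<Sum>k\<in>UNIV. nsq \<Omega> (partial k \<psi>)) = (LINT x|lebesgue_on \<Omega>. \<mu> / 2 * (\<Sum>k\<in>UNIV. (norm (partial k \<psi> x))\<^sup>2))"
    unfolding nsq_def using L2_integrable[OF L(2)] by simp
  also have "\<dots> \<le> (LINT x|lebesgue_on \<Omega>. Re (F x) + ?C * (if x \<in> K then E x else 0))"
  proof (rule integral_mono)
    show "integrable (lebesgue_on \<Omega>) (\<lambda>x. \<mu> / 2 * (\<Sum>k\<in>UNIV. (norm (partial k \<psi> x))\<^sup>2))"
      using L2_integrable[OF L(2)] by simp
    show "integrable (lebesgue_on \<Omega>) (\<lambda>x. Re (F x) + ?C * (if x \<in> K then E x else 0))"
      using iF iEK by simp
    show "\<mu> / 2 * (\<Sum>k\<in>UNIV. (norm (partial k \<psi> x))\<^sup>2) \<le> Re (F x) + ?C * (if x \<in> K then E x else 0)"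
      if "x \<in> space (lebesgue_on \<Omega>)" for x
      using point[of x] that by (simp add: partial_\<psi>)
  qed
  also have "\<dots> = ?C * (LINT x|lebesgue_on K. E x)"
  proof -
    have "(LINT x|lebesgue_on \<Omega>. Re (F x) + ?C * (if x \<in> K then E x else 0))
      = (LINT x|lebesgue_on \<Omega>. Re (F x)) + ?C * (LINT x|lebesgue_on \<Omega>. (if x \<in> K then E x else 0))"
      using iF iEK by simp
    then show ?thesis using ReF Lebesgue_Measure.integral_restrict[OF K(2) Km \<Omega>m, of E] by simp
  qed
  finally show "\<mu> / 2 * (\<Sum>k\<in>UNIV. nsq \<Omega> (partial k \<psi>)) \<le> 3 * real CARD('n) * (real CARD('n) * B\<^sup>2 / (2 * \<mu>) + B) *
      ((\<Sum>l\<in>UNIV. nsq K (\<lambda>x. U l x - partial l f x)) + nsq K u + nsq K f)"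
    unfolding EK C_def .
qed

section \<open>Transfer between Perron operators\<close>

lemma perron_operatorD:
  assumes "perron_operator \<Omega> a b c c\<^sub>0 T"
  shows "continuous_on (frontier \<Omega>) \<phi> \<Longrightarrow> continuous_on \<Omega> (T \<phi>)"
    "continuous_on (frontier \<Omega>) \<phi> \<Longrightarrow> bounded (T \<phi> ` \<Omega>)"
    "continuous_on (frontier \<Omega>) \<phi> \<Longrightarrow> continuous_on (frontier \<Omega>) \<psi> \<Longrightarrow> x \<in> \<Omega> \<Longrightarrow> T (\<lambda>z. \<phi> z + \<psi> z) x = T \<phi> x + T \<psi> x"
    "continuous_on (frontier \<Omega>) \<phi> \<Longrightarrow> x \<in> \<Omega> \<Longrightarrow> T (\<lambda>z. \<alpha> * \<phi> z) x = \<alpha> * T \<phi> x"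
    "\<exists>M. \<forall>\<phi>. continuous_on (frontier \<Omega>) \<phi> \<longrightarrow> (\<forall>x\<in>\<Omega>. norm (T \<phi> x) \<le> M * (SUP z\<in>frontier \<Omega>. norm (\<phi> z)))"
    "continuous_on (frontier \<Omega>) \<phi> \<Longrightarrow> harmonic \<Omega> a b c c\<^sub>0 (T \<phi>)"
    "continuous_on (closure \<Omega>) \<phi> \<Longrightarrow> \<phi> \<in> H1 \<Omega> \<Longrightarrow> (\<lambda>x. \<phi> x - T \<phi> x) \<in> H1_0 \<Omega>"
  using assms unfolding perron_operator_def by blast+

text \<open>Linearity turns the operator bound into continuity in the boundary data.\<close>

lemma perron_operator_Lipschitz:
  fixes T :: "(real ^ 'n::finite \<Rightarrow> complex) \<Rightarrow> real ^ 'n \<Rightarrow> complex"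
  assumes T: "perron_operator \<Omega> a b c c\<^sub>0 T" and \<Omega>: "open \<Omega>" "bounded \<Omega>"
  obtains M where "0 \<le> M"
    "\<And>\<phi> \<psi> \<delta> x. continuous_on (frontier \<Omega>) \<phi> \<Longrightarrow> continuous_on (frontier \<Omega>) \<psi> \<Longrightarrow>
      (\<And>z. z \<in> frontier \<Omega> \<Longrightarrow> norm (\<psi> z - \<phi> z) \<le> \<delta>) \<Longrightarrow> x \<in> \<Omega> \<Longrightarrow> norm (T \<psi> x - T \<phi> x) \<le> M * \<delta>"
proof -
  obtain M where M: "\<And>\<phi> x. continuous_on (frontier \<Omega>) \<phi> \<Longrightarrow> x \<in> \<Omega> \<Longrightarrow>
      norm (T \<phi> x) \<le> M * (SUP z\<in>frontier \<Omega>. norm (\<phi> z))"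
    using perron_operatorD(5)[OF T] by blast
  show thesis
  proof (rule that[of "max 0 M"])
    fix \<phi> \<psi> :: "real ^ 'n \<Rightarrow> complex" and \<delta> x
    assume cont: "continuous_on (frontier \<Omega>) \<phi>" "continuous_on (frontier \<Omega>) \<psi>" and x: "x \<in> \<Omega>"
      and le: "\<And>z. z \<in> frontier \<Omega> \<Longrightarrow> norm (\<psi> z - \<phi> z) \<le> \<delta>"
    \<comment> \<open>Only the empty set and the whole space have empty frontier; the point
      \<open>x\<close> and boundedness exclude both, so the supremum is over a nonempty set.\<close>
    have ne: "frontier \<Omega> \<noteq> {}" using x \<Omega>(2) by (metis empty_iff frontier_eq_empty not_bounded_UNIV)
    have "(SUP z\<in>frontier \<Omega>. norm (\<psi> z - \<phi> z)) \<le> \<delta>" by (rule cSUP_least[OF ne le])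
    moreover have "0 \<le> (SUP z\<in>frontier \<Omega>. norm (\<psi> z - \<phi> z))"
    proof -
      obtain z where z: "z \<in> frontier \<Omega>" using ne by blast
      have "norm (\<psi> z - \<phi> z) \<le> (SUP z\<in>frontier \<Omega>. norm (\<psi> z - \<phi> z))"
        by (rule cSUP_upper[OF z bdd_aboveI2[OF le]])
      then show ?thesis using norm_ge_zero order_trans by blast
    qed
    ultimately have "M * (SUP z\<in>frontier \<Omega>. norm (\<psi> z - \<phi> z)) \<le> max 0 M * \<delta>"
      by (intro mult_mono) auto
    moreover have "continuous_on (frontier \<Omega>) (\<lambda>z. \<psi> z - \<phi> z)" using cont by (intro continuous_intros)
    ultimately have "norm (T (\<lambda>z. \<psi> z - \<phi> z) x) \<le> max 0 M * \<delta>" using M x by (meson order_trans)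
    moreover have "T (\<lambda>z. \<psi> z - \<phi> z) x = T \<psi> x - T \<phi> x"
    proof -
      have c': "continuous_on (frontier \<Omega>) (\<lambda>z. - 1 * \<phi> z)" using cont by (intro continuous_intros)
      show ?thesis
        using perron_operatorD(3)[OF T cont(2) c' x] perron_operatorD(4)[OF T cont(1) x, of "-1"] by simp
    qed
    ultimately show "norm (T \<psi> x - T \<phi> x) \<le> max 0 M * \<delta>" by simp
  qed simp
qed

text \<open>\<Phi> is in \<open>H1\<close> and differs from \<open>T \<Phi>\<close> by an element of
  \<open>H1_0\<close>.\<close>

lemma perron_H1:
  assumes T: "perron_operator \<Omega> a b c c\<^sub>0 T" and \<Omega>: "open \<Omega>" "bounded \<Omega>"
    and \<Phi>: "smooth \<Phi>"
  shows "T \<Phi> \<in> H1 \<Omega>"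
proof -
  have H: "\<Phi> \<in> H1 \<Omega>" by (rule smooth_H1[OF \<Phi> \<Omega>])
  have "(\<lambda>x. \<Phi> x - T \<Phi> x) \<in> H1 \<Omega>"
    using perron_operatorD(7)[OF T smooth_continuous[OF \<Phi>] H] by (simp add: H1_0_def)
  from H1_diff[OF \<Omega>(1) H this] show ?thesis by simp
qed

text \<open>\<open>Bd\<close> is fixed before \<epsilon> and \<eta>: their smallness affects the
  \<open>L2\<close> distance, never the gradient bound. This is the form that the minimizing
  argument consumes.\<close>

lemma positive_part_test_approximation:
  fixes a :: "'n::finite \<Rightarrow> 'n \<Rightarrow> real ^ 'n \<Rightarrow> real"
  assumes \<Omega>: "open \<Omega>" "bounded \<Omega>" and coeff: "elliptic_coefficients \<Omega> a b c c\<^sub>0"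
    and T: "perron_operator \<Omega> a b c c\<^sub>0 T" and S: "perron_operator \<Omega> a' b' c' c\<^sub>0' S"
    and \<phi>: "continuous_on (frontier \<Omega>) \<phi>" and w: "S \<phi> \<in> H1 \<Omega>"
  obtains Bd where "\<And>\<epsilon> \<eta>. 0 < \<epsilon> \<Longrightarrow> \<epsilon> \<le> 1 \<Longrightarrow> 0 < \<eta> \<Longrightarrow> \<eta> \<le> 1 \<Longrightarrow>
    \<exists>\<psi>\<in>test_functions \<Omega>. (\<Sum>k\<in>UNIV. nsq \<Omega> (partial k \<psi>)) \<le> Bd \<and>
      nsq \<Omega> (\<lambda>x. \<psi> x - of_real (max 0 (Re (T \<phi> x - S \<phi> x)))) \<le> 48 * \<epsilon>\<^sup>2 * measure lebesgue \<Omega> + 6 * \<eta>"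
proof -
  have \<Omega>m: "\<Omega> \<in> sets lebesgue" "\<Omega> \<in> lmeasurable" using \<Omega> by (auto simp: bounded_set_imp_lmeasurable)
  let ?m = "measure lebesgue \<Omega>"
  obtain \<mu> B where "elliptic_form \<Omega> a b c c\<^sub>0 \<mu> B" using elliptic_coefficientsE[OF coeff] .
  then interpret elliptic_form \<Omega> a b c c\<^sub>0 \<mu> B .
  obtain b1 where b1: "\<And>x. x \<in> \<Omega> \<Longrightarrow> norm (T \<phi> x) \<le> b1"
    using perron_operatorD(2)[OF T \<phi>] by (auto simp: bounded_iff)
  obtain b2 where b2: "\<And>x. x \<in> \<Omega> \<Longrightarrow> norm (S \<phi> x) \<le> b2"
    using perron_operatorD(2)[OF S \<phi>] by (auto simp: bounded_iff)
  obtain W where W: "S \<phi> \<in> L2 \<Omega>" "\<And>k. W k \<in> L2 \<Omega>" "\<And>k. has_weak_partial \<Omega> k (S \<phi>) (W k)"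
    using H1E[OF w] by blast
  obtain MT where MT: "0 \<le> MT" "\<And>\<psi> \<delta> x. continuous_on (frontier \<Omega>) \<psi> \<Longrightarrow>
      (\<And>z. z \<in> frontier \<Omega> \<Longrightarrow> norm (\<psi> z - \<phi> z) \<le> \<delta>) \<Longrightarrow> x \<in> \<Omega> \<Longrightarrow> norm (T \<psi> x - T \<phi> x) \<le> MT * \<delta>"
    using perron_operator_Lipschitz[OF T \<Omega>] \<phi> by metis
  obtain MS where MS: "0 \<le> MS" "\<And>\<psi> \<delta> x. continuous_on (frontier \<Omega>) \<psi> \<Longrightarrow>
      (\<And>z. z \<in> frontier \<Omega> \<Longrightarrow> norm (\<psi> z - \<phi> z) \<le> \<delta>) \<Longrightarrow> x \<in> \<Omega> \<Longrightarrow> norm (S \<psi> x - S \<phi> x) \<le> MS * \<delta>"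
    using perron_operator_Lipschitz[OF S \<Omega>] \<phi> by metis
  define C where "C = 3 * real CARD('n) * (real CARD('n) * B\<^sup>2 / (2 * \<mu>) + B)"
  have C: "0 \<le> C" using \<mu> B by (simp add: C_def)
  \<comment> \<open>The three groups bound, in squared \<open>L2\<close> norm on \<open>K\<close>,
    the gradient of \<open>T \<Phi> - f\<close>, then \<open>T \<Phi>\<close>, then
    \<open>f\<close>. The additive numbers arise from \<epsilon>, \<eta> \<le> 1.\<close>
  define Q where "Q = (\<Sum>l\<in>UNIV. 2 * nsq \<Omega> (W l) + 8) + (b1 + 1)\<^sup>2 * ?m + (4 * (b1 + b2 + 2)\<^sup>2 * ?m + 4 + 18 * ?m)"
  show thesis
  proof (rule that[of "2 / \<mu> * (C * Q)"])
    fix \<epsilon> \<eta> :: real assume \<epsilon>: "0 < \<epsilon>" "\<epsilon> \<le> 1" and \<eta>: "0 < \<eta>" "\<eta> \<le> 1"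
    \<comment> \<open>Both solutions then move by at most \<epsilon> when \<phi> is replaced by
      \<Phi>; the summand 1 keeps the denominator positive.\<close>
    define \<delta> where "\<delta> = \<epsilon> / (MT + MS + 1)"
    have \<delta>: "0 < \<delta>" "MT * \<delta> \<le> \<epsilon>" "MS * \<delta> \<le> \<epsilon>"
      using \<epsilon> MT(1) MS(1) by (auto simp: \<delta>_def field_simps)
    have "compact (frontier \<Omega>)" using \<Omega>(2) by (rule compact_frontier_bounded)
    then obtain \<Phi> where \<Phi>: "smooth \<Phi>" "\<And>z. z \<in> frontier \<Omega> \<Longrightarrow> norm (\<Phi> z - \<phi> z) < \<delta>"
      using smooth_uniform_approximation[OF _ \<phi> \<delta>(1)] by blast
    note c\<Phi> = smooth_continuous[OF \<Phi>(1)]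
    have near: "norm (T \<Phi> x - T \<phi> x) \<le> \<epsilon>" "norm (S \<Phi> x - S \<phi> x) \<le> \<epsilon>" if "x \<in> \<Omega>" for x
      using MT(2)[OF c\<Phi> less_imp_le[OF \<Phi>(2)] that] MS(2)[OF c\<Phi> less_imp_le[OF \<Phi>(2)] that] \<delta> by auto
    obtain U where U: "T \<Phi> \<in> L2 \<Omega>" "\<And>k. U k \<in> L2 \<Omega>" "\<And>k. has_weak_partial \<Omega> k (T \<Phi>) (U k)"
      using H1E[OF perron_H1[OF T \<Omega> \<Phi>(1)]] by blast
    obtain X where X: "S \<Phi> \<in> L2 \<Omega>" "\<And>k. X k \<in> L2 \<Omega>" "\<And>k. has_weak_partial \<Omega> k (S \<Phi>) (X k)"
      using H1E[OF perron_H1[OF S \<Omega> \<Phi>(1)]] by blast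
    note L\<Phi> = smooth_L2[OF \<Phi>(1) \<Omega>(2) \<Omega>m(1)] smooth_L2[OF smooth_partial[OF \<Phi>(1)] \<Omega>(2) \<Omega>m(1)]
    note H\<Phi> = smooth_H1[OF \<Phi>(1) \<Omega>] smooth_has_weak_partial[OF \<Phi>(1) \<Omega>(1)]
    \<comment> \<open>Two approximations at level \<eta>/4 combine to a squared distance of at most
      2 \<eta>/4 + 2 \<eta>/4 = \<eta>.\<close>
    have \<eta>4: "0 < \<eta> / 4" using \<eta> by simp
    obtain v1 where v1: "v1 \<in> test_functions \<Omega>" "nsq \<Omega> (\<lambda>x. (\<Phi> x - T \<Phi> x) - v1 x) < \<eta> / 4"
        "\<And>k. nsq \<Omega> (\<lambda>x. (partial k \<Phi> x - U k x) - partial k v1 x) < \<eta> / 4"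
      using H1_0_approx[OF \<Omega>(1) perron_operatorD(7)[OF T c\<Phi> H\<Phi>(1)] has_weak_partial_diff[OF \<Omega>(1) H\<Phi>(2) U(3)]
          L2_diff[OF L\<Phi>(2) U(2)] \<eta>4] by blast
    obtain v2 where v2: "v2 \<in> test_functions \<Omega>" "nsq \<Omega> (\<lambda>x. (\<Phi> x - S \<Phi> x) - v2 x) < \<eta> / 4"
        "\<And>k. nsq \<Omega> (\<lambda>x. (partial k \<Phi> x - X k x) - partial k v2 x) < \<eta> / 4"
      using H1_0_approx[OF \<Omega>(1) perron_operatorD(7)[OF S c\<Phi> H\<Phi>(1)] has_weak_partial_diff[OF \<Omega>(1) H\<Phi>(2) X(3)]
          L2_diff[OF L\<Phi>(2) X(2)] \<eta>4] by blast
    note Lt = test_function_L2[of _ \<Omega>, OF _ \<Omega>m(1)] test_function_L2[OF test_functions_partial[of _ \<Omega>] \<Omega>m(1)]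
    \<comment> \<open>Each operator only puts \<Phi> minus its solution into \<open>H1_0\<close>, so
      T \<Phi> - S \<Phi> is approximated as (\<Phi> - S \<Phi>) - (\<Phi> - T \<Phi>).\<close>
    define v where "v x = v2 x - v1 x" for x
    have v: "v \<in> test_functions \<Omega>" unfolding v_def by (rule test_functions_diff[OF v2(1) v1(1)])
    note sv = test_functionsD[OF v]
    define h where "h x = T \<Phi> x - S \<Phi> x" for x
    have Lh: "h \<in> L2 \<Omega>" unfolding h_def by (rule L2_diff[OF U(1) X(1)])
    have hv: "nsq \<Omega> (\<lambda>x. h x - v x) \<le> \<eta>"
    proof -
      have "nsq \<Omega> (\<lambda>x. h x - v x) = nsq \<Omega> (\<lambda>x. ((\<Phi> x - S \<Phi> x) - v2 x) - ((\<Phi> x - T \<Phi> x) - v1 x))"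
        by (simp add: h_def v_def algebra_simps)
      also have "\<dots> \<le> 2 * nsq \<Omega> (\<lambda>x. (\<Phi> x - S \<Phi> x) - v2 x) + 2 * nsq \<Omega> (\<lambda>x. (\<Phi> x - T \<Phi> x) - v1 x)"
        by (intro nsq_diff_le L2_diff L\<Phi> X U Lt v1 v2)
      finally show ?thesis using v1(2) v2(2) by linarith
    qed
    have pv: "partial k v x = partial k v2 x - partial k v1 x" for k x
      unfolding v_def by (rule smooth_partial_diff[OF test_functionsD(1)[OF v2(1)] test_functionsD(1)[OF v1(1)]])
    have Hv: "nsq \<Omega> (\<lambda>x. (U k x - X k x) - partial k v x) \<le> \<eta>" for k
    proof -
      have "nsq \<Omega> (\<lambda>x. (U k x - X k x) - partial k v x)
        = nsq \<Omega> (\<lambda>x. ((partial k \<Phi> x - X k x) - partial k v2 x) - ((partial k \<Phi> x - U k x) - partial k v1 x))"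
        by (simp add: pv algebra_simps)
      also have "\<dots> \<le> 2 * nsq \<Omega> (\<lambda>x. (partial k \<Phi> x - X k x) - partial k v2 x) + 2 * nsq \<Omega> (\<lambda>x. (partial k \<Phi> x - U k x) - partial k v1 x)"
        by (intro nsq_diff_le L2_diff L\<Phi> X U Lt v1 v2)
      finally show ?thesis using v1(3)[of k] v2(3)[of k] by linarith
    qed
    define K where "K = closure {x. v x \<noteq> 0}"
    have K: "compact K" "K \<subseteq> \<Omega>" using sv by (auto simp: K_def)
    have v0: "v x = 0" if "x \<notin> K" for x using that closure_subset[of "{x. v x \<noteq> 0}"] by (auto simp: K_def)
    have Km: "K \<in> sets lebesgue" using K by (simp add: borel_compact)
    define g where "g x = S \<Phi> x - S \<phi> x" for x
    have Lg: "g \<in> L2 \<Omega>" unfolding g_def by (rule L2_diff[OF X(1) W(1)])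
    have cg: "continuous_on \<Omega> g"
      unfolding g_def by (intro continuous_on_diff perron_operatorD(1)[OF S] c\<Phi> \<phi>)
    have gW: "has_weak_partial \<Omega> k g (\<lambda>x. X k x - W k x)" for k
      unfolding g_def by (rule has_weak_partial_diff[OF \<Omega>(1) X(3) W(3)])
    have gb: "norm (g x) \<le> \<epsilon>" if "x \<in> \<Omega>" for x using near(2)[OF that] by (simp add: g_def)
    obtain e where e: "smooth e" "\<And>x. norm (e x) \<le> \<epsilon>" "nsq K (\<lambda>x. g x - e x) < \<eta>"
        "\<And>k. nsq K (\<lambda>x. (X k x - W k x) - partial k e x) < \<eta>"
      using smooth_approximation[OF \<Omega> Lg gW L2_diff[OF X(2) W(2)] cg gb less_imp_le[OF \<epsilon>(1)] K \<eta>(1)] by blast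
    \<comment> \<open>On \<open>K\<close> this is close to h + g - 2 \<epsilon> = T \<Phi> - S
      \<phi> - 2 \<epsilon>, also in the gradient; off \<open>K\<close> only \<open>e\<close>,
      bounded by \<epsilon>, competes with the shift.\<close>
    define f where "f x = v x + (e x - of_real (2 * \<epsilon>))" for x
    have sf: "smooth f" unfolding f_def by (intro smooth_intros(1-3) sv(1) e(1))
    have pf: "partial k f x = partial k v x + partial k e x" for k x
      unfolding f_def
      by (subst smooth_partial_add[OF sv(1) smooth_intros(3)[OF e(1) smooth_intros(1)]],
          subst smooth_partial_diff[OF e(1) smooth_intros(1)]) (simp add: partial_const)
    have f0: "Re (f x) \<le> 0" if "x \<notin> K" for x
      using v0[OF that] e(2)[of x] complex_Re_le_cmod[of "e x"] \<epsilon>(1) by (simp add: f_def)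
    define \<psi> where "\<psi> x = complex_of_real (flat 1 \<epsilon> (Re (f x)))" for x
    have harm: "elliptic_op \<Omega> a b c c\<^sub>0 (T \<Phi>) v = 0" if "v \<in> test_functions \<Omega>" for v
      using perron_operatorD(6)[OF T c\<Phi>] that by (simp add: harmonic_def)
    note energy = energy_estimate[OF \<Omega> U(1) U(3) U(2) harm sf \<epsilon>(1) K f0, folded \<psi>_def C_def]
    have LK: "z \<in> L2 K" if "z \<in> L2 \<Omega>" for z by (rule L2_subset[OF K(2) Km \<Omega>m(1) that])
    have mono: "nsq K z \<le> nsq \<Omega> z" if "z \<in> L2 \<Omega>" for z by (rule nsq_subset[OF K(2) Km \<Omega>m(1) that])
    note Le = smooth_L2[OF e(1) \<Omega>(2) \<Omega>m(1)] smooth_L2[OF smooth_partial[OF e(1)] \<Omega>(2) \<Omega>m(1)]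
    \<comment> \<open>The squared triangle inequality, applied twice, leaves twice the squared norm
      of \<open>W l\<close> plus 8 \<eta>.\<close>
    have grad: "nsq K (\<lambda>x. U l x - partial l f x) \<le> 2 * nsq \<Omega> (W l) + 8" for l
    proof -
      have "nsq K (\<lambda>x. U l x - partial l f x)
        = nsq K (\<lambda>x. W l x + (((U l x - X l x) - partial l v x) + ((X l x - W l x) - partial l e x)))"
        by (simp add: pf algebra_simps)
      also have "\<dots> \<le> 2 * nsq K (W l) + 2 * nsq K (\<lambda>x. ((U l x - X l x) - partial l v x) + ((X l x - W l x) - partial l e x))"
        by (intro nsq_add_le L2_add LK L2_diff W U X Lt v Le)
      finally have 1: "nsq K (\<lambda>x. U l x - partial l f x) \<le> 2 * nsq K (W l)
        + 2 * nsq K (\<lambda>x. ((U l x - X l x) - partial l v x) + ((X l x - W l x) - partial l e x))" .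
      have 2: "nsq K (\<lambda>x. ((U l x - X l x) - partial l v x) + ((X l x - W l x) - partial l e x))
          \<le> 2 * nsq K (\<lambda>x. (U l x - X l x) - partial l v x) + 2 * nsq K (\<lambda>x. (X l x - W l x) - partial l e x)"
        by (intro nsq_add_le LK L2_diff W U X Lt v Le)
      have "nsq K (\<lambda>x. (U l x - X l x) - partial l v x) \<le> \<eta>"
        by (rule order_trans[OF mono Hv]) (intro L2_diff U X Lt v)
      then show ?thesis using 1 2 e(4)[of l] mono[OF W(2)[of l]] \<eta>(2) by linarith
    qed
    have uK: "nsq K (T \<Phi>) \<le> (b1 + 1)\<^sup>2 * ?m"
    proof (rule order_trans[OF mono nsq_le_const])
      show "norm (T \<Phi> x) \<le> b1 + 1" if "x \<in> \<Omega>" for x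
        using norm_triangle_sub[of "T \<Phi> x" "T \<phi> x"] near(1)[OF that] b1[OF that] \<epsilon>(2) by linarith
    qed (use U \<Omega>m in auto)
    have hb: "nsq \<Omega> h \<le> (b1 + b2 + 2)\<^sup>2 * ?m"
    proof (rule nsq_le_const[OF Lh \<Omega>m(2)])
      fix x assume x: "x \<in> \<Omega>"
      show "norm (h x) \<le> b1 + b2 + 2"
        unfolding h_def
        using norm_triangle_ineq4[of "T \<Phi> x" "S \<Phi> x"] norm_triangle_sub[of "T \<Phi> x" "T \<phi> x"]
          norm_triangle_sub[of "S \<Phi> x" "S \<phi> x"] near[OF x] b1[OF x] b2[OF x] \<epsilon>(2) by linarith
    qed
    have fK: "nsq K f \<le> 4 * (b1 + b2 + 2)\<^sup>2 * ?m + 4 + 18 * ?m"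
    proof -
      have Le2: "(\<lambda>x. e x - of_real (2 * \<epsilon>)) \<in> L2 \<Omega>"
        by (rule smooth_L2[OF smooth_intros(3)[OF e(1) smooth_intros(1)] \<Omega>(2) \<Omega>m(1)])
      have "nsq K f \<le> nsq \<Omega> f" by (rule mono[OF smooth_L2[OF sf \<Omega>(2) \<Omega>m(1)]])
      also have "\<dots> \<le> 2 * nsq \<Omega> v + 2 * nsq \<Omega> (\<lambda>x. e x - of_real (2 * \<epsilon>))"
        unfolding f_def by (intro nsq_add_le Lt v Le2)
      finally have 1: "nsq K f \<le> 2 * nsq \<Omega> v + 2 * nsq \<Omega> (\<lambda>x. e x - of_real (2 * \<epsilon>))" .
      have "nsq \<Omega> v = nsq \<Omega> (\<lambda>x. h x - (h x - v x))" by simp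
      also have "\<dots> \<le> 2 * nsq \<Omega> h + 2 * nsq \<Omega> (\<lambda>x. h x - v x)"
        by (intro nsq_diff_le Lh L2_diff Lt v)
      finally have 2: "nsq \<Omega> v \<le> 2 * (b1 + b2 + 2)\<^sup>2 * ?m + 2" using hb hv \<eta>(2) by linarith
      have 3: "nsq \<Omega> (\<lambda>x. e x - of_real (2 * \<epsilon>)) \<le> 3\<^sup>2 * ?m"
      proof (rule nsq_le_const[OF Le2 \<Omega>m(2)])
        show "norm (e x - of_real (2 * \<epsilon>)) \<le> 3" for x
          using norm_triangle_ineq4[of "e x" "of_real (2 * \<epsilon>)"] e(2)[of x] \<epsilon> by (simp add: norm_mult)
      qed
      show ?thesis using 1 2 3 by simp
    qed
    have "\<mu> / 2 * (\<Sum>k\<in>UNIV. nsq \<Omega> (partial k \<psi>)) \<le> C * Q"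
    proof (rule order_trans[OF energy(2) mult_left_mono[OF _ C]])
      show "(\<Sum>l\<in>UNIV. nsq K (\<lambda>x. U l x - partial l f x)) + nsq K (T \<Phi>) + nsq K f \<le> Q"
        unfolding Q_def by (intro add_mono sum_mono grad uK fK)
    qed
    then have bound: "(\<Sum>k\<in>UNIV. nsq \<Omega> (partial k \<psi>)) \<le> 2 / \<mu> * (C * Q)"
      using \<mu> by (simp add: field_simps)
    let ?f = "\<lambda>x. max 0 (Re (T \<phi> x - S \<phi> x))"
    \<comment> \<open>On \<open>K\<close>, one \<epsilon> comes from replacing \<phi> by \<Phi> in
      \<open>T\<close>, two from the shift and one from smoothing the positive part. Off
      \<open>K\<close>, where \<open>v\<close> is 0, the bounds on \<open>g\<close> and T \<Phi> - T
      \<phi> cost 2 \<epsilon>.\<close>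
    have pt: "\<bar>flat 1 \<epsilon> (Re (f x)) - ?f x\<bar> \<le> 4 * \<epsilon> + norm (h x - v x) + (if x \<in> K then norm (g x - e x) else 0)"
      if x: "x \<in> \<Omega>" for x
    proof -
      have id: "T \<phi> x - S \<phi> x = h x + g x - (T \<Phi> x - T \<phi> x)" by (simp add: h_def g_def)
      have t: "\<bar>Re (T \<Phi> x - T \<phi> x)\<bar> \<le> \<epsilon>" using abs_Re_le_cmod near(1)[OF x] order_trans by blast
      show ?thesis
      proof (cases "x \<in> K")
        case True
        have "\<bar>Re (f x) - Re (T \<phi> x - S \<phi> x)\<bar> \<le> norm (h x - v x) + norm (g x - e x) + 3 * \<epsilon>"
        proof -
          have "Re (f x) - Re (T \<phi> x - S \<phi> x) = - Re (h x - v x) - Re (g x - e x) + Re (T \<Phi> x - T \<phi> x) - 2 * \<epsilon>"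
            by (simp add: id f_def)
          then show ?thesis
            using abs_Re_le_cmod[of "h x - v x"] abs_Re_le_cmod[of "g x - e x"] t \<epsilon>(1) by linarith
        qed
        moreover have "\<bar>flat 1 \<epsilon> (Re (f x)) - max 0 (Re (f x))\<bar> \<le> \<epsilon>"
          using flat_1_bounds(4,5)[OF \<epsilon>(1), of "Re (f x)"] by linarith
        moreover have "\<bar>max 0 (Re (f x)) - ?f x\<bar> \<le> \<bar>Re (f x) - Re (T \<phi> x - S \<phi> x)\<bar>" by linarith
        ultimately show ?thesis using True by simp
      next
        case False
        have "flat 1 \<epsilon> (Re (f x)) = 0" using f0[OF False] by (simp add: flat_def)
        moreover have "Re (T \<phi> x - S \<phi> x) \<le> norm (h x - v x) + 2 * \<epsilon>"
        proof -
          have "Re (T \<phi> x - S \<phi> x) = Re (h x - v x) + Re (g x) - Re (T \<Phi> x - T \<phi> x)"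
            by (simp add: id v0[OF False])
          then show ?thesis
            using complex_Re_le_cmod[of "h x - v x"] complex_Re_le_cmod[of "g x"] gb[OF x] t by linarith
        qed
        ultimately show ?thesis using False \<epsilon>(1) by (simp add: max_def)
      qed
    qed
    \<comment> \<open>48 is 3 times 4^2, and 6 \<eta> collects 3 \<eta> each from h - v and g -
      e.\<close>
    have "nsq \<Omega> (\<lambda>x. \<psi> x - of_real (?f x)) \<le> 48 * \<epsilon>\<^sup>2 * ?m + 6 * \<eta>"
    proof -
      interpret finite_measure "lebesgue_on \<Omega>" by (rule finite_measure_lebesgue_on[OF \<Omega>m(2)])
      let ?G = "\<lambda>x. (norm (g x - e x))\<^sup>2"
      have iG: "integrable (lebesgue_on K) ?G" by (intro L2_integrable LK L2_diff Lg Le)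
      note iGK = integrable_lebesgue_on_extend[OF iG Km \<Omega>m(1)]
      have ihv: "integrable (lebesgue_on \<Omega>) (\<lambda>x. (norm (h x - v x))\<^sup>2)" by (intro L2_integrable L2_diff Lh Lt v)
      have "nsq \<Omega> (\<lambda>x. \<psi> x - of_real (?f x)) \<le>
        (LINT x|lebesgue_on \<Omega>. 48 * \<epsilon>\<^sup>2 + 3 * (norm (h x - v x))\<^sup>2 + 3 * (if x \<in> K then ?G x else 0))"
        unfolding nsq_def
      proof (rule integral_mono')
        show "integrable (lebesgue_on \<Omega>) (\<lambda>x. 48 * \<epsilon>\<^sup>2 + 3 * (norm (h x - v x))\<^sup>2 + 3 * (if x \<in> K then ?G x else 0))"
          using ihv iGK by simp
        fix x assume "x \<in> space (lebesgue_on \<Omega>)"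
        then have x: "x \<in> \<Omega>" by simp
        have "(norm (\<psi> x - of_real (?f x)))\<^sup>2 = \<bar>flat 1 \<epsilon> (Re (f x)) - ?f x\<bar>\<^sup>2"
          unfolding \<psi>_def by (metis norm_of_real of_real_diff)
        also have "\<dots> \<le> (4 * \<epsilon> + norm (h x - v x) + (if x \<in> K then norm (g x - e x) else 0))\<^sup>2"
          by (rule power_mono[OF pt[OF x]]) simp
        also have "\<dots> \<le> 3 * (4 * \<epsilon>)\<^sup>2 + 3 * (norm (h x - v x))\<^sup>2 + 3 * (if x \<in> K then norm (g x - e x) else 0)\<^sup>2"
          by (rule sum3_squared_le)
        finally show "(norm (\<psi> x - of_real (?f x)))\<^sup>2 \<le> 48 * \<epsilon>\<^sup>2 + 3 * (norm (h x - v x))\<^sup>2 + 3 * (if x \<in> K then ?G x else 0)"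
          by (auto simp: power_mult_distrib split: if_splits)
      qed auto
      also have "\<dots> = 48 * \<epsilon>\<^sup>2 * ?m + 3 * nsq \<Omega> (\<lambda>x. h x - v x) + 3 * nsq K (\<lambda>x. g x - e x)"
        using ihv iGK \<Omega>m Lebesgue_Measure.integral_restrict[OF K(2) Km \<Omega>m(1), of ?G]
        by (simp add: nsq_def measure_restrict_space)
      finally show ?thesis using hv e(3) by linarith
    qed
    with bound energy(1) show "\<exists>\<psi>\<in>test_functions \<Omega>. (\<Sum>k\<in>UNIV. nsq \<Omega> (partial k \<psi>)) \<le> 2 / \<mu> * (C * Q) \<and>
      nsq \<Omega> (\<lambda>x. \<psi> x - of_real (?f x)) \<le> 48 * \<epsilon>\<^sup>2 * ?m + 6 * \<eta>" by blast
  qed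
qed

text \<open>Approximants with a common gradient bound that converge in \<open>L2\<close> force the
  limit to have a square-integrable weak gradient.\<close>

lemma positive_part_H1:
  fixes a :: "'n::finite \<Rightarrow> 'n \<Rightarrow> real ^ 'n \<Rightarrow> real"
  assumes \<Omega>: "open \<Omega>" "bounded \<Omega>" and coeff: "elliptic_coefficients \<Omega> a b c c\<^sub>0"
    and T: "perron_operator \<Omega> a b c c\<^sub>0 T" and S: "perron_operator \<Omega> a' b' c' c\<^sub>0' S"
    and \<phi>: "continuous_on (frontier \<Omega>) \<phi>" and w: "S \<phi> \<in> H1 \<Omega>"
  shows "(\<lambda>x. of_real (max 0 (Re (T \<phi> x - S \<phi> x)))) \<in> H1 \<Omega>"
proof -
  have \<Omega>m: "\<Omega> \<in> sets lebesgue" "\<Omega> \<in> lmeasurable" using \<Omega> by (auto simp: bounded_set_imp_lmeasurable)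
  let ?m = "measure lebesgue \<Omega>"
  let ?f = "\<lambda>x. complex_of_real (max 0 (Re (T \<phi> x - S \<phi> x)))"
  obtain Bd where Bd: "\<And>\<epsilon> \<eta>. 0 < \<epsilon> \<Longrightarrow> \<epsilon> \<le> 1 \<Longrightarrow> 0 < \<eta> \<Longrightarrow> \<eta> \<le> 1 \<Longrightarrow>
    \<exists>\<psi>\<in>test_functions \<Omega>. (\<Sum>k\<in>UNIV. nsq \<Omega> (partial k \<psi>)) \<le> Bd \<and>
      nsq \<Omega> (\<lambda>x. \<psi> x - ?f x) \<le> 48 * \<epsilon>\<^sup>2 * ?m + 6 * \<eta>"
    using positive_part_test_approximation[OF \<Omega> coeff T S \<phi> w] by blast
  have f: "?f \<in> L2 \<Omega>"
  proof -
    have cont: "continuous_on \<Omega> ?f"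
      by (intro continuous_intros perron_operatorD(1)[OF T \<phi>] perron_operatorD(1)[OF S \<phi>])
    obtain b1 where b1: "\<And>x. x \<in> \<Omega> \<Longrightarrow> norm (T \<phi> x) \<le> b1"
      using perron_operatorD(2)[OF T \<phi>] by (auto simp: bounded_iff)
    obtain b2 where b2: "\<And>x. x \<in> \<Omega> \<Longrightarrow> norm (S \<phi> x) \<le> b2"
      using perron_operatorD(2)[OF S \<phi>] by (auto simp: bounded_iff)
    interpret finite_measure "lebesgue_on \<Omega>" by (rule finite_measure_lebesgue_on[OF \<Omega>m(2)])
    have one: "(\<lambda>x. 1) \<in> L2 \<Omega>" by (simp add: L2_def)
    have meas: "?f \<in> borel_measurable (lebesgue_on \<Omega>)"
      by (rule continuous_imp_measurable_on_sets_lebesgue[OF cont \<Omega>m(1)])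
    have "norm (?f x) \<le> b1 + b2" if "x \<in> \<Omega>" for x
      using abs_Re_le_cmod[of "T \<phi> x - S \<phi> x"] norm_triangle_ineq4[of "T \<phi> x" "S \<phi> x"] b1[OF that] b2[OF that]
      unfolding norm_of_real by linarith
    from L2_bounded_mult[OF one meas this] show ?thesis by simp
  qed
  have approx: "\<exists>p\<in>test_functions \<Omega>. nsq \<Omega> (\<lambda>x. p x - ?f x) < e \<and> (\<Sum>k\<in>UNIV. nsq \<Omega> (partial k p)) \<le> Bd"
    if e: "0 < e" for e
  proof -
    \<comment> \<open>The two choices make the error at most e/2 + e/4.\<close>
    define \<epsilon> where "\<epsilon> = min 1 (e / (96 * (?m + 1)))"
    define \<eta> where "\<eta> = min 1 (e / 24)"
    have m: "0 < ?m + 1" by (simp add: add_nonneg_pos)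
    have \<epsilon>: "0 < \<epsilon>" "\<epsilon> \<le> 1" using e m by (auto simp: \<epsilon>_def)
    have \<eta>: "0 < \<eta>" "\<eta> \<le> 1" "\<eta> \<le> e / 24" using e by (auto simp: \<eta>_def)
    have "48 * \<epsilon>\<^sup>2 * ?m \<le> e / 2"
    proof -
      have "\<epsilon>\<^sup>2 \<le> \<epsilon>" using \<epsilon> by (simp add: power2_eq_square mult_left_le)
      then have "48 * \<epsilon>\<^sup>2 * ?m \<le> 48 * \<epsilon> * (?m + 1)"
        using \<epsilon> by (intro mult_mono) auto
      also have "\<dots> \<le> 48 * (e / (96 * (?m + 1))) * (?m + 1)"
        using m by (intro mult_right_mono) (auto simp: \<epsilon>_def)
      also have "\<dots> = e / 2" using m by (simp add: field_simps)
      finally show ?thesis .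
    qed
    moreover obtain \<psi> where "\<psi> \<in> test_functions \<Omega>" "(\<Sum>k\<in>UNIV. nsq \<Omega> (partial k \<psi>)) \<le> Bd"
      "nsq \<Omega> (\<lambda>x. \<psi> x - ?f x) \<le> 48 * \<epsilon>\<^sup>2 * ?m + 6 * \<eta>"
      using Bd[OF \<epsilon> \<eta>(1,2)] by blast
    moreover from calculation have "nsq \<Omega> (\<lambda>x. \<psi> x - ?f x) < e" using \<eta>(3) e by linarith
    ultimately show ?thesis by blast
  qed
  have mid: "(\<lambda>x. (1/2) * (p x + q x)) \<in> test_functions \<Omega>" if "p \<in> test_functions \<Omega>" "q \<in> test_functions \<Omega>" for p q
    by (intro test_functions_cmult test_functions_add that)
  show ?thesis
  proof (rule weak_gradient_of_bounded_approximation[where C="test_functions \<Omega>" and V=\<Omega> and f="?f" and B=Bd])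
    fix G assume "\<And>k. G k \<in> L2 \<Omega>" "\<And>k. has_weak_partial \<Omega> k ?f (G k)"
    with f show ?thesis by (intro H1I)
  qed (fact \<Omega>(1) f mid approx | erule test_functionsD(1) test_function_L2[OF _ \<Omega>m(1)]
      test_function_L2[OF test_functions_partial \<Omega>m(1)])+
qed

text \<open>Since Re (-i z) = Im z, the factors 1, -1, -i, i yield the positive and negative parts
  of the real and imaginary parts of T \<phi> - S \<phi>, from which the difference is
  reassembled.\<close>

lemma perron_H1_transfer:
  fixes a :: "'n::finite \<Rightarrow> 'n \<Rightarrow> real ^ 'n \<Rightarrow> real"
  assumes \<Omega>: "open \<Omega>" "bounded \<Omega>" and coeff: "elliptic_coefficients \<Omega> a b c c\<^sub>0"
    and T: "perron_operator \<Omega> a b c c\<^sub>0 T" and S: "perron_operator \<Omega> a' b' c' c\<^sub>0' S"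
    and \<phi>: "continuous_on (frontier \<Omega>) \<phi>" and w: "S \<phi> \<in> H1 \<Omega>"
  shows "T \<phi> \<in> H1 \<Omega>"
proof -
  have pos: "(\<lambda>x. of_real (max 0 (Re (\<alpha> * (T \<phi> x - S \<phi> x))))) \<in> H1 \<Omega>" for \<alpha>
  proof -
    have c: "continuous_on (frontier \<Omega>) (\<lambda>z. \<alpha> * \<phi> z)" using \<phi> by (intro continuous_intros)
    have "S (\<lambda>z. \<alpha> * \<phi> z) \<in> H1 \<Omega>"
      using H1_cong[of \<Omega> "S (\<lambda>z. \<alpha> * \<phi> z)" "\<lambda>x. \<alpha> * S \<phi> x", OF perron_operatorD(4)[OF S \<phi>]] H1_cmult[OF \<Omega>(1) w] by simp
    from positive_part_H1[OF \<Omega> coeff T S c this] show ?thesis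
      by (rule H1_cong[THEN iffD1, rotated])
        (simp add: perron_operatorD(4)[OF S \<phi>] perron_operatorD(4)[OF T \<phi>] right_diff_distrib)
  qed
  let ?p = "\<lambda>\<alpha> x. complex_of_real (max 0 (Re (\<alpha> * (T \<phi> x - S \<phi> x))))"
  have "(\<lambda>x. S \<phi> x + ((?p 1 x - ?p (-1) x) + \<i> * (?p (-\<i>) x - ?p \<i> x))) \<in> H1 \<Omega>"
    by (intro H1_add[OF \<Omega>(1)] H1_diff[OF \<Omega>(1)] H1_cmult[OF \<Omega>(1)] w pos)
  moreover have "S \<phi> x + ((?p 1 x - ?p (-1) x) + \<i> * (?p (-\<i>) x - ?p \<i> x)) = T \<phi> x" for x
    by (simp add: complex_eq_iff max_def)
  ultimately show ?thesis by simp
qed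

text \<open>The form equals |\<xi>|^2, so \<mu> = 1 works. This makes -\<Delta> available as the
  target of the transfer.\<close>

lemma Laplace_elliptic: "elliptic_coefficients \<Omega> (\<lambda>k l x. if k = l then 1 else 0) (\<lambda>k x. 0) (\<lambda>k x. 0) (\<lambda>x. 0)"
proof -
  have id: "Re (\<Sum>k\<in>UNIV. \<Sum>l\<in>UNIV. of_real (if k = l then 1 else 0) * \<xi> $ k * cnj (\<xi> $ l)) = (norm \<xi>)\<^sup>2" for \<xi> :: "complex ^ 'n::finite"
  proof -
    have "(\<Sum>l\<in>UNIV. of_real (if k = l then 1 else 0) * \<xi> $ k * cnj (\<xi> $ l)) = \<xi> $ k * cnj (\<xi> $ k)" for k
      by (simp add: if_distrib[of of_real] if_distrib[of "\<lambda>z. z * _"] cong: if_cong)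
    then have "(\<Sum>l\<in>UNIV. of_real (if k = l then 1 else 0) * \<xi> $ k * cnj (\<xi> $ l)) = of_real ((norm (\<xi> $ k))\<^sup>2)" for k
      by (simp only: complex_norm_square)
    then show ?thesis by (simp add: norm_vec_def L2_set_def sum_nonneg)
  qed
  show ?thesis
    unfolding elliptic_coefficients_def
  proof (intro conjI allI exI[of _ 1] ballI)
    fix x and \<xi> :: "complex ^ 'a"
    show "1 * (norm \<xi>)\<^sup>2 \<le> Re (\<Sum>k\<in>UNIV. \<Sum>l\<in>UNIV. of_real (if k = l then 1 else 0) * \<xi> $ k * cnj (\<xi> $ l))"
      by (simp only: id mult_1)
  qed (auto simp: bounded_iff)
qed

theorem corollary4p5:
  fixes \<Omega> :: "(real ^ 'n::finite) set"
    and a :: "'n \<Rightarrow> 'n \<Rightarrow> real ^ 'n \<Rightarrow> real"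
    and b :: "'n \<Rightarrow> real ^ 'n \<Rightarrow> complex"
    and c :: "'n \<Rightarrow> real ^ 'n \<Rightarrow> real"
    and c\<^sub>0 :: "real ^ 'n \<Rightarrow> complex"
    and T T\<^sub>\<Delta> :: "(real ^ 'n \<Rightarrow> complex) \<Rightarrow> real ^ 'n \<Rightarrow> complex"
    and \<phi> :: "real ^ 'n \<Rightarrow> complex"
  assumes "CARD('n) \<ge> 2"
    and "open \<Omega>" and "bounded \<Omega>"
    and "elliptic_coefficients \<Omega> a b c c\<^sub>0"
    and "\<not> zero_Dirichlet_eigenvalue \<Omega> a b c c\<^sub>0"
    and "perron_operator \<Omega> a b c c\<^sub>0 T"
    and "perron_operator_neg_Laplace \<Omega> T\<^sub>\<Delta>"
    and "continuous_on (frontier \<Omega>) \<phi>"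
  shows "T \<phi> \<in> H1 \<Omega> \<longleftrightarrow> T\<^sub>\<Delta> \<phi> \<in> H1 \<Omega>"
  using perron_H1_transfer[OF assms(2,3) Laplace_elliptic assms(7)[unfolded perron_operator_neg_Laplace_def] assms(6,8)]
    perron_H1_transfer[OF assms(2-4,6) assms(7)[unfolded perron_operator_neg_Laplace_def] assms(8)]
  by blast

end
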